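(* For each $n\ge2$ and each $r\in(0,+\infty]$, the Fréchet $\mathcal{O}(\mathbb{C}^\times)$-module $\mathcal{O}_{\mathrm{def}}(\mathbb{D}^n_r)$ is not topologically projective (and hence is not topologically free).
   Context: All algebras are complex, associative and unital; a Fréchet algebra is a complete metrizable locally convex algebra. $\mathbb{C}^\times=\mathbb{C}\setminus\{0\}$; $\mathcal{O}(\mathbb{C}^\times)$ is the Fréchet algebra of holomorphic functions on $\mathbb{C}^\times$ (compact-open topology). Definition of $\mathcal{O}_{\mathrm{def}}(\mathbb{D}^n_r)$. $W_{n,d}=\{1,\dots,n\}^d$, $W_n=\bigsqcup_{d\ge0}W_{n,d}$, $|\alpha|=d$ for $\alpha\in W_{n,d}$, $\zeta_\alpha=\zeta_{\alpha_1}\cdots\zeta_{\alpha_d}$. $\mathrm{s}(\alpha)=\mathrm{card}\{i\in\{1,\dots,d-1\}:\alpha_i\ne\alpha_{i+1}\}$ if $d=|\alpha|\ge2$, and $\mathrm{s}(\alpha)=|\alpha|-1$ if $|\alpha|\le1$. $\mathcal{F}(\mathbb{D}^n_r)$ is the Fréchet algebra of all formal series $a=\sum_{\alpha\in W_n}c_\alpha\zeta_\alpha$ in free variables $\zeta_1,\dots,\zeta_n$ with $\|a\|_{\rho,\tau}=\sum_\alpha|c_\alpha|\rho^{|\alpha|}\tau^{\mathrm{s}(\alpha)+1}<\infty$ for all $\rho\in(0,r)$, $\tau\ge1$, with the obvious multiplication and the topology given by these norms (a concrete form of the Arens-Michael free product of $n$ copies of the algebra of holomorphic functions on the disk of radius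 $r$). $\mathcal{O}(\mathbb{C}^\times,\mathcal{F}(\mathbb{D}^n_r))$ is the Fréchet algebra of holomorphic $\mathcal{F}(\mathbb{D}^n_r)$-valued functions on $\mathbb{C}^\times$ (compact-open topology), canonically an $\mathcal{O}(\mathbb{C}^\times)$-algebra; $z\in\mathcal{O}(\mathbb{C}^\times)$ is the coordinate. $I_{\mathbb{D}}$ is its closed two-sided ideal generated by $\zeta_i\zeta_j-z\zeta_j\zeta_i$ ($i<j$), and $\mathcal{O}_{\mathrm{def}}(\mathbb{D}^n_r)=\mathcal{O}(\mathbb{C}^\times,\mathcal{F}(\mathbb{D}^n_r))/I_{\mathbb{D}}$. Modules. Let $A$ be a Fréchet algebra. A left Fréchet $A$-module is a left $A$-module $X$ with a Fréchet space topology such that the action $A\times X\to X$ is continuous; morphisms are continuous $A$-module maps. A morphism $\sigma\colon X\to Y$ is an admissible epimorphism if there is a continuous linear map $\varkappa\colon Y\to X$ with $\sigma\varkappa=1_Y$. A left Fréchet $A$-module $P$ is topologically projective if for each admissible epimorphism $X\to Y$ of left Fréchet $A$-modules the induced map $\mathrm{Hom}_A(P,X)\to\mathrm{Hom}_A(P,Y)$ is onto. A left Fréchet $A$-module is topologically free if it is isomorphic to $A\,\widehat\otimes\,E$ (completed projective tensor product) for some Fréchet space $E$. *)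

theory Defs
  imports "HOL-Complex_Analysis.Complex_Analysis" "HOL-Algebra.QuotRing" "HOL-Algebra.Module"
begin

section \<open>Frechet spaces and Frechet modules\<close>

definition complex_ring :: "complex ring" where
  "complex_ring = \<lparr>carrier = UNIV, monoid.mult = (*), one = 1, zero = 0, add = (+)\<rparr>"

text \<open>
  A complex vector space with a topology. As usual in HOL-Algebra, the fields for multiplication and
  unit are meaningful only if the space is used as an algebra; otherwise they are ignored.
  In the second record, \<open>act\<close> is the action of an algebra with elements of type \<open>'a\<close>.
\<close>

record 'x tvs = "(complex, 'x) module" +
  top_of :: "'x topology"

record ('a, 'x) tmod = "'x tvs" +
  act :: "'a \<Rightarrow> 'x \<Rightarrow> 'x"

definition seminorm_on :: "(complex, 'x, 'm) module_scheme \<Rightarrow> ('x \<Rightarrow> real) \<Rightarrow> bool" where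
  "seminorm_on E p \<longleftrightarrow>
     (\<forall>x\<in>carrier E. 0 \<le> p x) \<and>
     (\<forall>x\<in>carrier E. \<forall>y\<in>carrier E. p (x \<oplus>\<^bsub>E\<^esub> y) \<le> p x + p y) \<and>
     (\<forall>c. \<forall>x\<in>carrier E. p (c \<odot>\<^bsub>E\<^esub> x) = cmod c * p x)"

text \<open>The carrier is added to the subbasis only to cover the case of an empty family of seminorms.\<close>

definition seminorm_topology ::
    "(complex, 'x, 'm) module_scheme \<Rightarrow> ('x \<Rightarrow> real) set \<Rightarrow> 'x topology" where
  "seminorm_topology E S = topology_generated_by
     (insert (carrier E)
       {{y \<in> carrier E. p (y \<ominus>\<^bsub>E\<^esub> x) < \<epsilon>} | p x \<epsilon>. p \<in> S \<and> x \<in> carrier E \<and> 0 < \<epsilon>})"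

definition tvs_Cauchy :: "('x, 'm) tvs_scheme \<Rightarrow> (nat \<Rightarrow> 'x) \<Rightarrow> bool" where
  "tvs_Cauchy E u \<longleftrightarrow>
     (\<forall>k. u k \<in> carrier E) \<and>
     (\<forall>V. openin (top_of E) V \<and> \<zero>\<^bsub>E\<^esub> \<in> V \<longrightarrow> (\<exists>N. \<forall>k\<ge>N. \<forall>l\<ge>N. u k \<ominus>\<^bsub>E\<^esub> u l \<in> V))"

text \<open>Complete metrizable locally convex space; by metrizability, sequential completeness is
  completeness.\<close>

definition frechet_space :: "('x, 'm) tvs_scheme \<Rightarrow> bool" where
  "frechet_space E \<longleftrightarrow>
     Module.module complex_ring E \<and>
     (\<exists>S. (\<forall>p\<in>S. seminorm_on E p) \<and> top_of E = seminorm_topology E S) \<and>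
     metrizable_space (top_of E) \<and>
     (\<forall>u. tvs_Cauchy E u \<longrightarrow> (\<exists>l. limitin (top_of E) u l sequentially))"

definition continuous_linear ::
    "('x, 'm) tvs_scheme \<Rightarrow> ('y, 'l) tvs_scheme \<Rightarrow> ('x \<Rightarrow> 'y) \<Rightarrow> bool" where
  "continuous_linear E F f \<longleftrightarrow>
     f \<in> carrier E \<rightarrow> carrier F \<and>
     (\<forall>x\<in>carrier E. \<forall>y\<in>carrier E. f (x \<oplus>\<^bsub>E\<^esub> y) = f x \<oplus>\<^bsub>F\<^esub> f y) \<and>
     (\<forall>c. \<forall>x\<in>carrier E. f (c \<odot>\<^bsub>E\<^esub> x) = c \<odot>\<^bsub>F\<^esub> f x) \<and>
     continuous_map (top_of E) (top_of F) f"

definition continuous_bilinear ::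
    "('x, 'm) tvs_scheme \<Rightarrow> ('y, 'l) tvs_scheme \<Rightarrow> ('z, 'k) tvs_scheme \<Rightarrow> ('x \<Rightarrow> 'y \<Rightarrow> 'z) \<Rightarrow> bool" where
  "continuous_bilinear E F G b \<longleftrightarrow>
     (\<forall>x\<in>carrier E. \<forall>y\<in>carrier F. b x y \<in> carrier G) \<and>
     (\<forall>x\<in>carrier E. \<forall>x'\<in>carrier E. \<forall>y\<in>carrier F. b (x \<oplus>\<^bsub>E\<^esub> x') y = b x y \<oplus>\<^bsub>G\<^esub> b x' y) \<and>
     (\<forall>x\<in>carrier E. \<forall>y\<in>carrier F. \<forall>y'\<in>carrier F. b x (y \<oplus>\<^bsub>F\<^esub> y') = b x y \<oplus>\<^bsub>G\<^esub> b x y') \<and>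
     (\<forall>c. \<forall>x\<in>carrier E. \<forall>y\<in>carrier F.
        b (c \<odot>\<^bsub>E\<^esub> x) y = c \<odot>\<^bsub>G\<^esub> b x y \<and> b x (c \<odot>\<^bsub>F\<^esub> y) = c \<odot>\<^bsub>G\<^esub> b x y) \<and>
     continuous_map (prod_topology (top_of E) (top_of F)) (top_of G) (\<lambda>(x, y). b x y)"

text \<open>
  From here on, \<open>A\<close> stands for a (not necessarily commutative) Frechet algebra. Note that
  \<open>Module.module\<close> is only used over the complex numbers, since it requires a commutative ring.
\<close>

definition frechet_module :: "('a, 'm) tvs_scheme \<Rightarrow> ('a, 'x, 'l) tmod_scheme \<Rightarrow> bool" where
  "frechet_module A X \<longleftrightarrow>
     frechet_space X \<and>
     continuous_bilinear A X X (act X) \<and>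
     (\<forall>x\<in>carrier X. act X \<one>\<^bsub>A\<^esub> x = x) \<and>
     (\<forall>a\<in>carrier A. \<forall>b\<in>carrier A. \<forall>x\<in>carrier X. act X (a \<otimes>\<^bsub>A\<^esub> b) x = act X a (act X b x))"

definition tmod_hom ::
    "('a, 'm) tvs_scheme \<Rightarrow> ('a, 'x, 'l) tmod_scheme \<Rightarrow> ('a, 'y, 'k) tmod_scheme \<Rightarrow> ('x \<Rightarrow> 'y) \<Rightarrow> bool" where
  "tmod_hom A X Y f \<longleftrightarrow>
     continuous_linear X Y f \<and>
     (\<forall>a\<in>carrier A. \<forall>x\<in>carrier X. f (act X a x) = act Y a (f x))"

definition tmod_iso ::
    "('a, 'm) tvs_scheme \<Rightarrow> ('a, 'x, 'l) tmod_scheme \<Rightarrow> ('a, 'y, 'k) tmod_scheme \<Rightarrow> bool" where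
  "tmod_iso A X Y \<longleftrightarrow>
     (\<exists>f g. tmod_hom A X Y f \<and> tmod_hom A Y X g \<and>
        (\<forall>x\<in>carrier X. g (f x) = x) \<and> (\<forall>y\<in>carrier Y. f (g y) = y))"

definition admissible_epi ::
    "('a, 'm) tvs_scheme \<Rightarrow> ('a, 'x, 'l) tmod_scheme \<Rightarrow> ('a, 'y, 'k) tmod_scheme \<Rightarrow> ('x \<Rightarrow> 'y) \<Rightarrow> bool" where
  "admissible_epi A X Y \<sigma> \<longleftrightarrow>
     tmod_hom A X Y \<sigma> \<and> (\<exists>\<kappa>. continuous_linear Y X \<kappa> \<and> (\<forall>y\<in>carrier Y. \<sigma> (\<kappa> y) = y))"

text \<open>
  HOL cannot quantify over all types inside a definition, so the test modules \<open>X\<close> and \<open>Y\<close> have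
  their carriers in the type \<open>nat \<Rightarrow> 'a \<times> 'p\<close>, where \<open>'a\<close> and \<open>'p\<close> are the types of the elements of
  \<open>A\<close> and \<open>P\<close>. This loses nothing: for a Frechet module \<open>P\<close>, lifting the identity of \<open>P\<close> along the
  admissible epimorphism \<open>A \<otimes> P \<rightarrow> P\<close> from the completed projective tensor product already yields
  the lifting property for all test modules. Every element of \<open>A \<otimes> P\<close> is the sum of a series of
  elementary tensors, so both of these modules have isomorphic copies with carriers in
  \<open>nat \<Rightarrow> 'a \<times> 'p\<close>. In any case, a lifting problem in this type that has no solution is an
  unsolvable lifting problem in the unrestricted sense.

  That \<open>P\<close> is a Frechet module is understood, and is not part of the predicate, so that the negation
  of the predicate always means that some lifting problem has no solution.
\<close>

definition topologically_projective ::
    "('a, 'm) tvs_scheme \<Rightarrow> ('a, 'p, 'l) tmod_scheme \<Rightarrow> bool" where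
  "topologically_projective A P \<longleftrightarrow>
     (\<forall>(X :: ('a, nat \<Rightarrow> 'a \<times> 'p) tmod) (Y :: ('a, nat \<Rightarrow> 'a \<times> 'p) tmod) \<sigma>.
        frechet_module A X \<and> frechet_module A Y \<and> admissible_epi A X Y \<sigma> \<longrightarrow>
        (\<forall>\<phi>. tmod_hom A P Y \<phi> \<longrightarrow>
           (\<exists>\<psi>. tmod_hom A P X \<psi> \<and> (\<forall>x\<in>carrier P. \<sigma> (\<psi> x) = \<phi> x))))"

text \<open>
  The completed projective tensor product of two Frechet spaces, given by its universal property: \<open>T\<close>
  is a Frechet space, and \<open>\<theta>\<close> is universal among the continuous bilinear maps on \<open>A \<times> E\<close> with values
  in Frechet spaces. As above, the type \<open>nat \<Rightarrow> 'a \<times> 'e\<close> is large enough to contain a copy of the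
  tensor product, whose elements are sums of series of elementary tensors.
\<close>

definition projective_tensor_product ::
    "('a, 'm) tvs_scheme \<Rightarrow> ('e, 'l) tvs_scheme \<Rightarrow> (nat \<Rightarrow> 'a \<times> 'e, 'k) tvs_scheme \<Rightarrow>
     ('a \<Rightarrow> 'e \<Rightarrow> (nat \<Rightarrow> 'a \<times> 'e)) \<Rightarrow> bool" where
  "projective_tensor_product A E T \<theta> \<longleftrightarrow>
     frechet_space T \<and> continuous_bilinear A E T \<theta> \<and>
     (\<forall>(F :: (nat \<Rightarrow> 'a \<times> 'e) tvs) b. frechet_space F \<and> continuous_bilinear A E F b \<longrightarrow>
        (\<exists>f. continuous_linear T F f \<and> (\<forall>a\<in>carrier A. \<forall>e\<in>carrier E. f (\<theta> a e) = b a e) \<and>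
           (\<forall>g. continuous_linear T F g \<and> (\<forall>a\<in>carrier A. \<forall>e\<in>carrier E. g (\<theta> a e) = b a e) \<longrightarrow>
              (\<forall>t\<in>carrier T. g t = f t))))"

definition topologically_free ::
    "'e itself \<Rightarrow> ('a, 'm) tvs_scheme \<Rightarrow> ('a, 'p, 'l) tmod_scheme \<Rightarrow> bool" where
  "topologically_free TYPE('e) A P \<longleftrightarrow>
     (\<exists>(E :: 'e tvs) (T :: ('a, nat \<Rightarrow> 'a \<times> 'e) tmod) \<theta>.
        frechet_space E \<and> projective_tensor_product A E T \<theta> \<and> frechet_module A T \<and>
        (\<forall>a\<in>carrier A. \<forall>b\<in>carrier A. \<forall>e\<in>carrier E. act T a (\<theta> b e) = \<theta> (a \<otimes>\<^bsub>A\<^esub> b) e) \<and>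
        tmod_iso A P T)"


section \<open>Algebras of holomorphic functions\<close>

definition compact_open ::
    "complex set \<Rightarrow> 'x topology \<Rightarrow> (complex \<Rightarrow> 'x) set \<Rightarrow> (complex \<Rightarrow> 'x) topology" where
  "compact_open U T C = topology_generated_by
     {{f \<in> C. f ` K \<subseteq> V} | K V. compact K \<and> K \<subseteq> U \<and> openin T V}"

text \<open>Functions on \<open>U\<close> are represented by functions that are \<open>undefined\<close> outside \<open>U\<close>.\<close>

definition hol :: "complex set \<Rightarrow> (complex \<Rightarrow> complex) tvs" where
  "hol U =
     \<lparr>carrier = {f \<in> extensional U. f holomorphic_on U},
      monoid.mult = (\<lambda>f g. \<lambda>z\<in>U. f z * g z), one = (\<lambda>z\<in>U. 1),
      zero = (\<lambda>z\<in>U. 0), add = (\<lambda>f g. \<lambda>z\<in>U. f z + g z),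
      smult = (\<lambda>c f. \<lambda>z\<in>U. c * f z),
      top_of = compact_open U euclidean {f \<in> extensional U. f holomorphic_on U}\<rparr>"

definition vector_holomorphic_on ::
    "('x, 'm) tvs_scheme \<Rightarrow> (complex \<Rightarrow> 'x) \<Rightarrow> complex set \<Rightarrow> bool" where
  "vector_holomorphic_on A f U \<longleftrightarrow>
     (\<forall>z\<in>U. \<exists>d. limitin (top_of A) (\<lambda>w. inverse (w - z) \<odot>\<^bsub>A\<^esub> (f w \<ominus>\<^bsub>A\<^esub> f z)) d (at z within U))"

text \<open>The algebra of holomorphic functions on \<open>U\<close> with values in \<open>A\<close>, as an algebra over \<open>hol U\<close>.\<close>

definition hol_valued ::
    "complex set \<Rightarrow> ('x, 'm) tvs_scheme \<Rightarrow> (complex \<Rightarrow> complex, complex \<Rightarrow> 'x) tmod" where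
  "hol_valued U A =
     \<lparr>carrier = {f \<in> U \<rightarrow>\<^sub>E carrier A. vector_holomorphic_on A f U},
      monoid.mult = (\<lambda>f g. \<lambda>z\<in>U. f z \<otimes>\<^bsub>A\<^esub> g z), one = (\<lambda>z\<in>U. \<one>\<^bsub>A\<^esub>),
      zero = (\<lambda>z\<in>U. \<zero>\<^bsub>A\<^esub>), add = (\<lambda>f g. \<lambda>z\<in>U. f z \<oplus>\<^bsub>A\<^esub> g z),
      smult = (\<lambda>c f. \<lambda>z\<in>U. c \<odot>\<^bsub>A\<^esub> f z),
      top_of = compact_open U (top_of A) {f \<in> U \<rightarrow>\<^sub>E carrier A. vector_holomorphic_on A f U},
      act = (\<lambda>g f. \<lambda>z\<in>U. g z \<odot>\<^bsub>A\<^esub> f z)\<rparr>"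


section \<open>Closed ideals and quotients\<close>

definition closed_ideal_generated :: "('x, 'm) tvs_scheme \<Rightarrow> 'x set \<Rightarrow> 'x set" where
  "closed_ideal_generated R G = \<Inter>{J. ideal J R \<and> closedin (top_of R) J \<and> G \<subseteq> J}"

text \<open>
  The ring \<open>R Quot J\<close> with the quotient topology and the induced actions; the unions below are
  over the representatives of a coset, and all their members coincide.
\<close>

definition quotient_tmod :: "('a, 'x) tmod \<Rightarrow> 'x set \<Rightarrow> ('a, 'x set) tmod" where
  "quotient_tmod R J =
     \<lparr>carrier = carrier (R Quot J), monoid.mult = monoid.mult (R Quot J), one = one (R Quot J),
      zero = zero (R Quot J), add = add (R Quot J),
      smult = (\<lambda>c Q. \<Union>x\<in>Q. J +>\<^bsub>R\<^esub> (c \<odot>\<^bsub>R\<^esub> x)),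
      top_of = topology (\<lambda>W. W \<subseteq> carrier (R Quot J) \<and>
                              openin (top_of R) {x \<in> carrier R. J +>\<^bsub>R\<^esub> x \<in> W}),
      act = (\<lambda>a Q. \<Union>x\<in>Q. J +>\<^bsub>R\<^esub> (act R a x))\<rparr>"


section \<open>The free polydisk algebra\<close>

definition words :: "nat \<Rightarrow> nat list set" where
  "words n = lists {1..n}"

text \<open>List indices start at 0, so \<open>\<alpha> ! (i - 1)\<close> is the \<open>i\<close>-th letter. Note that \<open>switches [] = -1\<close>.\<close>

definition switches :: "nat list \<Rightarrow> int" where
  "switches \<alpha> =
     (if 2 \<le> length \<alpha> then int (card {i \<in> {1..length \<alpha> - 1}. \<alpha> ! (i - 1) \<noteq> \<alpha> ! i})
      else int (length \<alpha>) - 1)"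

definition free_disk_term :: "real \<Rightarrow> real \<Rightarrow> (nat list \<Rightarrow> complex) \<Rightarrow> nat list \<Rightarrow> real" where
  "free_disk_term \<rho> \<tau> c \<alpha> = cmod (c \<alpha>) * \<rho> ^ length \<alpha> * \<tau> powi (switches \<alpha> + 1)"

definition free_disk_norm :: "nat \<Rightarrow> real \<Rightarrow> real \<Rightarrow> (nat list \<Rightarrow> complex) \<Rightarrow> real" where
  "free_disk_norm n \<rho> \<tau> c = (\<Sum>\<^sub>\<infinity>\<alpha>\<in>words n. free_disk_term \<rho> \<tau> c \<alpha>)"

text \<open>A formal series is represented by its family of coefficients, extended by zero to all lists.\<close>

definition free_disk_alg :: "nat \<Rightarrow> ereal \<Rightarrow> (complex, nat list \<Rightarrow> complex) module" where
  "free_disk_alg n r =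
     \<lparr>carrier = {c. (\<forall>\<alpha>. \<alpha> \<notin> words n \<longrightarrow> c \<alpha> = 0) \<and>
                    (\<forall>\<rho> \<tau>. 0 < \<rho> \<and> ereal \<rho> < r \<and> 1 \<le> \<tau> \<longrightarrow> free_disk_term \<rho> \<tau> c summable_on words n)},
      monoid.mult = (\<lambda>a b \<gamma>. \<Sum>(\<alpha>, \<beta>) | \<alpha> @ \<beta> = \<gamma>. a \<alpha> * b \<beta>), one = (\<lambda>\<alpha>. if \<alpha> = [] then 1 else 0),
      zero = (\<lambda>\<alpha>. 0), add = (\<lambda>a b \<alpha>. a \<alpha> + b \<alpha>),
      smult = (\<lambda>c a \<alpha>. c * a \<alpha>)\<rparr>"

definition free_disk :: "nat \<Rightarrow> ereal \<Rightarrow> (nat list \<Rightarrow> complex) tvs" where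
  "free_disk n r = module.extend (free_disk_alg n r)
     (tvs.fields (seminorm_topology (free_disk_alg n r)
        {free_disk_norm n \<rho> \<tau> | \<rho> \<tau>. 0 < \<rho> \<and> ereal \<rho> < r \<and> 1 \<le> \<tau>}))"


section \<open>The holomorphic deformation\<close>

definition punctured_plane :: "complex set" where
  "punctured_plane = - {0}"

definition free_gen :: "nat \<Rightarrow> complex \<Rightarrow> nat list \<Rightarrow> complex" where
  "free_gen i = (\<lambda>z\<in>punctured_plane. \<lambda>\<alpha>. if \<alpha> = [i] then 1 else 0)"

definition coordinate :: "complex \<Rightarrow> complex" where
  "coordinate = (\<lambda>z\<in>punctured_plane. z)"

definition hol_free_disk ::
    "nat \<Rightarrow> ereal \<Rightarrow> (complex \<Rightarrow> complex, complex \<Rightarrow> nat list \<Rightarrow> complex) tmod" where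
  "hol_free_disk n r = hol_valued punctured_plane (free_disk n r)"

definition def_ideal :: "nat \<Rightarrow> ereal \<Rightarrow> (complex \<Rightarrow> nat list \<Rightarrow> complex) set" where
  "def_ideal n r = closed_ideal_generated (hol_free_disk n r)
     {free_gen i \<otimes>\<^bsub>hol_free_disk n r\<^esub> free_gen j \<ominus>\<^bsub>hol_free_disk n r\<^esub>
        act (hol_free_disk n r) coordinate (free_gen j \<otimes>\<^bsub>hol_free_disk n r\<^esub> free_gen i)
      | i j. 1 \<le> i \<and> i < j \<and> j \<le> n}"

definition deformed_polydisk ::
    "nat \<Rightarrow> ereal \<Rightarrow> (complex \<Rightarrow> complex, (complex \<Rightarrow> nat list \<Rightarrow> complex) set) tmod" where
  "deformed_polydisk n r = quotient_tmod (hol_free_disk n r) (def_ideal n r)"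

end

theory Submission
  imports Defs "HOL-Real_Asymp.Real_Asymp"
begin

text \<open>
  Fix \<open>0 < \<rho> < r\<close>. Sending every \<open>\<zeta>\<^sub>i\<close> to \<open>\<rho>\<close> and \<open>z\<close> to \<open>1\<close> defines a continuous character of
  \<open>\<O>\<^sub>d\<^sub>e\<^sub>f\<close>, that is, a module morphism to \<open>\<complex>\<close>, on which functions act by their value at \<open>1\<close>.
  Evaluation at \<open>1\<close> maps the Banach module of continuous functions on the annulus
  \<open>K = {1/2 \<le> \<bar>z\<bar> \<le> 2}\<close> that are holomorphic inside it onto \<open>\<complex>\<close>, and the constants split this
  epimorphism. The character does not lift: the images \<open>g\<close> and \<open>h\<close> of \<open>\<zeta>\<^sub>1\<^sup>k \<zeta>\<^sub>2\<^sup>k\<close> and \<open>\<zeta>\<^sub>2\<^sup>k \<zeta>\<^sub>1\<^sup>k\<close> under a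
  lift would satisfy \<open>g = z\<^bsup>k*k\<^esup> h\<close>, and by continuity they are bounded on \<open>K\<close> by \<open>k!\<close> for large
  \<open>k\<close>. Hence \<open>g h\<close> is at most \<open>k!\<^sup>2 / 2\<^bsup>k*k\<^esup>\<close> on the boundary of \<open>K\<close>, whereas its value at \<open>1\<close> is
  \<open>\<rho>\<^bsup>4*k\<^esup>\<close>, which contradicts the maximum principle.
\<close>

section \<open>The free disk algebra\<close>

text \<open>Moving k letters past k letters costs a factor z^(k^2), exponential in k^2, while every
  seminorm of a word of length 2k is at most exponential in k. So division by k! sends both families
  of words to 0 in all seminorms at once, whatever the radii and also for r infinite, and the loss
  k!^2 remains negligible against 2^(k^2). A lift then enters only through its continuity along
  these null sequences and its module law, and no seminorm of the quotient has to be computed. The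
  source A(K) has a single norm, so one limit bounds g and h on both boundary circles together. The
  fibre at 1 is where the relations become plain commutativity, so characters with all generators
  nonzero exist there; the neighbouring fibres with modulus different from 1 force g h to be tiny.
  The two claims of the theorem concern lifting problems in different types: projectivity uses the
  type of the elements of P, freeness the type of the space E. The test modules are therefore built
  with a free type parameter, and the same unsolvable problem is posed twice.\<close>

definition word_weight :: "real \<Rightarrow> real \<Rightarrow> nat list \<Rightarrow> real" where
  "word_weight \<rho> \<tau> \<alpha> = \<rho> ^ length \<alpha> * \<tau> ^ length (remdups_adj \<alpha>)"

text \<open>\<open>switches\<close> plus one counts the maximal constant blocks of a word; the
  convention for words of length at most one is what makes this hold there as well. Counting blocks
  turns the integer power in the norm into a natural one and makes submultiplicativity
  visible.\<close>

lemma switches_eq: "switches \<alpha> + 1 = int (length (remdups_adj \<alpha>))"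
proof (induction \<alpha> rule: remdups_adj.induct)
  case (3 a b l)
  let ?S = "\<lambda>\<alpha>. {i \<in> {1..length \<alpha> - 1}. \<alpha> ! (i - 1) \<noteq> \<alpha> ! i}"
  \<comment> \<open>For a nonempty word both branches of \<open>switches\<close> agree: a single
    letter leaves an empty index set.\<close>
  have card_eq: "switches (b # l) + 1 = int (card (?S (b # l))) + 1"
    by (cases l) (auto simp: switches_def)
  have "?S (a # b # l) = (if a \<noteq> b then {1} else {}) \<union> Suc ` ?S (b # l)"
  proof (rule Set.set_eqI)
    fix i show "i \<in> ?S (a # b # l) \<longleftrightarrow> i \<in> (if a \<noteq> b then {1} else {}) \<union> Suc ` ?S (b # l)"
    proof (cases i)
      case (Suc j) then show ?thesis by (cases j) (auto simp: image_iff)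
    qed auto
  qed
  moreover have "card (Suc ` ?S (b # l)) = card (?S (b # l))"
    by (rule card_image) simp
  moreover have "{1} \<inter> Suc ` ?S (b # l) = {}" by auto
  ultimately have "card (?S (a # b # l)) = (if a \<noteq> b then 1 else 0) + card (?S (b # l))"
    by (simp add: card_insert_if)
  then show ?case using 3 card_eq by (auto simp: switches_def)
qed (auto simp: switches_def)

lemma free_disk_term_eq: "free_disk_term \<rho> \<tau> c \<alpha> = cmod (c \<alpha>) * word_weight \<rho> \<tau> \<alpha>"
  by (simp add: free_disk_term_def word_weight_def switches_eq)

text \<open>Concatenation keeps all blocks, except that the last block of \<open>xs\<close> may
  merge with the first of \<open>ys\<close>. For \<tau> at least 1 this makes the weights
  submultiplicative, and hence the norms.\<close>

lemma length_remdups_adj_append: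
  "length (remdups_adj (xs @ ys)) \<le> length (remdups_adj xs) + length (remdups_adj ys)"
proof (induction xs rule: remdups_adj.induct)
  case (2 x)
  then show ?case by (cases ys) auto
qed auto

lemma word_weight_nonneg: "0 < \<rho> \<Longrightarrow> 1 \<le> \<tau> \<Longrightarrow> 0 \<le> word_weight \<rho> \<tau> \<alpha>"
  by (simp add: word_weight_def)

lemma word_weight_append:
  assumes "0 < \<rho>" "1 \<le> \<tau>"
  shows "word_weight \<rho> \<tau> (\<alpha> @ \<beta>) \<le> word_weight \<rho> \<tau> \<alpha> * word_weight \<rho> \<tau> \<beta>"
proof -
  have "\<tau> ^ length (remdups_adj (\<alpha> @ \<beta>)) \<le> \<tau> ^ (length (remdups_adj \<alpha>) + length (remdups_adj \<beta>))"
    using length_remdups_adj_append assms(2) by (rule power_increasing)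
  then show ?thesis
    using assms by (simp add: word_weight_def power_add mult_left_mono algebra_simps)
qed

definition admissible_radii :: "ereal \<Rightarrow> real \<Rightarrow> real \<Rightarrow> bool" where
  "admissible_radii r \<rho> \<tau> \<longleftrightarrow> 0 < \<rho> \<and> ereal \<rho> < r \<and> 1 \<le> \<tau>"

definition splits :: "'a list \<Rightarrow> ('a list \<times> 'a list) set" where
  "splits \<gamma> = {(\<alpha>, \<beta>). \<alpha> @ \<beta> = \<gamma>}"

definition word_conv :: "(nat list \<Rightarrow> complex) \<Rightarrow> (nat list \<Rightarrow> complex) \<Rightarrow> nat list \<Rightarrow> complex" where
  "word_conv a b \<gamma> = (\<Sum>(\<alpha>, \<beta>)\<in>splits \<gamma>. a \<alpha> * b \<beta>)"

lemma finite_splits: "finite (splits \<gamma>)"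
proof -
  have "splits \<gamma> \<subseteq> (\<lambda>i. (take i \<gamma>, drop i \<gamma>)) ` {..length \<gamma>}"
  proof clarify
    fix \<alpha> \<beta> assume "(\<alpha>, \<beta>) \<in> splits \<gamma>"
    then show "(\<alpha>, \<beta>) \<in> (\<lambda>i. (take i \<gamma>, drop i \<gamma>)) ` {..length \<gamma>}"
      by (intro image_eqI[of _ _ "length \<alpha>"]) (auto simp: splits_def)
  qed
  then show ?thesis by (rule finite_subset) simp
qed

lemma free_disk_simps:
  "monoid.mult (free_disk n r) = word_conv"
  "one (free_disk n r) = (\<lambda>\<alpha>. if \<alpha> = [] then 1 else 0)"
  "zero (free_disk n r) = (\<lambda>\<alpha>. 0)"
  "add (free_disk n r) = (\<lambda>a b \<alpha>. a \<alpha> + b \<alpha>)"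
  "smult (free_disk n r) = (\<lambda>c a \<alpha>. c * a \<alpha>)"
  by (auto simp: free_disk_def free_disk_alg_def module.defs tvs.defs word_conv_def splits_def fun_eq_iff)

lemma free_disk_carrier:
  "carrier (free_disk n r) = {c. (\<forall>\<alpha>. \<alpha> \<notin> words n \<longrightarrow> c \<alpha> = 0) \<and>
      (\<forall>\<rho> \<tau>. admissible_radii r \<rho> \<tau> \<longrightarrow> (\<lambda>\<alpha>. cmod (c \<alpha>) * word_weight \<rho> \<tau> \<alpha>) summable_on words n)}"
  by (auto simp: free_disk_def free_disk_alg_def module.defs tvs.defs free_disk_term_eq[abs_def]
      admissible_radii_def)

lemma free_disk_norm_eq:
  "free_disk_norm n \<rho> \<tau> c = (\<Sum>\<^sub>\<infinity>\<alpha>\<in>words n. cmod (c \<alpha>) * word_weight \<rho> \<tau> \<alpha>)"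
  by (simp add: free_disk_norm_def free_disk_term_eq)

text \<open>The terms are nonnegative, so bounded finite sums give summability. Together with
  \<open>free_disk_norm_leI\<close>, one finite estimate per operation yields both closure and the
  norm inequality.\<close>

lemma free_disk_carrierI:
  assumes "\<And>\<alpha>. \<alpha> \<notin> words n \<Longrightarrow> c \<alpha> = 0"
    and "\<And>\<rho> \<tau>. admissible_radii r \<rho> \<tau> \<Longrightarrow>
      \<exists>M. \<forall>G. finite G \<and> G \<subseteq> words n \<longrightarrow> (\<Sum>\<alpha>\<in>G. cmod (c \<alpha>) * word_weight \<rho> \<tau> \<alpha>) \<le> M"
  shows "c \<in> carrier (free_disk n r)"
proof -
  have "(\<lambda>\<alpha>. cmod (c \<alpha>) * word_weight \<rho> \<tau> \<alpha>) summable_on words n" if "admissible_radii r \<rho> \<tau>" for \<rho> \<tau>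
  proof (rule nonneg_bdd_above_summable_on)
    show "0 \<le> cmod (c \<alpha>) * word_weight \<rho> \<tau> \<alpha>" for \<alpha>
      using that word_weight_nonneg by (simp add: admissible_radii_def)
    show "bdd_above (sum (\<lambda>\<alpha>. cmod (c \<alpha>) * word_weight \<rho> \<tau> \<alpha>) ` {F. F \<subseteq> words n \<and> finite F})"
      using assms(2)[OF that] by (auto simp: bdd_above_def)
  qed
  then show ?thesis using assms(1) by (auto simp: free_disk_carrier)
qed

lemma free_disk_sum_le_norm:
  assumes "c \<in> carrier (free_disk n r)" "admissible_radii r \<rho> \<tau>" "finite G" "G \<subseteq> words n"
  shows "(\<Sum>\<alpha>\<in>G. cmod (c \<alpha>) * word_weight \<rho> \<tau> \<alpha>) \<le> free_disk_norm n \<rho> \<tau> c"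
  unfolding free_disk_norm_eq
  by (rule finite_sum_le_infsum)
    (use assms word_weight_nonneg in \<open>auto simp: free_disk_carrier admissible_radii_def\<close>)

lemma free_disk_norm_leI:
  assumes "admissible_radii r \<rho> \<tau>" "c \<in> carrier (free_disk n r)"
    and "\<And>G. finite G \<Longrightarrow> G \<subseteq> words n \<Longrightarrow> (\<Sum>\<alpha>\<in>G. cmod (c \<alpha>) * word_weight \<rho> \<tau> \<alpha>) \<le> M"
  shows "free_disk_norm n \<rho> \<tau> c \<le> M"
  unfolding free_disk_norm_eq
  by (rule infsum_le_finite_sums) (use assms in \<open>auto simp: free_disk_carrier\<close>)

lemma free_disk_norm_nonneg:
  "admissible_radii r \<rho> \<tau> \<Longrightarrow> 0 \<le> free_disk_norm n \<rho> \<tau> c"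
  unfolding free_disk_norm_eq
  by (rule infsum_nonneg) (use word_weight_nonneg in \<open>auto simp: admissible_radii_def\<close>)

lemma free_disk_add_bound:
  assumes "a \<in> carrier (free_disk n r)" "b \<in> carrier (free_disk n r)" "admissible_radii r \<rho> \<tau>"
    "finite G" "G \<subseteq> words n"
  shows "(\<Sum>\<alpha>\<in>G. cmod (a \<alpha> + b \<alpha>) * word_weight \<rho> \<tau> \<alpha>)
    \<le> free_disk_norm n \<rho> \<tau> a + free_disk_norm n \<rho> \<tau> b"
proof -
  have "(\<Sum>\<alpha>\<in>G. cmod (a \<alpha> + b \<alpha>) * word_weight \<rho> \<tau> \<alpha>) \<le>
      (\<Sum>\<alpha>\<in>G. cmod (a \<alpha>) * word_weight \<rho> \<tau> \<alpha> + cmod (b \<alpha>) * word_weight \<rho> \<tau> \<alpha>)"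
    using assms(3) word_weight_nonneg
    by (intro sum_mono) (auto simp: admissible_radii_def norm_triangle_ineq mult_right_mono
        simp flip: distrib_right)
  also have "\<dots> \<le> free_disk_norm n \<rho> \<tau> a + free_disk_norm n \<rho> \<tau> b"
    unfolding sum.distrib using assms by (intro add_mono free_disk_sum_le_norm) auto
  finally show ?thesis .
qed

lemma free_disk_add_closed:
  assumes "a \<in> carrier (free_disk n r)" "b \<in> carrier (free_disk n r)"
  shows "(\<lambda>\<alpha>. a \<alpha> + b \<alpha>) \<in> carrier (free_disk n r)"
proof (rule free_disk_carrierI)
  show "a \<alpha> + b \<alpha> = 0" if "\<alpha> \<notin> words n" for \<alpha>
    using assms that by (simp add: free_disk_carrier)
qed (use free_disk_add_bound[OF assms] in blast)

lemma free_disk_norm_add: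
  assumes "a \<in> carrier (free_disk n r)" "b \<in> carrier (free_disk n r)" "admissible_radii r \<rho> \<tau>"
  shows "free_disk_norm n \<rho> \<tau> (\<lambda>\<alpha>. a \<alpha> + b \<alpha>) \<le> free_disk_norm n \<rho> \<tau> a + free_disk_norm n \<rho> \<tau> b"
  by (rule free_disk_norm_leI[OF assms(3) free_disk_add_closed[OF assms(1,2)] free_disk_add_bound[OF assms]])

lemma free_disk_smult_closed:
  assumes "a \<in> carrier (free_disk n r)"
  shows "(\<lambda>\<alpha>. c * a \<alpha>) \<in> carrier (free_disk n r)"
  using assms by (auto simp: free_disk_carrier norm_mult mult.assoc intro!: summable_on_cmult_right)

lemma free_disk_norm_smult: "free_disk_norm n \<rho> \<tau> (\<lambda>\<alpha>. c * a \<alpha>) = cmod c * free_disk_norm n \<rho> \<tau> a"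
  by (simp add: free_disk_norm_eq norm_mult mult.assoc infsum_cmult_right')

lemma free_disk_diff_closed:
  assumes "a \<in> carrier (free_disk n r)" "b \<in> carrier (free_disk n r)"
  shows "(\<lambda>\<alpha>. a \<alpha> - b \<alpha>) \<in> carrier (free_disk n r)"
  using free_disk_add_closed[OF assms(1) free_disk_smult_closed[OF assms(2), of "-1"]] by simp

text \<open>A pair of words occurs as a factorization of only one word, its concatenation. The
  double sum is therefore part of the product of two finite partial sums of the norms.\<close>

lemma free_disk_mult_bound:
  assumes a: "a \<in> carrier (free_disk n r)" and b: "b \<in> carrier (free_disk n r)"
    and rt: "admissible_radii r \<rho> \<tau>" and G: "finite G" "G \<subseteq> words n"
  shows "(\<Sum>\<gamma>\<in>G. cmod (word_conv a b \<gamma>) * word_weight \<rho> \<tau> \<gamma>)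
    \<le> free_disk_norm n \<rho> \<tau> a * free_disk_norm n \<rho> \<tau> b"
proof -
  let ?u = "word_weight \<rho> \<tau>"
  have nn: "0 \<le> ?u \<alpha>" for \<alpha> using rt word_weight_nonneg by (auto simp: admissible_radii_def)
  \<comment> \<open>\<open>S\<close> collects all factorizations of words in \<open>G\<close>,
    tagged with the word; \<open>A\<close> and \<open>B\<close> are the left and right factors that
    occur.\<close>
  define S where "S = Sigma G splits"
  define A where "A = (\<lambda>p. fst (snd p)) ` S"
  define B where "B = (\<lambda>p. snd (snd p)) ` S"
  have finS: "finite S" unfolding S_def using G finite_splits by blast
  have AB: "finite A" "finite B" using finS by (auto simp: A_def B_def)
  have AW: "A \<subseteq> words n" "B \<subseteq> words n"
    using G(2) by (fastforce simp: A_def B_def S_def splits_def words_def subset_iff)+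
  have "(\<Sum>\<gamma>\<in>G. cmod (word_conv a b \<gamma>) * ?u \<gamma>)
    \<le> (\<Sum>\<gamma>\<in>G. \<Sum>(\<alpha>, \<beta>)\<in>splits \<gamma>. (cmod (a \<alpha>) * ?u \<alpha>) * (cmod (b \<beta>) * ?u \<beta>))"
  proof (rule sum_mono)
    fix \<gamma> assume "\<gamma> \<in> G"
    have "cmod (word_conv a b \<gamma>) \<le> (\<Sum>(\<alpha>, \<beta>)\<in>splits \<gamma>. cmod (a \<alpha>) * cmod (b \<beta>))"
      unfolding word_conv_def
      by (rule order_trans[OF norm_sum]) (simp add: split_def norm_mult)
    then have "cmod (word_conv a b \<gamma>) * ?u \<gamma> \<le> (\<Sum>(\<alpha>, \<beta>)\<in>splits \<gamma>. cmod (a \<alpha>) * cmod (b \<beta>)) * ?u \<gamma>"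
      using nn by (rule mult_right_mono)
    also have "\<dots> = (\<Sum>(\<alpha>, \<beta>)\<in>splits \<gamma>. (cmod (a \<alpha>) * cmod (b \<beta>)) * ?u (\<alpha> @ \<beta>))"
      by (auto simp: sum_distrib_right splits_def intro!: sum.cong)
    also have "\<dots> \<le> (\<Sum>(\<alpha>, \<beta>)\<in>splits \<gamma>. (cmod (a \<alpha>) * cmod (b \<beta>)) * (?u \<alpha> * ?u \<beta>))"
      using rt word_weight_append
      by (intro sum_mono) (auto simp: admissible_radii_def intro!: mult_left_mono)
    finally show "cmod (word_conv a b \<gamma>) * ?u \<gamma> \<le>
        (\<Sum>(\<alpha>, \<beta>)\<in>splits \<gamma>. (cmod (a \<alpha>) * ?u \<alpha>) * (cmod (b \<beta>) * ?u \<beta>))"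
      by (simp add: mult_ac)
  qed
  also have "\<dots> = (\<Sum>(\<gamma>, \<alpha>, \<beta>)\<in>S. (cmod (a \<alpha>) * ?u \<alpha>) * (cmod (b \<beta>) * ?u \<beta>))"
    unfolding S_def using G finite_splits by (subst sum.Sigma) auto
  \<comment> \<open>The tag is the concatenation of the two factors, so dropping it is injective on
    \<open>S\<close>.\<close>
  also have "\<dots> = (\<Sum>(\<alpha>, \<beta>)\<in>snd ` S. (cmod (a \<alpha>) * ?u \<alpha>) * (cmod (b \<beta>) * ?u \<beta>))"
    by (subst sum.reindex) (auto simp: inj_on_def S_def splits_def split_def)
  also have "\<dots> \<le> (\<Sum>(\<alpha>, \<beta>)\<in>A \<times> B. (cmod (a \<alpha>) * ?u \<alpha>) * (cmod (b \<beta>) * ?u \<beta>))"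
    using AB nn by (intro sum_mono2) (force simp: A_def B_def)+
  also have "\<dots> = (\<Sum>\<alpha>\<in>A. cmod (a \<alpha>) * ?u \<alpha>) * (\<Sum>\<beta>\<in>B. cmod (b \<beta>) * ?u \<beta>)"
    by (simp add: sum_product sum.cartesian_product)
  also have "\<dots> \<le> free_disk_norm n \<rho> \<tau> a * free_disk_norm n \<rho> \<tau> b"
    using a b rt AB AW nn
    by (intro mult_mono free_disk_sum_le_norm free_disk_norm_nonneg sum_nonneg) auto
  finally show ?thesis .
qed

lemma word_conv_support:
  assumes "a \<in> carrier (free_disk n r)" "b \<in> carrier (free_disk n r)" "\<gamma> \<notin> words n"
  shows "word_conv a b \<gamma> = 0"
proof -
  have "a \<alpha> * b \<beta> = 0" if "(\<alpha>, \<beta>) \<in> splits \<gamma>" for \<alpha> \<beta>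
  proof -
    have "\<alpha> \<notin> words n \<or> \<beta> \<notin> words n" using that assms(3) by (auto simp: splits_def words_def)
    then show ?thesis using assms(1,2) by (auto simp: free_disk_carrier)
  qed
  then show ?thesis by (auto simp: word_conv_def intro!: sum.neutral)
qed

lemma free_disk_mult_closed:
  assumes "a \<in> carrier (free_disk n r)" "b \<in> carrier (free_disk n r)"
  shows "word_conv a b \<in> carrier (free_disk n r)"
  by (rule free_disk_carrierI) (use free_disk_mult_bound[OF assms] word_conv_support[OF assms] in blast)+

lemma free_disk_norm_mult:
  assumes "a \<in> carrier (free_disk n r)" "b \<in> carrier (free_disk n r)" "admissible_radii r \<rho> \<tau>"
  shows "free_disk_norm n \<rho> \<tau> (word_conv a b) \<le> free_disk_norm n \<rho> \<tau> a * free_disk_norm n \<rho> \<tau> b"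
  by (rule free_disk_norm_leI[OF assms(3) free_disk_mult_closed[OF assms(1,2)] free_disk_mult_bound[OF assms]])

section \<open>Monomials and the ring structure of the free disk algebra\<close>

definition word_basis :: "nat list \<Rightarrow> nat list \<Rightarrow> complex" where
  "word_basis w = (\<lambda>\<alpha>. if \<alpha> = w then 1 else 0)"

lemma word_basis_closed:
  assumes "w \<in> words n" shows "word_basis w \<in> carrier (free_disk n r)"
proof (rule free_disk_carrierI)
  fix \<rho> \<tau> assume rt: "admissible_radii r \<rho> \<tau>"
  have "(\<Sum>\<alpha>\<in>G. cmod (word_basis w \<alpha>) * word_weight \<rho> \<tau> \<alpha>) \<le> word_weight \<rho> \<tau> w" if "finite G" for G
  proof -
    have "(\<Sum>\<alpha>\<in>G. cmod (word_basis w \<alpha>) * word_weight \<rho> \<tau> \<alpha>)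
      = (\<Sum>\<alpha>\<in>G. if \<alpha> = w then word_weight \<rho> \<tau> w else 0)"
      by (intro sum.cong) (auto simp: word_basis_def)
    then show ?thesis
      using that word_weight_nonneg rt by (auto simp: admissible_radii_def)
  qed
  then show "\<exists>M. \<forall>G. finite G \<and> G \<subseteq> words n \<longrightarrow>
      (\<Sum>\<alpha>\<in>G. cmod (word_basis w \<alpha>) * word_weight \<rho> \<tau> \<alpha>) \<le> M" by blast
qed (use assms in \<open>auto simp: word_basis_def\<close>)

text \<open>The summand is kept general because it is used twice: for the norm of a monomial and for
  the value of the character on it.\<close>

lemma infsum_word_basis:
  fixes f :: "complex \<Rightarrow> nat list \<Rightarrow> 'b :: {topological_comm_monoid_add, t2_space}"
  assumes "w \<in> words n" "\<And>\<alpha>. f 0 \<alpha> = 0"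
  shows "(\<Sum>\<^sub>\<infinity>\<alpha>\<in>words n. f (word_basis w \<alpha>) \<alpha>) = f 1 w"
proof -
  have "(\<Sum>\<^sub>\<infinity>\<alpha>\<in>words n. f (word_basis w \<alpha>) \<alpha>) = (\<Sum>\<^sub>\<infinity>\<alpha>\<in>{w}. f (word_basis w \<alpha>) \<alpha>)"
    by (rule infsum_cong_neutral) (use assms in \<open>auto simp: word_basis_def\<close>)
  then show ?thesis by (simp add: word_basis_def)
qed

lemma free_disk_norm_word_basis:
  "w \<in> words n \<Longrightarrow> free_disk_norm n \<rho> \<tau> (word_basis w) = word_weight \<rho> \<tau> w"
  unfolding free_disk_norm_eq by (subst infsum_word_basis[where f = "\<lambda>x \<alpha>. cmod x * word_weight \<rho> \<tau> \<alpha>"]) auto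

lemma word_conv_basis: "word_conv (word_basis v) (word_basis w) = word_basis (v @ w)"
proof
  fix \<gamma>
  have "word_conv (word_basis v) (word_basis w) \<gamma> = (\<Sum>p\<in>splits \<gamma>. if p = (v, w) then 1 else 0)"
    unfolding word_conv_def by (intro sum.cong) (auto simp: word_basis_def split: if_splits)
  also have "\<dots> = (if (v, w) \<in> splits \<gamma> then 1 else 0)"
    using finite_splits[of \<gamma>] by (auto simp: sum.delta)
  finally show "word_conv (word_basis v) (word_basis w) \<gamma> = word_basis (v @ w) \<gamma>"
    by (auto simp: splits_def word_basis_def)
qed

lemma word_conv_add_left: "word_conv (\<lambda>\<alpha>. a \<alpha> + b \<alpha>) c = (\<lambda>\<gamma>. word_conv a c \<gamma> + word_conv b c \<gamma>)"
  by (auto simp: word_conv_def split_def distrib_right sum.distrib)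

lemma word_conv_add_right: "word_conv c (\<lambda>\<alpha>. a \<alpha> + b \<alpha>) = (\<lambda>\<gamma>. word_conv c a \<gamma> + word_conv c b \<gamma>)"
  by (auto simp: word_conv_def split_def distrib_left sum.distrib)

lemma word_conv_smult_left: "word_conv (\<lambda>\<alpha>. c * a \<alpha>) b = (\<lambda>\<gamma>. c * word_conv a b \<gamma>)"
  by (auto simp: word_conv_def split_def sum_distrib_left mult_ac)

lemma word_conv_smult_right: "word_conv a (\<lambda>\<alpha>. c * b \<alpha>) = (\<lambda>\<gamma>. c * word_conv a b \<gamma>)"
  by (auto simp: word_conv_def split_def sum_distrib_left mult_ac)

lemma word_conv_one_left: "word_conv (\<lambda>\<alpha>. if \<alpha> = [] then 1 else 0) a = a"
proof
  fix \<gamma>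
  have "word_conv (\<lambda>\<alpha>. if \<alpha> = [] then 1 else 0) a \<gamma> = (\<Sum>p\<in>splits \<gamma>. if p = ([], \<gamma>) then a \<gamma> else 0)"
    unfolding word_conv_def by (intro sum.cong) (auto simp: splits_def split: if_splits)
  also have "\<dots> = a \<gamma>" using finite_splits[of \<gamma>] by (auto simp: sum.delta splits_def)
  finally show "word_conv (\<lambda>\<alpha>. if \<alpha> = [] then 1 else 0) a \<gamma> = a \<gamma>" .
qed

lemma word_conv_one_right: "word_conv a (\<lambda>\<alpha>. if \<alpha> = [] then 1 else 0) = a"
proof
  fix \<gamma>
  have "word_conv a (\<lambda>\<alpha>. if \<alpha> = [] then 1 else 0) \<gamma> = (\<Sum>p\<in>splits \<gamma>. if p = (\<gamma>, []) then a \<gamma> else 0)"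
    unfolding word_conv_def by (intro sum.cong) (auto simp: splits_def split: if_splits)
  also have "\<dots> = a \<gamma>" using finite_splits[of \<gamma>] by (auto simp: sum.delta splits_def)
  finally show "word_conv a (\<lambda>\<alpha>. if \<alpha> = [] then 1 else 0) \<gamma> = a \<gamma>" .
qed

text \<open>Both sides sum over the factorizations of the word into three factors; the reindexing
  only changes which two of them are bracketed.\<close>

lemma word_conv_assoc: "word_conv (word_conv a b) c = word_conv a (word_conv b c)"
proof
  fix \<gamma>
  have "word_conv (word_conv a b) c \<gamma>
      = (\<Sum>p\<in>splits \<gamma>. \<Sum>q\<in>splits (fst p). a (fst q) * b (snd q) * c (snd p))"
    by (simp add: word_conv_def split_def sum_distrib_right)
  also have "\<dots> = (\<Sum>(p, q)\<in>Sigma (splits \<gamma>) (\<lambda>p. splits (fst p)). a (fst q) * b (snd q) * c (snd p))"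
    by (subst sum.Sigma) (use finite_splits in auto)
  also have "\<dots> = (\<Sum>(p, q)\<in>Sigma (splits \<gamma>) (\<lambda>p. splits (snd p)). a (fst p) * b (fst q) * c (snd q))"
    by (rule sum.reindex_bij_witness[where j = "\<lambda>(p, q). ((fst q, snd q @ snd p), (snd q, snd p))"
          and i = "\<lambda>(p, q). ((fst p @ fst q, snd q), (fst p, fst q))"]) (auto simp: splits_def)
  also have "\<dots> = (\<Sum>p\<in>splits \<gamma>. \<Sum>q\<in>splits (snd p). a (fst p) * b (fst q) * c (snd q))"
    by (subst sum.Sigma) (use finite_splits in auto)
  also have "\<dots> = word_conv a (word_conv b c) \<gamma>"
    by (simp add: word_conv_def split_def sum_distrib_left mult_ac)
  finally show "word_conv (word_conv a b) c \<gamma> = word_conv a (word_conv b c) \<gamma>" .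
qed

lemma free_disk_one: "\<one>\<^bsub>free_disk n r\<^esub> = word_basis []"
  by (simp add: free_disk_simps word_basis_def)

lemma free_disk_zero_closed: "(\<lambda>\<alpha>. 0) \<in> carrier (free_disk n r)"
  by (simp add: free_disk_carrier)

lemma ring_free_disk: "ring (free_disk n r)"
proof (rule ringI)
  show "abelian_group (free_disk n r)"
  proof (rule abelian_groupI)
    fix x assume "x \<in> carrier (free_disk n r)"
    then show "\<exists>y\<in>carrier (free_disk n r). y \<oplus>\<^bsub>free_disk n r\<^esub> x = \<zero>\<^bsub>free_disk n r\<^esub>"
      by (intro bexI[of _ "\<lambda>\<alpha>. -1 * x \<alpha>"] free_disk_smult_closed) (simp_all add: free_disk_simps)
  qed (auto simp: free_disk_simps free_disk_add_closed free_disk_zero_closed algebra_simps)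
  show "Group.monoid (free_disk n r)"
    by (rule monoidI)
      (simp_all add: free_disk_simps free_disk_mult_closed word_conv_assoc word_conv_one_left
        word_conv_one_right word_basis_closed[of "[]", unfolded word_basis_def] words_def)
qed (simp_all add: free_disk_simps word_conv_add_left word_conv_add_right)

lemma free_disk_minus:
  assumes "x \<in> carrier (free_disk n r)" "y \<in> carrier (free_disk n r)"
  shows "x \<ominus>\<^bsub>free_disk n r\<^esub> y = (\<lambda>\<alpha>. x \<alpha> - y \<alpha>)"
proof -
  interpret ring "free_disk n r" by (rule ring_free_disk)
  have "\<ominus>\<^bsub>free_disk n r\<^esub> y = (\<lambda>\<alpha>. -1 * y \<alpha>)"
    by (rule minus_equality) (use assms free_disk_smult_closed[of y n r "-1"] in \<open>auto simp: free_disk_simps\<close>)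
  then show ?thesis by (simp add: a_minus_def free_disk_simps)
qed

section \<open>Seminorm topologies and uniform algebras\<close>

text \<open>The sets that eventually contain the family whenever they contain the limit are stable
  under finite intersections and arbitrary unions. Convergence can thus be tested on a subbasis,
  which is how all topologies here are given.\<close>

lemma limitin_topology_generated_by:
  "limitin (topology_generated_by S) f l F \<longleftrightarrow>
    l \<in> \<Union>S \<and> (\<forall>s\<in>S. l \<in> s \<longrightarrow> (\<forall>\<^sub>F x in F. f x \<in> s))"
proof -
  have "\<forall>\<^sub>F x in F. f x \<in> U"
    if "generate_topology_on S U" "l \<in> U" "\<forall>s\<in>S. l \<in> s \<longrightarrow> (\<forall>\<^sub>F x in F. f x \<in> s)" for U
    using that
  proof (induction U rule: generate_topology_on.induct)
    case (UN \<K>)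
    then obtain k where "k \<in> \<K>" "l \<in> k" by blast
    then have "\<forall>\<^sub>F x in F. f x \<in> k" using UN by blast
    then show ?case by (rule eventually_mono) (use \<open>k \<in> \<K>\<close> in auto)
  qed (auto intro: eventually_conj)
  then show ?thesis
    by (auto simp: limitin_def openin_topology_generated_by_iff intro: generate_topology_on.Basis)
qed

lemma topspace_seminorm_topology [simp]: "topspace (seminorm_topology E S) = carrier E"
  by (auto simp: seminorm_topology_def)

text \<open>The subbasic balls have arbitrary centres. By the triangle inequality, such a ball
  around \<open>x0\<close> that contains \<open>l\<close> also contains a smaller ball around
  \<open>l\<close>. The hypotheses speak only of differences, so that one statement fits all the
  concrete spaces.\<close>

lemma limitin_seminorm_topology:
  assumes tri: "\<And>p x y z. \<lbrakk>p \<in> S; x \<in> carrier E; y \<in> carrier E; z \<in> carrier E\<rbrakk> \<Longrightarrow>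
      p (x \<ominus>\<^bsub>E\<^esub> z) \<le> p (x \<ominus>\<^bsub>E\<^esub> y) + p (y \<ominus>\<^bsub>E\<^esub> z)"
    and zero: "\<And>p x. \<lbrakk>p \<in> S; x \<in> carrier E\<rbrakk> \<Longrightarrow> p (x \<ominus>\<^bsub>E\<^esub> x) = 0"
  shows "limitin (seminorm_topology E S) f l F \<longleftrightarrow>
    l \<in> carrier E \<and> (\<forall>\<^sub>F x in F. f x \<in> carrier E) \<and>
    (\<forall>p\<in>S. \<forall>\<epsilon>>0. \<forall>\<^sub>F x in F. p (f x \<ominus>\<^bsub>E\<^esub> l) < \<epsilon>)" (is "?L \<longleftrightarrow> ?R")
proof -
  define B where "B = {{y \<in> carrier E. p (y \<ominus>\<^bsub>E\<^esub> x) < \<epsilon>} | p x \<epsilon>. p \<in> S \<and> x \<in> carrier E \<and> 0 < \<epsilon>}"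
  have lim: "?L \<longleftrightarrow> l \<in> \<Union>(insert (carrier E) B) \<and>
      (\<forall>s\<in>insert (carrier E) B. l \<in> s \<longrightarrow> (\<forall>\<^sub>F x in F. f x \<in> s))"
    unfolding seminorm_topology_def B_def by (rule limitin_topology_generated_by)
  show ?thesis
  proof
    assume L: ?L
    then have l: "l \<in> carrier E" using limitin_topspace[OF L] by simp
    have basic: "\<forall>\<^sub>F x in F. f x \<in> s" if "s \<in> insert (carrier E) B" "l \<in> s" for s
      using L that unfolding lim by blast
    have *: "\<forall>\<^sub>F x in F. p (f x \<ominus>\<^bsub>E\<^esub> l) < \<epsilon>" if p: "p \<in> S" and \<epsilon>: "0 < \<epsilon>" for p \<epsilon>
    proof -
      let ?s = "{y \<in> carrier E. p (y \<ominus>\<^bsub>E\<^esub> l) < \<epsilon>}"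
      have "?s \<in> insert (carrier E) B"
        unfolding B_def by (intro insertI2 CollectI exI conjI) (rule refl p l \<epsilon>)+
      moreover have "l \<in> ?s" using l \<epsilon> zero[OF p l] by simp
      ultimately have "\<forall>\<^sub>F x in F. f x \<in> ?s" by (rule basic)
      then show ?thesis by (rule eventually_mono) simp
    qed
    show ?R by (intro conjI ballI allI impI l basic *) simp_all
  next
    assume R: ?R
    note l = R[THEN conjunct1] and ev = R[THEN conjunct2, THEN conjunct1]
      and small = R[THEN conjunct2, THEN conjunct2]
    have "\<forall>\<^sub>F x in F. f x \<in> {y \<in> carrier E. p (y \<ominus>\<^bsub>E\<^esub> x0) < \<epsilon>}"
      if p: "p \<in> S" and x0: "x0 \<in> carrier E" and \<epsilon>: "p (l \<ominus>\<^bsub>E\<^esub> x0) < \<epsilon>" for p x0 \<epsilon>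
    proof -
      have "0 < \<epsilon> - p (l \<ominus>\<^bsub>E\<^esub> x0)" using \<epsilon> by simp
      then have "\<forall>\<^sub>F x in F. p (f x \<ominus>\<^bsub>E\<^esub> l) < \<epsilon> - p (l \<ominus>\<^bsub>E\<^esub> x0)"
        by (rule small[rule_format, OF p])
      with ev show ?thesis
      proof eventually_elim
        fix x assume "f x \<in> carrier E" and *: "p (f x \<ominus>\<^bsub>E\<^esub> l) < \<epsilon> - p (l \<ominus>\<^bsub>E\<^esub> x0)"
        then show "f x \<in> {y \<in> carrier E. p (y \<ominus>\<^bsub>E\<^esub> x0) < \<epsilon>}"
          using tri[OF p _ l x0, of "f x"] by simp
      qed
    qed
    then have "\<forall>\<^sub>F x in F. f x \<in> s" if "s \<in> B" "l \<in> s" for s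
      using that unfolding B_def by (elim CollectE exE conjE) simp
    with l ev show ?L unfolding lim by simp
  qed
qed

text \<open>Subtraction is determined by carrier, addition and zero alone. This moves the topology
  between a record and the smaller record from which its topology field was built.\<close>

lemma seminorm_topology_cong:
  assumes "carrier E = carrier E'" "add E = add E'" "zero E = zero E'"
  shows "seminorm_topology E S = seminorm_topology E' S"
proof -
  have "a_minus E = a_minus E'"
    by (intro ext) (simp add: a_minus_def a_inv_def m_inv_def assms)
  then show ?thesis using assms by (simp add: seminorm_topology_def)
qed

lemma metrizable_seminorm_topology:
  assumes tri: "\<And>x y z. \<lbrakk>x \<in> carrier E; y \<in> carrier E; z \<in> carrier E\<rbrakk> \<Longrightarrow>
      p (x \<ominus>\<^bsub>E\<^esub> z) \<le> p (x \<ominus>\<^bsub>E\<^esub> y) + p (y \<ominus>\<^bsub>E\<^esub> z)"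
    and nonneg: "\<And>x y. \<lbrakk>x \<in> carrier E; y \<in> carrier E\<rbrakk> \<Longrightarrow> 0 \<le> p (x \<ominus>\<^bsub>E\<^esub> y)"
    and sym: "\<And>x y. \<lbrakk>x \<in> carrier E; y \<in> carrier E\<rbrakk> \<Longrightarrow> p (x \<ominus>\<^bsub>E\<^esub> y) = p (y \<ominus>\<^bsub>E\<^esub> x)"
    and zero: "\<And>x y. \<lbrakk>x \<in> carrier E; y \<in> carrier E\<rbrakk> \<Longrightarrow> p (x \<ominus>\<^bsub>E\<^esub> y) = 0 \<longleftrightarrow> x = y"
  shows "metrizable_space (seminorm_topology E {p})"
proof -
  \<comment> \<open>\<open>Metric_space\<close> asks for symmetry and nonnegativity on the whole
    type, hence the value 0 off the carrier.\<close>
  define d where "d x y = (if x \<in> carrier E \<and> y \<in> carrier E then p (x \<ominus>\<^bsub>E\<^esub> y) else 0)" for x y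
  have d: "d x y = p (x \<ominus>\<^bsub>E\<^esub> y)" if "x \<in> carrier E" "y \<in> carrier E" for x y
    using that by (simp add: d_def)
  interpret Metric_space "carrier E" d
  proof
    show "0 \<le> d x y" for x y using nonneg[of x y] by (simp add: d_def)
    show "d x y = d y x" for x y
      using sym[of x y] by (cases "x \<in> carrier E"; cases "y \<in> carrier E") (simp_all add: d_def)
    show "d x y = 0 \<longleftrightarrow> x = y" if "x \<in> carrier E" "y \<in> carrier E" for x y
      unfolding d[OF that] by (rule zero[OF that])
    show "d x z \<le> d x y + d y z" if "x \<in> carrier E" "y \<in> carrier E" "z \<in> carrier E" for x y z
      unfolding d[OF that(1,3)] d[OF that(1,2)] d[OF that(2,3)] by (rule tri[OF that])
  qed
  have ball: "{y \<in> carrier E. p (y \<ominus>\<^bsub>E\<^esub> x) < \<epsilon>} = mball x \<epsilon>" if x: "x \<in> carrier E" for x \<epsilon>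
  proof (rule Set.set_eqI)
    fix y show "y \<in> {y \<in> carrier E. p (y \<ominus>\<^bsub>E\<^esub> x) < \<epsilon>} \<longleftrightarrow> y \<in> mball x \<epsilon>"
      using x sym[of x y] d[of x y] by (cases "y \<in> carrier E") simp_all
  qed
  define B where "B = {{y \<in> carrier E. q (y \<ominus>\<^bsub>E\<^esub> x) < \<epsilon>} | q x \<epsilon>. q \<in> {p} \<and> x \<in> carrier E \<and> 0 < \<epsilon>}"
  have top: "seminorm_topology E {p} = topology_generated_by (insert (carrier E) B)"
    by (simp add: seminorm_topology_def B_def)
  have "openin (seminorm_topology E {p}) W \<longleftrightarrow> openin mtopology W" for W
  proof
    have "openin mtopology s" if s: "s \<in> insert (carrier E) B" for s
    proof (cases "s = carrier E")
      case True then show ?thesis using openin_topspace[of mtopology] by simp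
    next
      case False
      then obtain x \<epsilon> where "x \<in> carrier E" "s = {y \<in> carrier E. p (y \<ominus>\<^bsub>E\<^esub> x) < \<epsilon>}"
        using s unfolding B_def by blast
      then show ?thesis using ball openin_mball by simp
    qed
    moreover assume "openin (seminorm_topology E {p}) W"
    ultimately show "openin mtopology W"
      unfolding top openin_topology_generated_by_iff
      by (rule generate_topology_on_coarsest[OF istopology_openin])
  next
    assume W: "openin mtopology W"
    have "\<exists>T. openin (seminorm_topology E {p}) T \<and> x \<in> T \<and> T \<subseteq> W" if "x \<in> W" for x
    proof -
      obtain e where e: "e > 0" "mball x e \<subseteq> W" using W \<open>x \<in> W\<close> unfolding openin_mtopology by blast
      have x: "x \<in> carrier E" using W \<open>x \<in> W\<close> unfolding openin_mtopology by blast
      have "mball x e \<in> insert (carrier E) B"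
        unfolding B_def using x e(1) ball[OF x, of e] by blast
      then have "openin (seminorm_topology E {p}) (mball x e)"
        unfolding top by (rule topology_generated_by_Basis)
      moreover have "x \<in> mball x e" using x e(1) by simp
      ultimately show ?thesis using e(2) by blast
    qed
    then show "openin (seminorm_topology E {p}) W" by (subst openin_subopen) blast
  qed
  then have "seminorm_topology E {p} = mtopology" by (simp add: topology_eq)
  then show ?thesis by (simp add: metrizable_space_mtopology)
qed

section \<open>The uniform algebra A(K) of a compact set as a Frechet space\<close>

lemma cring_complex_ring: "cring complex_ring"
proof (rule cringI)
  show "abelian_group complex_ring"
  proof (rule abelian_groupI)
    fix x assume "x \<in> carrier complex_ring"
    show "\<exists>y\<in>carrier complex_ring. y \<oplus>\<^bsub>complex_ring\<^esub> x = \<zero>\<^bsub>complex_ring\<^esub>"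
      by (rule bexI[of _ "- x"]) (simp_all add: complex_ring_def)
  qed (simp_all add: complex_ring_def)
  show "Group.comm_monoid complex_ring"
    by (rule comm_monoidI) (auto simp: complex_ring_def)
qed (auto simp: complex_ring_def algebra_simps)

text \<open>The carrier of the uniform algebra \<open>A(K)\<close> is copied to the type required of test modules.\<close>

definition encode :: "(complex \<Rightarrow> complex) \<Rightarrow> nat \<Rightarrow> (complex \<Rightarrow> complex) \<times> 'q" where
  "encode f = (\<lambda>_. (f, undefined))"

definition decode :: "(nat \<Rightarrow> (complex \<Rightarrow> complex) \<times> 'q) \<Rightarrow> complex \<Rightarrow> complex" where
  "decode x = fst (x 0)"

lemma decode_encode [simp]: "decode (encode f) = f"
  by (simp add: decode_def encode_def)

lemma encode_inject [simp]: "encode f = encode g \<longleftrightarrow> f = g"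
  by (auto simp: encode_def fun_eq_iff)

text \<open>For a one-point set the interior is empty and every function on it qualifies, so the
  same construction also supplies the one-dimensional target of the epimorphism.\<close>

definition uniform_fns :: "complex set \<Rightarrow> (complex \<Rightarrow> complex) set" where
  "uniform_fns K = {f \<in> extensional K. continuous_on K f \<and> f holomorphic_on interior K}"

definition uniform_norm :: "complex set \<Rightarrow> (nat \<Rightarrow> (complex \<Rightarrow> complex) \<times> 'q) \<Rightarrow> real" where
  "uniform_norm K x = (SUP z\<in>K. cmod (decode x z))"

definition uniform_alg :: "complex set \<Rightarrow> (complex, nat \<Rightarrow> (complex \<Rightarrow> complex) \<times> 'q) module" where
  "uniform_alg K = \<lparr>carrier = encode ` uniform_fns K,
     monoid.mult = (\<lambda>x y. encode (\<lambda>z\<in>K. decode x z * decode y z)), one = encode (\<lambda>z\<in>K. 1),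
     zero = encode (\<lambda>z\<in>K. 0), add = (\<lambda>x y. encode (\<lambda>z\<in>K. decode x z + decode y z)),
     smult = (\<lambda>c x. encode (\<lambda>z\<in>K. c * decode x z))\<rparr>"

text \<open>The topology is a field of the record but is defined through subtraction in that record.
  It is therefore taken from the smaller record \<open>uniform_alg\<close>;
  \<open>top_of_uniform_module\<close> then restates it in terms of the module itself.\<close>

definition uniform_module ::
    "complex set \<Rightarrow> (complex \<Rightarrow> complex, nat \<Rightarrow> (complex \<Rightarrow> complex) \<times> 'q) tmod" where
  "uniform_module K = \<lparr>carrier = carrier (uniform_alg K), monoid.mult = monoid.mult (uniform_alg K),
     one = one (uniform_alg K), zero = zero (uniform_alg K), add = add (uniform_alg K),
     smult = smult (uniform_alg K), top_of = seminorm_topology (uniform_alg K) {uniform_norm K},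
     act = (\<lambda>a x. encode (\<lambda>z\<in>K. a z * decode x z))\<rparr>"

lemma uniform_module_simps:
  "carrier (uniform_module K) = encode ` uniform_fns K"
  "zero (uniform_module K) = encode (\<lambda>z\<in>K. 0)"
  "add (uniform_module K) = (\<lambda>x y. encode (\<lambda>z\<in>K. decode x z + decode y z))"
  "smult (uniform_module K) = (\<lambda>c x. encode (\<lambda>z\<in>K. c * decode x z))"
  "act (uniform_module K) = (\<lambda>a x. encode (\<lambda>z\<in>K. a z * decode x z))"
  by (simp_all add: uniform_module_def uniform_alg_def)

lemma top_of_uniform_module:
  "top_of (uniform_module K) = seminorm_topology (uniform_module K) {uniform_norm K}"
  (is "top_of ?X = seminorm_topology _ {?p}")
proof -
  have "seminorm_topology ?X {?p} = seminorm_topology (uniform_alg K) {?p}"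
    by (rule seminorm_topology_cong) (simp_all add: uniform_module_def)
  moreover have "top_of ?X = seminorm_topology (uniform_alg K) {?p}"
    by (simp add: uniform_module_def)
  ultimately show ?thesis by simp
qed

lemma uniform_fnsD:
  assumes "f \<in> uniform_fns K"
  shows "f \<in> extensional K" "continuous_on K f" "f holomorphic_on interior K"
  using assms by (auto simp: uniform_fns_def)

lemma uniform_fnsI:
  assumes "continuous_on K f" "f holomorphic_on interior K"
  shows "restrict f K \<in> uniform_fns K"
proof -
  have "continuous_on K (restrict f K)"
    using assms(1) by (rule continuous_on_eq) simp
  moreover have "restrict f K holomorphic_on interior K"
    using assms(2) by (rule holomorphic_transform) (use interior_subset[of K] in auto)
  ultimately show ?thesis by (simp add: uniform_fns_def)
qed

lemma uniform_fns_restrict [simp]: "f \<in> uniform_fns K \<Longrightarrow> restrict f K = f"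
  by (simp add: uniform_fnsD extensional_restrict)

lemma uniform_fns_closed:
  "(\<lambda>z\<in>K. c) \<in> uniform_fns K"
  "f \<in> uniform_fns K \<Longrightarrow> g \<in> uniform_fns K \<Longrightarrow> (\<lambda>z\<in>K. f z + g z) \<in> uniform_fns K"
  "f \<in> uniform_fns K \<Longrightarrow> g \<in> uniform_fns K \<Longrightarrow> (\<lambda>z\<in>K. f z - g z) \<in> uniform_fns K"
  "f \<in> uniform_fns K \<Longrightarrow> (\<lambda>z\<in>K. c * f z) \<in> uniform_fns K"
  "f \<in> uniform_fns K \<Longrightarrow> (\<lambda>z\<in>K. - f z) \<in> uniform_fns K"
  by (auto intro!: uniform_fnsI continuous_intros holomorphic_intros simp: uniform_fnsD)

lemma abelian_group_uniform_module: "abelian_group (uniform_module K)"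
proof (rule abelian_groupI)
  fix x :: "nat \<Rightarrow> (complex \<Rightarrow> complex) \<times> 'q" assume "x \<in> carrier (uniform_module K)"
  then obtain f where f: "f \<in> uniform_fns K" "x = encode f" by (auto simp: uniform_module_simps)
  then have "restrict (\<lambda>z. - f z) K \<in> uniform_fns K"
    by (simp add: uniform_fns_closed)
  then show "\<exists>y\<in>carrier (uniform_module K). y \<oplus>\<^bsub>uniform_module K\<^esub> x = \<zero>\<^bsub>uniform_module K\<^esub>"
    by (intro bexI[of _ "encode (restrict (\<lambda>z. - f z) K)"]) (auto simp: uniform_module_simps f cong: restrict_cong)
qed (auto simp: uniform_module_simps uniform_fns_closed add_ac cong: restrict_cong)

lemma uniform_module_minus:
  assumes "f \<in> uniform_fns K" "g \<in> uniform_fns K"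
  shows "encode f \<ominus>\<^bsub>uniform_module K\<^esub> encode g =
    (encode (\<lambda>z\<in>K. f z - g z) :: nat \<Rightarrow> (complex \<Rightarrow> complex) \<times> 'q)"
proof -
  interpret abelian_group "uniform_module K :: (complex \<Rightarrow> complex, nat \<Rightarrow> (complex \<Rightarrow> complex) \<times> 'q) tmod" by (rule abelian_group_uniform_module)
  have "restrict (\<lambda>z. - g z) K \<in> uniform_fns K"
    using assms by (simp add: uniform_fns_closed)
  then have "\<ominus>\<^bsub>uniform_module K\<^esub> encode g =
      (encode (restrict (\<lambda>z. - g z) K) :: nat \<Rightarrow> (complex \<Rightarrow> complex) \<times> 'q)"
    by (intro minus_equality) (use assms in \<open>auto simp: uniform_module_simps cong: restrict_cong\<close>)
  then show ?thesis by (simp add: a_minus_def uniform_module_simps cong: restrict_cong)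
qed

context
  fixes K :: "complex set"
  assumes compact: "compact K" and nonempty: "K \<noteq> {}"
begin

lemma uniform_fns_bdd: "f \<in> uniform_fns K \<Longrightarrow> bdd_above ((\<lambda>z. cmod (f z)) ` K)"
  using compact
  by (intro bounded_imp_bdd_above compact_imp_bounded compact_continuous_image continuous_intros)
    (auto dest: uniform_fnsD)

lemma uniform_norm_ge: "f \<in> uniform_fns K \<Longrightarrow> z \<in> K \<Longrightarrow> cmod (f z) \<le> uniform_norm K (encode f)"
  unfolding uniform_norm_def decode_encode by (rule cSUP_upper[OF _ uniform_fns_bdd])

lemma uniform_norm_leI: "(\<And>z. z \<in> K \<Longrightarrow> cmod (f z) \<le> M) \<Longrightarrow> uniform_norm K (encode f) \<le> M"
  unfolding uniform_norm_def decode_encode using nonempty by (rule cSUP_least)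

lemma uniform_norm_nonneg: "f \<in> uniform_fns K \<Longrightarrow> 0 \<le> uniform_norm K (encode f)"
  using uniform_norm_ge nonempty by (metis ex_in_conv norm_ge_zero order_trans)

lemma uniform_norm_cong: "(\<And>z. z \<in> K \<Longrightarrow> cmod (f z) = cmod (g z)) \<Longrightarrow>
    uniform_norm K (encode f) = uniform_norm K (encode g)"
  by (simp add: uniform_norm_def)

lemma uniform_norm_mult:
  assumes "f \<in> uniform_fns K"
  shows "uniform_norm K (encode (\<lambda>z\<in>K. c * f z)) = cmod c * uniform_norm K (encode f)"
proof (rule antisym)
  show "uniform_norm K (encode (\<lambda>z\<in>K. c * f z)) \<le> cmod c * uniform_norm K (encode f)"
    by (rule uniform_norm_leI) (use assms in \<open>auto simp: norm_mult intro!: mult_left_mono uniform_norm_ge\<close>)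
  have g: "(\<lambda>z\<in>K. c * f z) \<in> uniform_fns K"
    using assms by (simp add: uniform_fns_closed)
  show "cmod c * uniform_norm K (encode f) \<le> uniform_norm K (encode (\<lambda>z\<in>K. c * f z))"
  proof (cases "c = 0")
    case True then show ?thesis using uniform_norm_nonneg[OF g] by simp
  next
    case False
    have "uniform_norm K (encode f) \<le> uniform_norm K (encode (\<lambda>z\<in>K. c * f z)) / cmod c"
      by (rule uniform_norm_leI) (use uniform_norm_ge[OF g] False in \<open>auto simp: norm_mult field_simps\<close>)
    then show ?thesis using False by (simp add: field_simps)
  qed
qed

lemma uniform_norm_add:
  assumes "f \<in> uniform_fns K" "g \<in> uniform_fns K"
  shows "uniform_norm K (encode (\<lambda>z\<in>K. f z + g z)) \<le> uniform_norm K (encode f) + uniform_norm K (encode g)"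
  by (rule uniform_norm_leI)
    (use assms in \<open>auto intro!: order_trans[OF norm_triangle_ineq] add_mono uniform_norm_ge\<close>)

lemma uniform_norm_dist_triangle:
  assumes "x \<in> carrier (uniform_module K)" "y \<in> carrier (uniform_module K)" "z \<in> carrier (uniform_module K)"
  shows "uniform_norm K (x \<ominus>\<^bsub>uniform_module K\<^esub> z) \<le>
    uniform_norm K (x \<ominus>\<^bsub>uniform_module K\<^esub> y) + uniform_norm K (y \<ominus>\<^bsub>uniform_module K\<^esub> z)"
proof -
  obtain f g h where *: "f \<in> uniform_fns K" "g \<in> uniform_fns K" "h \<in> uniform_fns K"
    "x = encode f" "y = encode g" "z = encode h" using assms by (auto simp: uniform_module_simps)
  have "(\<lambda>z\<in>K. f z - g z) \<in> uniform_fns K" "(\<lambda>z\<in>K. g z - h z) \<in> uniform_fns K"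
    using * by (simp_all add: uniform_fns_closed)
  from uniform_norm_add[OF this] show ?thesis
    by (simp add: * uniform_module_minus cong: restrict_cong)
qed

lemma uniform_norm_dist_zero:
  fixes x y :: "nat \<Rightarrow> (complex \<Rightarrow> complex) \<times> 'q"
  assumes "x \<in> carrier (uniform_module K)" "y \<in> carrier (uniform_module K)"
  shows "uniform_norm K (x \<ominus>\<^bsub>uniform_module K\<^esub> y) = 0 \<longleftrightarrow> x = y"
proof -
  obtain f g where *: "f \<in> uniform_fns K" "g \<in> uniform_fns K" "x = encode f" "y = encode g"
    using assms by (auto simp: uniform_module_simps)
  have d: "(\<lambda>z\<in>K. f z - g z) \<in> uniform_fns K"
    using * by (simp add: uniform_fns_closed)
  show ?thesis
  proof
    assume "uniform_norm K (x \<ominus>\<^bsub>uniform_module K\<^esub> y) = 0"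
    then have "uniform_norm K (encode (\<lambda>z\<in>K. f z - g z) :: nat \<Rightarrow> (complex \<Rightarrow> complex) \<times> 'q) = 0"
      using * by (simp only: uniform_module_minus)
    then have "cmod ((\<lambda>z\<in>K. f z - g z) z) \<le> 0" if "z \<in> K" for z
      using uniform_norm_ge[OF d that] by metis
    then have "f z = g z" if "z \<in> K" for z using that by fastforce
    then have "f = g" using *(1,2) by (auto dest!: uniform_fnsD(1) intro: extensionalityI)
    then show "x = y" using * by simp
  next
    assume "x = y"
    then have fg: "f = g" using * by simp
    have "uniform_norm K (encode (\<lambda>z\<in>K. f z - g z) :: nat \<Rightarrow> (complex \<Rightarrow> complex) \<times> 'q) \<le> 0"
      by (rule uniform_norm_leI) (simp add: fg)
    moreover have "0 \<le> uniform_norm K (encode (\<lambda>z\<in>K. f z - g z) :: nat \<Rightarrow> (complex \<Rightarrow> complex) \<times> 'q)"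
      by (rule uniform_norm_nonneg[OF d])
    ultimately show "uniform_norm K (x \<ominus>\<^bsub>uniform_module K\<^esub> y) = 0"
      unfolding *(3,4) uniform_module_minus[OF *(1,2)] by (rule antisym)
  qed
qed

lemma limitin_uniform_module:
  "limitin (top_of (uniform_module K)) f l F \<longleftrightarrow>
    l \<in> carrier (uniform_module K) \<and> (\<forall>\<^sub>F x in F. f x \<in> carrier (uniform_module K)) \<and>
    (\<forall>\<epsilon>>0. \<forall>\<^sub>F x in F. uniform_norm K (f x \<ominus>\<^bsub>uniform_module K\<^esub> l) < \<epsilon>)"
  unfolding top_of_uniform_module
  by (subst limitin_seminorm_topology) (auto simp: uniform_norm_dist_triangle uniform_norm_dist_zero)

lemma module_uniform_module: "Module.module complex_ring (uniform_module K)"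
proof (rule moduleI)
  show "cring complex_ring" by (rule cring_complex_ring)
  show "abelian_group (uniform_module K)" by (rule abelian_group_uniform_module)
qed (auto simp: uniform_module_simps complex_ring_def uniform_fns_closed ring_distribs mult.assoc
      cong: restrict_cong)

text \<open>A Cauchy sequence is uniformly Cauchy on \<open>K\<close>. Its uniform limit is
  continuous on \<open>K\<close>, and holomorphic in the interior by Weierstrass's theorem on
  locally uniform limits.\<close>

lemma uniform_module_complete:
  fixes u :: "nat \<Rightarrow> nat \<Rightarrow> (complex \<Rightarrow> complex) \<times> 'q"
  assumes "tvs_Cauchy (uniform_module K) u"
  shows "\<exists>l. limitin (top_of (uniform_module K)) u l sequentially"
proof -
  let ?X = "uniform_module K :: (complex \<Rightarrow> complex, nat \<Rightarrow> (complex \<Rightarrow> complex) \<times> 'q) tmod"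
  have "\<forall>k. u k \<in> carrier ?X" using assms by (simp add: tvs_Cauchy_def)
  then obtain f where f: "f k \<in> uniform_fns K" "u k = encode (f k)" for k
    unfolding uniform_module_simps image_iff Bex_def choice_iff by blast
  have minus: "u k \<ominus>\<^bsub>?X\<^esub> u l = encode (\<lambda>z\<in>K. f k z - f l z)" for k l
    by (simp add: f uniform_module_minus)
  have diff: "(\<lambda>z\<in>K. f k z - f l z) \<in> uniform_fns K" for k l
    using f by (simp add: uniform_fns_closed)
  have zero: "(\<lambda>z\<in>K. 0) \<in> uniform_fns K" by (simp add: uniform_fns_closed)
  have "\<exists>N. \<forall>k\<ge>N. \<forall>l\<ge>N. uniform_norm K (u k \<ominus>\<^bsub>?X\<^esub> u l) < \<epsilon>" if "0 < \<epsilon>" for \<epsilon>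
  proof -
    \<comment> \<open>Cauchy sequences are defined by open neighbourhoods of zero; the unit of
      translation here is a subbasic ball centred at zero.\<close>
    let ?V = "{y \<in> carrier ?X. uniform_norm K (y \<ominus>\<^bsub>?X\<^esub> \<zero>\<^bsub>?X\<^esub>) < \<epsilon>}"
    have z: "\<zero>\<^bsub>?X\<^esub> \<in> carrier ?X" using zero by (simp add: uniform_module_simps)
    have "openin (top_of ?X) ?V"
      unfolding top_of_uniform_module seminorm_topology_def
      by (rule topology_generated_by_Basis) (use z \<open>0 < \<epsilon>\<close> in auto)
    moreover have "\<zero>\<^bsub>?X\<^esub> \<in> ?V" using z \<open>0 < \<epsilon>\<close> uniform_norm_dist_zero[OF z z] by auto
    ultimately obtain N where "\<forall>k\<ge>N. \<forall>l\<ge>N. u k \<ominus>\<^bsub>?X\<^esub> u l \<in> ?V"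
      using assms unfolding tvs_Cauchy_def by blast
    moreover have "(u k \<ominus>\<^bsub>?X\<^esub> u l) \<ominus>\<^bsub>?X\<^esub> \<zero>\<^bsub>?X\<^esub> = u k \<ominus>\<^bsub>?X\<^esub> u l" for k l
      by (simp add: minus uniform_module_simps(2) uniform_module_minus[OF diff zero] cong: restrict_cong)
    ultimately show ?thesis by auto
  qed
  note Cauchy = this
  have "uniformly_Cauchy_on K f"
    unfolding uniformly_Cauchy_on_def minus dist_norm
  proof (intro allI impI)
    fix \<epsilon> :: real assume "0 < \<epsilon>"
    then obtain N where N: "\<And>k l. k \<ge> N \<Longrightarrow> l \<ge> N \<Longrightarrow>
        uniform_norm K (encode (\<lambda>z\<in>K. f k z - f l z) :: nat \<Rightarrow> (complex \<Rightarrow> complex) \<times> 'q) < \<epsilon>"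
      using Cauchy unfolding minus by blast
    have "norm (f k z - f l z) < \<epsilon>" if "z \<in> K" "k \<ge> N" "l \<ge> N" for z k l
      using order.strict_trans1[OF uniform_norm_ge[OF diff that(1)] N[OF that(2,3)]] that(1) by simp
    then show "\<exists>N. \<forall>z\<in>K. \<forall>k\<ge>N. \<forall>l\<ge>N. norm (f k z - f l z) < \<epsilon>" by blast
  qed
  then obtain g where g: "uniform_limit K f g sequentially"
    using Cauchy_uniformly_convergent by (auto simp: uniformly_convergent_on_def)
  have cont: "continuous_on K g"
    by (rule uniform_limit_theorem[OF _ g]) (simp_all add: f uniform_fnsD)
  have "g holomorphic_on interior K"
  proof (rule holomorphic_uniform_sequence)
    fix x assume "x \<in> interior K"
    then obtain d where "0 < d" "cball x d \<subseteq> interior K"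
      using open_contains_cball open_interior by blast
    moreover from this have "uniform_limit (cball x d) f g sequentially"
      using g interior_subset by (blast intro: uniform_limit_on_subset)
    ultimately show "\<exists>d>0. cball x d \<subseteq> interior K \<and> uniform_limit (cball x d) f g sequentially"
      by blast
  qed (simp_all add: f uniform_fnsD)
  with cont have G: "restrict g K \<in> uniform_fns K" by (rule uniform_fnsI)
  have lim: "\<forall>\<^sub>F k in sequentially. uniform_norm K (u k \<ominus>\<^bsub>?X\<^esub> encode (restrict g K)) < \<epsilon>" if "0 < \<epsilon>" for \<epsilon>
  proof -
    \<comment> \<open>Half of \<epsilon>, because strict pointwise bounds give only a weak bound on
      the supremum.\<close>
    have "\<forall>\<^sub>F k in sequentially. \<forall>z\<in>K. dist (f k z) (g z) < \<epsilon> / 2"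
      using g half_gt_zero[OF \<open>0 < \<epsilon>\<close>] unfolding uniform_limit_iff by blast
    then show ?thesis
    proof (rule eventually_mono)
      fix k assume "\<forall>z\<in>K. dist (f k z) (g z) < \<epsilon> / 2"
      then have "uniform_norm K (u k \<ominus>\<^bsub>?X\<^esub> encode (restrict g K)) \<le> \<epsilon> / 2"
        unfolding f(2) uniform_module_minus[OF f(1) G]
        by (intro uniform_norm_leI) (auto simp: dist_norm less_imp_le)
      then show "uniform_norm K (u k \<ominus>\<^bsub>?X\<^esub> encode (restrict g K)) < \<epsilon>" using \<open>0 < \<epsilon>\<close> by simp
    qed
  qed
  have "encode (restrict g K) \<in> carrier ?X" "u k \<in> carrier ?X" for k
    using G f by (auto simp: uniform_module_simps)
  then have "limitin (top_of ?X) u (encode (restrict g K)) sequentially"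
    by (simp add: limitin_uniform_module lim)
  then show ?thesis by (rule exI[of _ "encode (restrict g K)"])
qed

lemma seminorm_on_uniform_norm: "seminorm_on (uniform_module K) (uniform_norm K)"
  by (auto simp: seminorm_on_def uniform_module_simps uniform_norm_nonneg uniform_norm_add
      uniform_norm_mult)

lemma metrizable_uniform_module:
  "metrizable_space (top_of
    (uniform_module K :: (complex \<Rightarrow> complex, nat \<Rightarrow> (complex \<Rightarrow> complex) \<times> 'q) tmod))"
  unfolding top_of_uniform_module
proof (rule metrizable_seminorm_topology)
  let ?X = "uniform_module K :: (complex \<Rightarrow> complex, nat \<Rightarrow> (complex \<Rightarrow> complex) \<times> 'q) tmod"
  fix x y assume xy: "x \<in> carrier ?X" "y \<in> carrier ?X"
  then obtain f g where *: "f \<in> uniform_fns K" "g \<in> uniform_fns K" "x = encode f" "y = encode g"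
    by (auto simp: uniform_module_simps)
  have "(\<lambda>z\<in>K. f z - g z) \<in> uniform_fns K"
    using * by (simp add: uniform_fns_closed)
  then show "0 \<le> uniform_norm K (x \<ominus>\<^bsub>?X\<^esub> y)"
    using uniform_norm_nonneg by (simp add: * uniform_module_minus)
  show "uniform_norm K (x \<ominus>\<^bsub>?X\<^esub> y) = uniform_norm K (y \<ominus>\<^bsub>?X\<^esub> x)"
    by (auto simp: * uniform_module_minus norm_minus_commute intro: uniform_norm_cong)
  show "uniform_norm K (x \<ominus>\<^bsub>?X\<^esub> y) = 0 \<longleftrightarrow> x = y"
    using xy by (rule uniform_norm_dist_zero)
qed (rule uniform_norm_dist_triangle)

lemma frechet_space_uniform_module:
  "frechet_space (uniform_module K :: (complex \<Rightarrow> complex, nat \<Rightarrow> (complex \<Rightarrow> complex) \<times> 'q) tmod)"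
    (is "frechet_space ?X")
proof -
  have "\<exists>S. (\<forall>p\<in>S. seminorm_on ?X p) \<and> top_of ?X = seminorm_topology ?X S"
    using seminorm_on_uniform_norm
    by (intro exI[of _ "{uniform_norm K}"]) (simp add: top_of_uniform_module)
  then show ?thesis
    unfolding frechet_space_def
    by (intro conjI allI impI module_uniform_module metrizable_uniform_module uniform_module_complete)
qed

end

section \<open>Topologically free modules and admissible epimorphisms\<close>

text \<open>The universal property of the tensor product ranges over spaces of the exact record type
  \<open>tvs\<close>, whereas test modules also carry an action. Truncation to the parent record
  bridges the two.\<close>

lemma module_truncate:
  assumes "Module.module complex_ring X" shows "Module.module complex_ring (tvs.truncate X)"
proof -
  interpret module complex_ring X by fact
  have "abelian_group (tvs.truncate X)"
  proof (rule abelian_groupI)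
    fix x assume "x \<in> carrier (tvs.truncate X)"
    then show "\<exists>y\<in>carrier (tvs.truncate X). y \<oplus>\<^bsub>tvs.truncate X\<^esub> x = \<zero>\<^bsub>tvs.truncate X\<^esub>"
      by (intro bexI[of _ "\<ominus>\<^bsub>X\<^esub> x"]) (simp_all add: tvs.truncate_def M.l_neg)
  qed (simp_all add: tvs.truncate_def M.a_ac)
  then show ?thesis
    by (rule moduleI[OF R.is_cring])
      (simp_all add: tvs.truncate_def smult_l_distr smult_r_distr smult_assoc1)
qed

lemma frechet_space_truncate:
  assumes "frechet_space X" shows "frechet_space (tvs.truncate X)"
proof -
  have [simp]: "carrier (tvs.truncate X) = carrier X" "top_of (tvs.truncate X) = top_of X"
    "zero (tvs.truncate X) = zero X" "add (tvs.truncate X) = add X" "smult (tvs.truncate X) = smult X"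
    by (simp_all add: tvs.truncate_def)
  have minus: "x \<ominus>\<^bsub>tvs.truncate X\<^esub> y = x \<ominus>\<^bsub>X\<^esub> y" for x y
    by (simp add: a_minus_def a_inv_def m_inv_def)
  have "seminorm_topology (tvs.truncate X) S = seminorm_topology X S" for S
    by (rule seminorm_topology_cong) simp_all
  then show ?thesis
    using assms module_truncate[of X]
    by (simp add: frechet_space_def seminorm_on_def tvs_Cauchy_def minus)
qed

lemma continuous_linear_truncate: "continuous_linear T (tvs.truncate X) f \<longleftrightarrow> continuous_linear T X f"
  by (simp add: continuous_linear_def tvs.truncate_def)

lemma continuous_bilinear_truncate:
  "continuous_bilinear A E (tvs.truncate X) b \<longleftrightarrow> continuous_bilinear A E X b"
  by (simp add: continuous_bilinear_def tvs.truncate_def)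

lemma continuous_linear_compose:
  assumes "continuous_linear E F f" "continuous_linear F G g"
  shows "continuous_linear E G (\<lambda>x. g (f x))"
  using assms continuous_map_compose[of "top_of E" "top_of F" f "top_of G" g]
  by (simp add: continuous_linear_def Pi_iff o_def)

lemma continuous_linear_closed:
  "continuous_linear E F f \<Longrightarrow> x \<in> carrier E \<Longrightarrow> f x \<in> carrier F"
  by (auto simp: continuous_linear_def)

lemma continuous_bilinear_right:
  assumes "continuous_bilinear A E F b" "a \<in> carrier A" "topspace (top_of A) = carrier A"
  shows "continuous_linear E F (b a)"
proof -
  have "continuous_map (top_of E) (prod_topology (top_of A) (top_of E)) (\<lambda>x. (a, x))"
    using assms(2,3) by (intro continuous_map_pairedI) simp_all
  moreover have "continuous_map (prod_topology (top_of A) (top_of E)) (top_of F) (\<lambda>(x, y). b x y)"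
    using assms(1) by (simp add: continuous_bilinear_def)
  ultimately have "continuous_map (top_of E) (top_of F) ((\<lambda>(x, y). b x y) \<circ> (\<lambda>x. (a, x)))"
    by (rule continuous_map_compose)
  then show ?thesis
    using assms(1,2) by (simp add: continuous_linear_def continuous_bilinear_def o_def)
qed

lemma continuous_bilinear_compose_right:
  assumes b: "continuous_bilinear A X Z b" and h: "continuous_linear E X h"
  shows "continuous_bilinear A E Z (\<lambda>a e. b a (h e))"
proof -
  let ?AE = "prod_topology (top_of A) (top_of E)"
  have "continuous_map ?AE (top_of X) (h \<circ> snd)"
    using h by (intro continuous_map_compose[OF continuous_map_snd]) (simp add: continuous_linear_def)
  then have "continuous_map ?AE (prod_topology (top_of A) (top_of X)) (\<lambda>p. (fst p, (h \<circ> snd) p))"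
    by (rule continuous_map_pairedI[OF continuous_map_fst])
  moreover have "continuous_map (prod_topology (top_of A) (top_of X)) (top_of Z) (\<lambda>(x, y). b x y)"
    using b by (simp add: continuous_bilinear_def)
  ultimately have "continuous_map ?AE (top_of Z) ((\<lambda>(x, y). b x y) \<circ> (\<lambda>p. (fst p, (h \<circ> snd) p)))"
    by (rule continuous_map_compose)
  moreover have "(\<lambda>(x, y). b x y) \<circ> (\<lambda>p. (fst p, (h \<circ> snd) p)) = (\<lambda>(a, e). b a (h e))"
    by auto
  ultimately show ?thesis
    using b h by (simp add: continuous_linear_def continuous_bilinear_def Pi_iff)
qed

lemma continuous_bilinear_compose_linear:
  assumes b: "continuous_bilinear A E X b" and g: "continuous_linear X Z g"
  shows "continuous_bilinear A E Z (\<lambda>a e. g (b a e))"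
proof -
  let ?AE = "prod_topology (top_of A) (top_of E)"
  have "continuous_map ?AE (top_of Z) (g \<circ> (\<lambda>(x, y). b x y))"
    using b g by (intro continuous_map_compose[of _ "top_of X"])
      (simp_all add: continuous_linear_def continuous_bilinear_def)
  moreover have "g \<circ> (\<lambda>(x, y). b x y) = (\<lambda>(x, y). g (b x y))" by auto
  ultimately show ?thesis
    using b g by (simp add: continuous_linear_def continuous_bilinear_def Pi_iff)
qed

section \<open>The universal property of the tensor product and lifting from free modules\<close>

lemma projective_tensor_product_factor:
  fixes F :: "(nat \<Rightarrow> 'a \<times> 'e) tvs"
    and A :: "('a, 'm) tvs_scheme" and E :: "('e, 'l) tvs_scheme"
  assumes "projective_tensor_product A E T \<theta>" "frechet_space F" "continuous_bilinear A E F b"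
  shows "\<exists>f. continuous_linear T F f \<and> (\<forall>a\<in>carrier A. \<forall>e\<in>carrier E. f (\<theta> a e) = b a e) \<and>
           (\<forall>g. continuous_linear T F g \<and> (\<forall>a\<in>carrier A. \<forall>e\<in>carrier E. g (\<theta> a e) = b a e) \<longrightarrow>
              (\<forall>t\<in>carrier T. g t = f t))"
  using assms(1)[unfolded projective_tensor_product_def, THEN conjunct2, THEN conjunct2, THEN spec,
      THEN spec, THEN mp, OF conjI[OF assms(2,3)]] .

text \<open>Both maps factor the same continuous bilinear map, namely \<open>f\<close> composed with
  \<open>\<theta>\<close>, so the uniqueness clause identifies each with the universal
  factorization.\<close>

lemma projective_tensor_product_unique:
  fixes F :: "(nat \<Rightarrow> 'a \<times> 'e, 'z) tvs_scheme"
    and A :: "('a, 'm) tvs_scheme" and E :: "('e, 'l) tvs_scheme"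
  assumes T: "projective_tensor_product A E T \<theta>" and F: "frechet_space F"
    and f: "continuous_linear T F f" and g: "continuous_linear T F g"
    and eq: "\<And>a e. a \<in> carrier A \<Longrightarrow> e \<in> carrier E \<Longrightarrow> f (\<theta> a e) = g (\<theta> a e)"
    and t: "t \<in> carrier T"
  shows "f t = g t"
proof -
  let ?F = "tvs.truncate F" and ?b = "\<lambda>a e. f (\<theta> a e)"
  have "continuous_bilinear A E T \<theta>" using T by (simp add: projective_tensor_product_def)
  then have b: "continuous_bilinear A E ?F ?b"
    unfolding continuous_bilinear_truncate using f by (rule continuous_bilinear_compose_linear)
  obtain h where h: "\<forall>g. continuous_linear T ?F g \<and>
      (\<forall>a\<in>carrier A. \<forall>e\<in>carrier E. g (\<theta> a e) = ?b a e) \<longrightarrow> (\<forall>t\<in>carrier T. g t = h t)"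
    using projective_tensor_product_factor[OF T frechet_space_truncate[OF F] b]
    by (elim exE conjE) (rule that)
  have "f t = h t" using h[rule_format, of f] f t by (simp add: continuous_linear_truncate)
  moreover have "g t = h t" using h[rule_format, of g] g t eq by (simp add: continuous_linear_truncate)
  ultimately show ?thesis by simp
qed

text \<open>The classical argument that free modules are projective: choose images of the elements 1
  \<otimes> e by the linear splitting and extend by the action of \<open>A\<close>. That the
  extension is a module map and that it lifts \<phi> are equalities between continuous linear maps,
  checked on elementary tensors. The test modules live in the type belonging to \<open>E\<close>,
  not to \<open>P\<close>.\<close>

lemma topologically_free_lifting:
  fixes X Y :: "('a, nat \<Rightarrow> 'a \<times> 'e) tmod"
    and A :: "('a, 'm) tvs_scheme" and P :: "('a, 'p, 'l) tmod_scheme"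
  assumes top: "topspace (top_of A) = carrier A" and monoid: "Group.monoid A"
    and free: "topologically_free TYPE('e) A P"
    and X: "frechet_module A X" and Y: "frechet_module A Y" and \<sigma>: "admissible_epi A X Y \<sigma>"
    and \<phi>: "tmod_hom A P Y \<phi>"
  shows "\<exists>\<psi>. tmod_hom A P X \<psi> \<and> (\<forall>x\<in>carrier P. \<sigma> (\<psi> x) = \<phi> x)"
proof -
  interpret A: Group.monoid A by (rule monoid)
  note A = top A.one_closed A.r_one A.m_closed
  obtain E :: "'e tvs" and T :: "('a, nat \<Rightarrow> 'a \<times> 'e) tmod" and \<theta> where
    T: "projective_tensor_product A E T \<theta>" "frechet_module A T" and
    act\<theta>: "\<And>a b e. a \<in> carrier A \<Longrightarrow> b \<in> carrier A \<Longrightarrow> e \<in> carrier E \<Longrightarrow>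
      act T a (\<theta> b e) = \<theta> (a \<otimes>\<^bsub>A\<^esub> b) e" and iso: "tmod_iso A P T"
    using free unfolding topologically_free_def by metis
  obtain \<alpha> \<beta> where \<alpha>: "tmod_hom A P T \<alpha>" and \<beta>: "tmod_hom A T P \<beta>"
    and \<beta>\<alpha>: "\<And>x. x \<in> carrier P \<Longrightarrow> \<beta> (\<alpha> x) = x"
    using iso unfolding tmod_iso_def by metis
  obtain \<kappa> where \<kappa>: "continuous_linear Y X \<kappa>" "\<And>y. y \<in> carrier Y \<Longrightarrow> \<sigma> (\<kappa> y) = y"
    and \<sigma>h: "tmod_hom A X Y \<sigma>"
    using \<sigma> unfolding admissible_epi_def by metis
  note lin = \<alpha>[unfolded tmod_hom_def, THEN conjunct1] \<beta>[unfolded tmod_hom_def, THEN conjunct1]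
    \<sigma>h[unfolded tmod_hom_def, THEN conjunct1] \<phi>[unfolded tmod_hom_def, THEN conjunct1]
  have \<theta>: "continuous_bilinear A E T \<theta>" using T(1) by (simp add: projective_tensor_product_def)
  have \<phi>\<beta>: "continuous_linear T Y (\<lambda>t. \<phi> (\<beta> t))" by (rule continuous_linear_compose[OF lin(2,4)])
  have frX: "frechet_space X" and frY: "frechet_space Y" and actX: "continuous_bilinear A X X (act X)"
    and actT: "continuous_bilinear A T T (act T)"
    using X Y T(2) by (simp_all add: frechet_module_def)
  \<comment> \<open>The splitting \<open>\<kappa>\<close> is only linear, so it is applied to the
    tensors 1 \<otimes> e alone; the action of \<open>A\<close> does the rest.\<close>
  define h where "h e = \<kappa> (\<phi> (\<beta> (\<theta> \<one>\<^bsub>A\<^esub> e)))" for e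
  have h: "continuous_linear E X h"
    unfolding h_def
    by (rule continuous_linear_compose[OF continuous_linear_compose[OF
          continuous_bilinear_right[OF \<theta> A(2,1)] \<phi>\<beta>] \<kappa>(1)])
  have hc: "h e \<in> carrier X" if "e \<in> carrier E" for e
    using h that by (rule continuous_linear_closed)
  have b: "continuous_bilinear A E (tvs.truncate X) (\<lambda>a e. act X a (h e))"
    unfolding continuous_bilinear_truncate using actX h by (rule continuous_bilinear_compose_right)
  obtain f where "continuous_linear T (tvs.truncate X) f"
    and "\<forall>a\<in>carrier A. \<forall>e\<in>carrier E. f (\<theta> a e) = act X a (h e)"
    using projective_tensor_product_factor[OF T(1) frechet_space_truncate[OF frX] b]
    by (elim exE conjE) (rule that)
  then have f\<theta>: "\<And>a e. a \<in> carrier A \<Longrightarrow> e \<in> carrier E \<Longrightarrow> f (\<theta> a e) = act X a (h e)" by blast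
  from \<open>continuous_linear T (tvs.truncate X) f\<close> have f: "continuous_linear T X f" by (simp add: continuous_linear_truncate)
  have \<theta>c: "\<theta> a e \<in> carrier T" if "a \<in> carrier A" "e \<in> carrier E" for a e
    using \<theta> that by (simp add: continuous_bilinear_def)
  have act_f: "f (act T a t) = act X a (f t)" if a: "a \<in> carrier A" and t: "t \<in> carrier T" for a t
  proof (rule projective_tensor_product_unique[OF T(1) frX _ _ _ t])
    show "continuous_linear T X (\<lambda>t. f (act T a t))"
      by (rule continuous_linear_compose[OF continuous_bilinear_right[OF actT a A(1)] f])
    show "continuous_linear T X (\<lambda>t. act X a (f t))"
      by (rule continuous_linear_compose[OF f continuous_bilinear_right[OF actX a A(1)]])
    fix b e assume be: "b \<in> carrier A" "e \<in> carrier E"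
    then have "f (act T a (\<theta> b e)) = act X (a \<otimes>\<^bsub>A\<^esub> b) (h e)"
      using a A(4) by (simp add: act\<theta> f\<theta>)
    also have "\<dots> = act X a (act X b (h e))"
      using X a be hc unfolding frechet_module_def by metis
    finally show "f (act T a (\<theta> b e)) = act X a (f (\<theta> b e))" using be by (simp add: f\<theta>)
  qed
  have \<sigma>f: "\<sigma> (f t) = \<phi> (\<beta> t)" if "t \<in> carrier T" for t
  proof (rule projective_tensor_product_unique[OF T(1) frY _ \<phi>\<beta> _ that])
    show "continuous_linear T Y (\<lambda>t. \<sigma> (f t))" by (rule continuous_linear_compose[OF f lin(3)])
    fix a e assume ae: "a \<in> carrier A" "e \<in> carrier E"
    note cP = continuous_linear_closed[OF lin(2) \<theta>c[OF A(2) ae(2)]]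
    note c = cP continuous_linear_closed[OF lin(4) cP]
    have "\<sigma> (f (\<theta> a e)) = act Y a (\<sigma> (h e))"
      using ae hc \<sigma>h by (simp add: f\<theta> tmod_hom_def)
    also have "\<sigma> (h e) = \<phi> (\<beta> (\<theta> \<one>\<^bsub>A\<^esub> e))" unfolding h_def by (rule \<kappa>(2)[OF c(2)])
    also have "act Y a \<dots> = \<phi> (act P a (\<beta> (\<theta> \<one>\<^bsub>A\<^esub> e)))"
      using \<phi> ae c by (simp add: tmod_hom_def)
    also have "act P a (\<beta> (\<theta> \<one>\<^bsub>A\<^esub> e)) = \<beta> (act T a (\<theta> \<one>\<^bsub>A\<^esub> e))"
      using \<beta> ae \<theta>c[OF A(2) ae(2)] by (simp add: tmod_hom_def)
    also have "act T a (\<theta> \<one>\<^bsub>A\<^esub> e) = \<theta> a e" using ae A by (simp add: act\<theta>)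
    finally show "\<sigma> (f (\<theta> a e)) = \<phi> (\<beta> (\<theta> a e))" .
  qed
  show ?thesis
  proof (intro exI conjI ballI)
    show "tmod_hom A P X (\<lambda>x. f (\<alpha> x))"
      using continuous_linear_compose[OF lin(1) f] \<alpha> act_f lin(1)
      by (auto simp: tmod_hom_def dest: continuous_linear_closed)
    fix x assume "x \<in> carrier P"
    then show "\<sigma> (f (\<alpha> x)) = \<phi> x" using \<sigma>f[of "\<alpha> x"] \<beta>\<alpha> lin(1) by (simp add: continuous_linear_closed)
  qed
qed

section \<open>The algebra of holomorphic functions on U and its action on A(K)\<close>

lemma hol_simps:
  "carrier (hol U) = {f \<in> extensional U. f holomorphic_on U}"
  "monoid.mult (hol U) = (\<lambda>f g. \<lambda>z\<in>U. f z * g z)"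
  "one (hol U) = (\<lambda>z\<in>U. 1)"
  "add (hol U) = (\<lambda>f g. \<lambda>z\<in>U. f z + g z)"
  "smult (hol U) = (\<lambda>c f. \<lambda>z\<in>U. c * f z)"
  "top_of (hol U) = compact_open U euclidean (carrier (hol U))"
  by (simp_all add: hol_def)

lemma topspace_compact_open [simp]: "topspace (compact_open U T C) = C"
proof -
  \<comment> \<open>The empty compact set imposes no condition, so the whole of \<open>C\<close> is
    itself subbasic.\<close>
  have "C \<in> {{f \<in> C. f ` K \<subseteq> V} | K V. compact K \<and> K \<subseteq> U \<and> openin T V}"
    by (rule CollectI, rule exI[of _ "{}"], rule exI[of _ "{}"]) simp
  then show ?thesis unfolding compact_open_def topology_generated_by_topspace by blast
qed

lemma compact_open_subbasis:
  "compact K \<Longrightarrow> K \<subseteq> U \<Longrightarrow> openin T V \<Longrightarrow> openin (compact_open U T C) {f \<in> C. f ` K \<subseteq> V}"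
  unfolding compact_open_def by (rule topology_generated_by_Basis) blast

lemma holI:
  assumes "f holomorphic_on U" shows "restrict f U \<in> carrier (hol U)"
  using holomorphic_transform[OF assms, of "restrict f U"] by (simp add: hol_simps)

lemma monoid_hol: "Group.monoid (hol U)"
proof (rule monoidI)
  show "\<one>\<^bsub>hol U\<^esub> \<in> carrier (hol U)" unfolding hol_simps(3) by (rule holI) (rule holomorphic_on_const)
  show "a \<otimes>\<^bsub>hol U\<^esub> b \<in> carrier (hol U)" if "a \<in> carrier (hol U)" "b \<in> carrier (hol U)" for a b
    unfolding hol_simps(2) by (rule holI) (use that in \<open>auto simp: hol_simps intro!: holomorphic_on_mult\<close>)
qed (auto simp: hol_simps extensional_restrict mult.assoc cong: restrict_cong)

text \<open>Compact-open neighbourhoods contain uniform ones: cover \<open>K\<close> by finitely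
  many balls on whose closures \<open>a\<close> varies by less than \<epsilon>/2, and ask of
  \<open>b\<close> that it map each piece of \<open>K\<close> into the \<epsilon>/2-ball around the
  value of \<open>a\<close> at the centre.\<close>

lemma compact_open_uniform_nbhd:
  assumes K: "compact K" "K \<subseteq> U" and a: "a \<in> C" "continuous_on K a" and \<epsilon>: "0 < (\<epsilon> :: real)"
  obtains W where "openin (compact_open U euclidean C) W" "a \<in> W"
    "\<And>b z. b \<in> W \<Longrightarrow> z \<in> K \<Longrightarrow> cmod (b z - a z) < \<epsilon>"
proof -
  have "\<exists>d>0. \<forall>w\<in>K. dist w z \<le> d \<longrightarrow> dist (a w) (a z) < \<epsilon> / 2" if z: "z \<in> K" for z
  proof -
    obtain d where d: "d > 0" "\<forall>w\<in>K. dist w z < d \<longrightarrow> dist (a w) (a z) < \<epsilon> / 2"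
      using a(2)[unfolded continuous_on_iff, rule_format, OF z half_gt_zero[OF \<epsilon>]] by blast
    \<comment> \<open>The radius is halved so that the estimate holds on the closed ball, whose
      intersection with \<open>K\<close> is compact.\<close>
    show ?thesis by (rule exI[of _ "d / 2"]) (use d in auto)
  qed
  then obtain d where d: "\<And>z. z \<in> K \<Longrightarrow> d z > 0"
      "\<And>z w. z \<in> K \<Longrightarrow> w \<in> K \<Longrightarrow> dist w z \<le> d z \<Longrightarrow> dist (a w) (a z) < \<epsilon> / 2"
    by metis
  have "K \<subseteq> (\<Union>z\<in>K. ball z (d z))" using d(1) by force
  then obtain Z where Z: "Z \<subseteq> K" "finite Z" "K \<subseteq> (\<Union>z\<in>Z. ball z (d z))"
    using compactE_image[OF K(1), of K "\<lambda>z. ball z (d z)"] by blast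
  let ?N = "\<lambda>z. {f \<in> C. f ` (K \<inter> cball z (d z)) \<subseteq> ball (a z) (\<epsilon> / 2)}"
  \<comment> \<open>The factor \<open>C\<close> matters when \<open>K\<close>, and with it
    \<open>Z\<close>, is empty: the empty intersection would be the whole type.\<close>
  define W where "W = C \<inter> (\<Inter>z\<in>Z. ?N z)"
  have N: "openin (compact_open U euclidean C) (?N z)" for z
    by (rule compact_open_subbasis) (use K in auto)
  have "openin (compact_open U euclidean C) C"
    using openin_topspace[of "compact_open U euclidean C"] by simp
  then have "openin (compact_open U euclidean C) W"
    unfolding W_def using Z(2) N
    by (cases "Z = {}") (auto intro!: openin_Int openin_INT)
  moreover have "a \<in> W"
    using a(1) d(2) Z(1) by (force simp: W_def dist_commute)
  moreover have "cmod (b z - a z) < \<epsilon>" if b: "b \<in> W" and z: "z \<in> K" for b z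
  proof -
    obtain y where y: "y \<in> Z" "dist y z < d y" using Z(3) z by auto
    then have "b \<in> ?N y" using b by (simp add: W_def)
    then have "dist (a y) (b z) < \<epsilon> / 2" using y z by force
    moreover have "dist (a z) (a y) < \<epsilon> / 2" using d(2)[of y z] y z Z(1) by (auto simp: dist_commute)
    ultimately show ?thesis
      using dist_triangle[of "a z" "b z" "a y"] by (simp add: dist_norm norm_minus_commute)
  qed
  ultimately show ?thesis by (rule that)
qed

text \<open>Continuity is tested by limits along the filters \<open>atin\<close>; this is the
  convergence from which each such test starts.\<close>

lemma limitin_atin_self_id: "x \<in> topspace X \<Longrightarrow> limitin X (\<lambda>y. y) x (atin X x)"
  using continuous_map_id[of X] unfolding continuous_map_atin by (simp add: id_def)

context
  fixes K :: "complex set"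
  assumes compact: "compact K" and nonempty: "K \<noteq> {}"
begin

lemmas limitin_um = limitin_uniform_module[OF compact nonempty]

lemma uniform_module_act_closed:
  assumes "K \<subseteq> U" "a \<in> carrier (hol U)" "f \<in> uniform_fns K"
  shows "(\<lambda>z\<in>K. a z * f z) \<in> uniform_fns K"
proof -
  have "a holomorphic_on K" "a holomorphic_on interior K"
    using assms(1,2) interior_subset[of K] by (auto simp: hol_simps intro: holomorphic_on_subset)
  then show ?thesis
    using assms(3) by (intro uniform_fnsI continuous_on_mult holomorphic_on_mult)
      (auto simp: uniform_fnsD holomorphic_on_imp_continuous_on)
qed

lemma continuous_act_uniform_module:
  assumes "K \<subseteq> U"
  shows "continuous_map (prod_topology (top_of (hol U)) (top_of (uniform_module K)))
    (top_of (uniform_module K :: (complex \<Rightarrow> complex, nat \<Rightarrow> (complex \<Rightarrow> complex) \<times> 'q) tmod))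
    (\<lambda>(a, x). act (uniform_module K) a x)"
    (is "continuous_map (prod_topology ?TA ?TX) _ _")
  unfolding continuous_map_atin
proof
  fix p assume "p \<in> topspace (prod_topology ?TA ?TX)"
  then obtain a f where p: "p = (a, encode f)" and a: "a \<in> carrier (hol U)" and f: "f \<in> uniform_fns K"
    by (auto simp: hol_simps top_of_uniform_module uniform_module_simps)
  let ?F = "atin (prod_topology ?TA ?TX) p"
  have pt: "p \<in> topspace (prod_topology ?TA ?TX)" by fact
  have fst: "limitin ?TA fst a ?F" and snd: "limitin ?TX snd (encode f) ?F"
    using continuous_map_fst[of ?TA ?TX] continuous_map_snd[of ?TA ?TX] pt
    unfolding continuous_map_atin by (auto simp: p)
  have aK: "continuous_on K a"
    using a assms by (auto simp: hol_simps intro: holomorphic_on_imp_continuous_on holomorphic_on_subset)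
  then obtain M where M: "\<And>z. z \<in> K \<Longrightarrow> cmod (a z) \<le> M" "0 \<le> M"
    using compact_imp_bounded[OF compact_continuous_image[OF aK compact]] nonempty
    unfolding bounded_iff by (metis ex_in_conv image_eqI norm_ge_zero order_trans)
  let ?N = "uniform_norm K (encode f :: nat \<Rightarrow> (complex \<Rightarrow> complex) \<times> 'q)"
  have N0: "0 \<le> ?N" using uniform_norm_nonneg[OF compact nonempty f] .
  have cl: "\<forall>\<^sub>F q in ?F. snd q \<in> carrier (uniform_module K)"
    using snd unfolding limitin_um by blast
  have cl1: "\<forall>\<^sub>F q in ?F. fst q \<in> carrier (hol U)"
    by (rule limitinD[OF fst]) (use openin_topspace[of ?TA] a in \<open>auto simp: hol_simps(6)\<close>)
  show "limitin ?TX (\<lambda>(a, x). act (uniform_module K) a x) ((\<lambda>(a, x). act (uniform_module K) a x) p) ?F"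
    unfolding limitin_um
  proof (intro conjI allI impI)
    show "(\<lambda>(a, x). act (uniform_module K) a x) p \<in> carrier (uniform_module K)"
      using uniform_module_act_closed[OF assms a f] by (simp add: p uniform_module_simps)
    show "\<forall>\<^sub>F q in ?F. (\<lambda>(a, x). act (uniform_module K) a x) q \<in> carrier (uniform_module K)"
      using cl cl1
    proof eventually_elim
      case (elim q)
      then obtain g where "g \<in> uniform_fns K" "snd q = encode g" by (auto simp: uniform_module_simps)
      then show ?case
        using uniform_module_act_closed[OF assms elim(2)] by (auto simp: split_def uniform_module_simps)
    qed
    fix \<epsilon> :: real assume \<epsilon>: "0 < \<epsilon>"
    \<comment> \<open>Writing b g - a f = b (g - f) + (b - a) f, the error is at most (M + 1)
      \<delta> + \<delta> \<open>?N\<close>. The bound \<delta> at most 1 is what gives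
      \<open>M + 1\<close> as a bound for \<open>b\<close> on \<open>K\<close>.\<close>
    have "\<exists>\<delta>>0. \<delta> \<le> 1 \<and> \<delta> * s < \<epsilon>" if "0 < s" for s
    proof (intro exI[of _ "min 1 (\<epsilon> / (2 * s))"] conjI)
      have "min 1 (\<epsilon> / (2 * s)) * s \<le> \<epsilon> / (2 * s) * s" using that by (intro mult_right_mono) auto
      then show "min 1 (\<epsilon> / (2 * s)) * s < \<epsilon>" using that \<epsilon> by simp
    qed (use that \<epsilon> in auto)
    moreover have "0 < M + 1 + ?N" using M(2) N0 by simp
    ultimately obtain \<delta> where \<delta>: "0 < \<delta>" "\<delta> \<le> 1" "\<delta> * (M + 1 + ?N) < \<epsilon>" by metis
    obtain W where W: "openin ?TA W" "a \<in> W"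
      "\<And>b z. b \<in> W \<Longrightarrow> z \<in> K \<Longrightarrow> cmod (b z - a z) < \<delta>"
      unfolding hol_simps(6) using compact_open_uniform_nbhd[OF compact assms a aK \<delta>(1)] by metis
    have "\<forall>\<^sub>F q in ?F. fst q \<in> W" using fst W by (blast intro: limitinD)
    moreover have "\<forall>\<^sub>F q in ?F. uniform_norm K (snd q \<ominus>\<^bsub>uniform_module K\<^esub> encode f) < \<delta>"
      using snd \<delta>(1) unfolding limitin_um by blast
    ultimately show "\<forall>\<^sub>F q in ?F. uniform_norm K ((\<lambda>(a, x). act (uniform_module K) a x) q
        \<ominus>\<^bsub>uniform_module K\<^esub> (\<lambda>(a, x). act (uniform_module K) a x) p) < \<epsilon>"
      using cl cl1
    proof eventually_elim
      case (elim q)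
      obtain g where g: "g \<in> uniform_fns K" "snd q = encode g"
        using elim(3) by (auto simp: uniform_module_simps)
      define b where "b = fst q"
      have b: "b \<in> carrier (hol U)" "b \<in> W" using elim by (auto simp: b_def)
      have q: "q = (b, encode g)" using g(2) by (simp add: b_def prod_eq_iff)
      have gf: "(\<lambda>z\<in>K. g z - f z) \<in> uniform_fns K" using g f by (simp add: uniform_fns_closed)
      have "uniform_norm K (encode (\<lambda>z\<in>K. g z - f z) :: nat \<Rightarrow> (complex \<Rightarrow> complex) \<times> 'q) < \<delta>"
        using elim(2) unfolding g(2) uniform_module_minus[OF g(1) f] .
      then have gfz: "cmod (g z - f z) \<le> \<delta>" if "z \<in> K" for z
        using uniform_norm_ge[OF compact nonempty gf that] that
        by (metis order.strict_trans1 less_imp_le restrict_apply')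
      have eq: "(\<lambda>(a, x). act (uniform_module K) a x) q
        \<ominus>\<^bsub>uniform_module K\<^esub> (\<lambda>(a, x). act (uniform_module K) a x) p =
        (encode (\<lambda>z\<in>K. b z * g z - a z * f z) :: nat \<Rightarrow> (complex \<Rightarrow> complex) \<times> 'q)"
        using uniform_module_minus[OF uniform_module_act_closed[OF assms b(1) g(1)]
            uniform_module_act_closed[OF assms a f]]
        by (simp add: q p uniform_module_simps(5) cong: restrict_cong)
      have bound: "uniform_norm K (encode (\<lambda>z\<in>K. b z * g z - a z * f z)
          :: nat \<Rightarrow> (complex \<Rightarrow> complex) \<times> 'q) \<le> \<delta> * (M + 1 + ?N)"
      proof (rule uniform_norm_leI[OF compact nonempty])
        fix z assume z: "z \<in> K"
        have ba: "cmod (b z - a z) \<le> \<delta>" using W(3)[OF b(2) z] by simp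
        have "cmod (b z) \<le> cmod (b z - a z) + cmod (a z)" using norm_triangle_ineq[of "b z - a z" "a z"] by simp
        then have bz: "cmod (b z) \<le> M + 1" using ba \<delta>(2) M(1)[OF z] by simp
        have "b z * g z - a z * f z = b z * (g z - f z) + (b z - a z) * f z" by (simp add: algebra_simps)
        then have "cmod (b z * g z - a z * f z) \<le> cmod (b z) * cmod (g z - f z) + cmod (b z - a z) * cmod (f z)"
          by (metis norm_mult norm_triangle_ineq)
        also have "\<dots> \<le> (M + 1) * \<delta> + \<delta> * ?N"
          using bz gfz[OF z] ba uniform_norm_ge[OF compact nonempty f z] M(2) \<delta>(1)
          by (intro add_mono mult_mono) auto
        finally show "cmod ((\<lambda>z\<in>K. b z * g z - a z * f z) z) \<le> \<delta> * (M + 1 + ?N)"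
          using z by (simp add: algebra_simps)
      qed
      show ?case unfolding eq by (rule order.strict_trans1[OF bound \<delta>(3)])
    qed
  qed
qed

lemma frechet_module_uniform_module:
  assumes "K \<subseteq> U"
  shows "frechet_module (hol U) (uniform_module K)"
proof -
  have [simp]: "z \<in> U" if "z \<in> K" for z using that assms by blast
  have "continuous_bilinear (hol U) (uniform_module K) (uniform_module K) (act (uniform_module K))"
    unfolding continuous_bilinear_def using continuous_act_uniform_module[OF assms]
    by (auto simp: uniform_module_simps hol_simps(4,5) uniform_module_act_closed[OF assms]
        ring_distribs mult_ac cong: restrict_cong)
  then show ?thesis
    unfolding frechet_module_def using frechet_space_uniform_module[OF compact nonempty]
    by (auto simp: uniform_module_simps hol_simps(2,3) mult.assoc cong: restrict_cong)
qed

lemma continuous_map_uniform_module: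
  fixes g :: "(nat \<Rightarrow> (complex \<Rightarrow> complex) \<times> 'q) \<Rightarrow> nat \<Rightarrow> (complex \<Rightarrow> complex) \<times> 's"
  assumes L: "compact L" "L \<noteq> {}"
    and g: "\<And>x. x \<in> carrier (uniform_module K) \<Longrightarrow> g x \<in> carrier (uniform_module L)"
    and le: "\<And>x y. x \<in> carrier (uniform_module K) \<Longrightarrow> y \<in> carrier (uniform_module K) \<Longrightarrow>
      uniform_norm L (g x \<ominus>\<^bsub>uniform_module L\<^esub> g y) \<le> uniform_norm K (x \<ominus>\<^bsub>uniform_module K\<^esub> y)"
  shows "continuous_map (top_of (uniform_module K)) (top_of (uniform_module L)) g"
  unfolding continuous_map_atin
proof
  let ?TX = "top_of (uniform_module K :: (complex \<Rightarrow> complex, nat \<Rightarrow> (complex \<Rightarrow> complex) \<times> 'q) tmod)"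
  fix x assume x: "x \<in> topspace ?TX"
  then have xc: "x \<in> carrier (uniform_module K)" by (simp add: top_of_uniform_module)
  have id: "limitin ?TX (\<lambda>y. y) x (atin ?TX x)" using x by (rule limitin_atin_self_id)
  then have ev: "\<forall>\<^sub>F y in atin ?TX x. y \<in> carrier (uniform_module K)" unfolding limitin_um by blast
  show "limitin (top_of (uniform_module L)) g (g x) (atin ?TX x)"
    unfolding limitin_uniform_module[OF L]
  proof (intro conjI allI impI g xc)
    show "\<forall>\<^sub>F y in atin ?TX x. g y \<in> carrier (uniform_module L)"
      using ev by eventually_elim (rule g)
    fix \<epsilon> :: real assume "0 < \<epsilon>"
    then have "\<forall>\<^sub>F y in atin ?TX x. uniform_norm K (y \<ominus>\<^bsub>uniform_module K\<^esub> x) < \<epsilon>"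
      using id unfolding limitin_um by blast
    then show "\<forall>\<^sub>F y in atin ?TX x. uniform_norm L (g y \<ominus>\<^bsub>uniform_module L\<^esub> g x) < \<epsilon>"
      using ev by eventually_elim (rule order.strict_trans1[OF le], auto simp: xc)
  qed
qed

end

text \<open>The splitting extends a value by a constant function. It preserves norms and is linear,
  but in general it does not commute with nonconstant functions, which leaves room for an
  obstruction to lifting. Restriction to a point is a contraction.\<close>

lemma admissible_epi_restrict:
  fixes K :: "complex set" and w :: complex
  assumes K: "compact K" "w \<in> K" "K \<subseteq> U"
  defines "\<sigma> \<equiv> \<lambda>x :: nat \<Rightarrow> (complex \<Rightarrow> complex) \<times> 'q.
    (encode (restrict (decode x) {w}) :: nat \<Rightarrow> (complex \<Rightarrow> complex) \<times> 'q)"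
  shows "admissible_epi (hol U) (uniform_module K) (uniform_module {w}) \<sigma>"
proof -
  have ne: "K \<noteq> {}" "{w} \<noteq> {}" "compact {w}" using K by auto
  define \<kappa> where "\<kappa> = (\<lambda>x :: nat \<Rightarrow> (complex \<Rightarrow> complex) \<times> 'q.
    (encode (\<lambda>z\<in>K. decode x w) :: nat \<Rightarrow> (complex \<Rightarrow> complex) \<times> 'q))"
  have \<kappa>c: "\<kappa> x \<in> carrier (uniform_module K)" for x
    by (simp add: \<kappa>_def uniform_module_simps uniform_fns_closed)
  have const: "restrict f {w} \<in> uniform_fns {w}" for f
    by (rule uniform_fnsI) (auto simp: holomorphic_on_def)
  have \<sigma>c: "\<sigma> x \<in> carrier (uniform_module {w})" for x
    by (simp add: \<sigma>_def uniform_module_simps const)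
  have [simp]: "w \<in> K" "w \<in> U" using K by auto
  have "continuous_linear (uniform_module K) (uniform_module {w}) \<sigma>"
    unfolding continuous_linear_def
  proof (intro conjI ballI allI)
    show "continuous_map (top_of (uniform_module K)) (top_of (uniform_module {w})) \<sigma>"
    proof (rule continuous_map_uniform_module[OF K(1) ne(1) ne(3,2) \<sigma>c])
      fix x y :: "nat \<Rightarrow> (complex \<Rightarrow> complex) \<times> 'q"
      assume "x \<in> carrier (uniform_module K)" "y \<in> carrier (uniform_module K)"
      then obtain f g where fg: "f \<in> uniform_fns K" "g \<in> uniform_fns K" "x = encode f" "y = encode g"
        by (auto simp: uniform_module_simps)
      have "(\<lambda>z\<in>K. f z - g z) \<in> uniform_fns K" using fg by (simp add: uniform_fns_closed)
      from uniform_norm_ge[OF K(1) ne(1) this K(2)]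
      show "uniform_norm {w} (\<sigma> x \<ominus>\<^bsub>uniform_module {w}\<^esub> \<sigma> y) \<le> uniform_norm K (x \<ominus>\<^bsub>uniform_module K\<^esub> y)"
        unfolding \<sigma>_def uniform_module_minus[OF const const] fg(3,4) uniform_module_minus[OF fg(1,2)]
        by (simp add: uniform_norm_def)
    qed
  qed (auto simp: \<sigma>c, auto simp: \<sigma>_def uniform_module_simps cong: restrict_cong)
  moreover have "continuous_linear (uniform_module {w}) (uniform_module K) \<kappa>"
    unfolding continuous_linear_def
  proof (intro conjI ballI allI)
    show "continuous_map (top_of (uniform_module {w})) (top_of (uniform_module K)) \<kappa>"
    proof (rule continuous_map_uniform_module[OF ne(3,2) K(1) ne(1) \<kappa>c])
      fix x y :: "nat \<Rightarrow> (complex \<Rightarrow> complex) \<times> 'q"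
      assume "x \<in> carrier (uniform_module {w})" "y \<in> carrier (uniform_module {w})"
      then obtain f g where fg: "f \<in> uniform_fns {w}" "g \<in> uniform_fns {w}" "x = encode f" "y = encode g"
        by (auto simp: uniform_module_simps)
      show "uniform_norm K (\<kappa> x \<ominus>\<^bsub>uniform_module K\<^esub> \<kappa> y) \<le> uniform_norm {w} (x \<ominus>\<^bsub>uniform_module {w}\<^esub> y)"
        unfolding \<kappa>_def fg(3,4) uniform_module_minus[OF fg(1,2)]
          uniform_module_minus[OF uniform_fns_closed(1) uniform_fns_closed(1)]
        by (rule uniform_norm_leI[OF K(1) ne(1)]) (simp add: uniform_norm_def)
    qed
  qed (auto simp: \<kappa>c, auto simp: \<kappa>_def uniform_module_simps cong: restrict_cong)
  moreover have "\<sigma> (act (uniform_module K) a x) = act (uniform_module {w}) a (\<sigma> x)" for a x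
    by (auto simp: \<sigma>_def uniform_module_simps cong: restrict_cong)
  moreover have "\<sigma> (\<kappa> y) = y" if y: "y \<in> carrier (uniform_module {w})" for y
  proof -
    obtain f where f: "f \<in> uniform_fns {w}" "y = encode f" using y by (auto simp: uniform_module_simps)
    have "restrict (\<lambda>z\<in>K. f w) {w} = restrict f {w}" by (auto simp: fun_eq_iff restrict_def)
    then show ?thesis using f by (simp add: \<sigma>_def \<kappa>_def)
  qed
  ultimately show ?thesis unfolding admissible_epi_def tmod_hom_def by blast
qed

section \<open>Holomorphic functions with values in the free disk algebra\<close>

lemma top_of_free_disk:
  "top_of (free_disk n r) = seminorm_topology (free_disk n r)
    {free_disk_norm n \<rho> \<tau> | \<rho> \<tau>. admissible_radii r \<rho> \<tau>}" (is "_ = seminorm_topology ?F ?S")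
proof -
  have "top_of ?F = seminorm_topology (free_disk_alg n r) ?S"
    by (simp add: free_disk_def module.defs tvs.defs admissible_radii_def)
  also have "\<dots> = seminorm_topology ?F ?S"
    by (rule seminorm_topology_cong) (simp_all add: free_disk_def module.defs tvs.defs)
  finally show ?thesis .
qed

lemma topspace_free_disk [simp]: "topspace (top_of (free_disk n r)) = carrier (free_disk n r)"
  by (simp add: top_of_free_disk)

lemma limitin_free_disk:
  "limitin (top_of (free_disk n r)) f l G \<longleftrightarrow>
    l \<in> carrier (free_disk n r) \<and> (\<forall>\<^sub>F x in G. f x \<in> carrier (free_disk n r)) \<and>
    (\<forall>\<rho> \<tau>. admissible_radii r \<rho> \<tau> \<longrightarrow> ((\<lambda>x. free_disk_norm n \<rho> \<tau> (\<lambda>\<alpha>. f x \<alpha> - l \<alpha>)) \<longlongrightarrow> 0) G)"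
    (is "_ \<longleftrightarrow> ?l \<and> ?ev \<and> ?lim")
proof -
  let ?F = "free_disk n r"
  let ?S = "{free_disk_norm n \<rho> \<tau> | \<rho> \<tau>. admissible_radii r \<rho> \<tau>}"
  have "limitin (top_of ?F) f l G \<longleftrightarrow> ?l \<and> ?ev \<and>
      (\<forall>p\<in>?S. \<forall>\<epsilon>>0. \<forall>\<^sub>F x in G. p (f x \<ominus>\<^bsub>?F\<^esub> l) < \<epsilon>)"
    unfolding top_of_free_disk
  proof (rule limitin_seminorm_topology)
    fix p x y z assume p: "p \<in> ?S" and xyz: "x \<in> carrier ?F" "y \<in> carrier ?F" "z \<in> carrier ?F"
    obtain \<rho> \<tau> where \<rho>: "p = free_disk_norm n \<rho> \<tau>" "admissible_radii r \<rho> \<tau>" using p by blast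
    show "p (x \<ominus>\<^bsub>?F\<^esub> z) \<le> p (x \<ominus>\<^bsub>?F\<^esub> y) + p (y \<ominus>\<^bsub>?F\<^esub> z)"
      using free_disk_norm_add[OF free_disk_diff_closed[OF xyz(1,2)] free_disk_diff_closed[OF xyz(2,3)] \<rho>(2)]
      by (simp add: free_disk_minus xyz \<rho>(1))
  next
    fix p x assume p: "p \<in> ?S" and x: "x \<in> carrier ?F"
    obtain \<rho> \<tau> where \<rho>: "p = free_disk_norm n \<rho> \<tau>" using p by blast
    show "p (x \<ominus>\<^bsub>?F\<^esub> x) = 0" by (simp add: free_disk_minus x \<rho> free_disk_norm_eq)
  qed
  also have "\<dots> \<longleftrightarrow> ?l \<and> ?ev \<and> ?lim"
  proof (intro conj_cong refl)
    assume l: ?l and ev: ?ev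
    have "(\<forall>\<epsilon>>0. \<forall>\<^sub>F x in G. free_disk_norm n \<rho> \<tau> (f x \<ominus>\<^bsub>?F\<^esub> l) < \<epsilon>) \<longleftrightarrow>
      ((\<lambda>x. free_disk_norm n \<rho> \<tau> (\<lambda>\<alpha>. f x \<alpha> - l \<alpha>)) \<longlongrightarrow> 0) G" if rt: "admissible_radii r \<rho> \<tau>" for \<rho> \<tau>
      unfolding tendsto_iff
    proof (intro all_cong1 imp_cong refl)
      fix \<epsilon> :: real
      have "\<forall>\<^sub>F x in G. (free_disk_norm n \<rho> \<tau> (f x \<ominus>\<^bsub>?F\<^esub> l) < \<epsilon>) =
          (dist (free_disk_norm n \<rho> \<tau> (\<lambda>\<alpha>. f x \<alpha> - l \<alpha>)) 0 < \<epsilon>)"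
        using ev by eventually_elim
          (simp add: free_disk_minus l free_disk_norm_nonneg[OF rt])
      then show "(\<forall>\<^sub>F x in G. free_disk_norm n \<rho> \<tau> (f x \<ominus>\<^bsub>?F\<^esub> l) < \<epsilon>) =
        (\<forall>\<^sub>F x in G. dist (free_disk_norm n \<rho> \<tau> (\<lambda>\<alpha>. f x \<alpha> - l \<alpha>)) 0 < \<epsilon>)"
        by (rule eventually_subst)
    qed
    then show "(\<forall>p\<in>?S. \<forall>\<epsilon>>0. \<forall>\<^sub>F x in G. p (f x \<ominus>\<^bsub>?F\<^esub> l) < \<epsilon>) \<longleftrightarrow> ?lim" by blast
  qed
  finally show ?thesis .
qed

text \<open>Holomorphy only asserts that some derivative exists; here it is named, since the sum and
  product rules need its value, and its convergence is spelled out for each seminorm.\<close>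

definition free_disk_deriv ::
  "nat \<Rightarrow> ereal \<Rightarrow> complex set \<Rightarrow> (complex \<Rightarrow> nat list \<Rightarrow> complex) \<Rightarrow> complex \<Rightarrow> (nat list \<Rightarrow> complex) \<Rightarrow> bool" where
  "free_disk_deriv n r U f z d \<longleftrightarrow> d \<in> carrier (free_disk n r) \<and> (\<forall>\<rho> \<tau>. admissible_radii r \<rho> \<tau> \<longrightarrow>
    ((\<lambda>w. free_disk_norm n \<rho> \<tau> (\<lambda>\<alpha>. inverse (w - z) * (f w \<alpha> - f z \<alpha>) - d \<alpha>)) \<longlongrightarrow> 0) (at z within U))"

lemma vector_holomorphic_on_free_disk:
  assumes f: "f \<in> U \<rightarrow>\<^sub>E carrier (free_disk n r)"
  shows "vector_holomorphic_on (free_disk n r) f U \<longleftrightarrow> (\<forall>z\<in>U. \<exists>d. free_disk_deriv n r U f z d)"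
  unfolding vector_holomorphic_on_def
proof (intro ball_cong refl ex_cong1)
  let ?F = "free_disk n r"
  fix z d assume z: "z \<in> U"
  have U: "\<forall>\<^sub>F w in at z within U. w \<in> U" by (simp add: eventually_at_filter)
  have fU: "f w \<in> carrier ?F" if "w \<in> U" for w using f that by auto
  have eq: "inverse (w - z) \<odot>\<^bsub>?F\<^esub> (f w \<ominus>\<^bsub>?F\<^esub> f z) = (\<lambda>\<alpha>. inverse (w - z) * (f w \<alpha> - f z \<alpha>))"
    if "w \<in> U" for w
    using fU[OF that] fU[OF z] by (simp add: free_disk_simps(5) free_disk_minus)
  have ev: "\<forall>\<^sub>F w in at z within U. inverse (w - z) \<odot>\<^bsub>?F\<^esub> (f w \<ominus>\<^bsub>?F\<^esub> f z) \<in> carrier ?F"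
    using U by eventually_elim
      (simp only: eq, intro free_disk_smult_closed free_disk_diff_closed fU z, assumption)
  have "((\<lambda>w. free_disk_norm n \<rho> \<tau> (\<lambda>\<alpha>. (inverse (w - z) \<odot>\<^bsub>?F\<^esub> (f w \<ominus>\<^bsub>?F\<^esub> f z)) \<alpha> - d \<alpha>)) \<longlongrightarrow> 0) (at z within U)
    \<longleftrightarrow> ((\<lambda>w. free_disk_norm n \<rho> \<tau> (\<lambda>\<alpha>. inverse (w - z) * (f w \<alpha> - f z \<alpha>) - d \<alpha>)) \<longlongrightarrow> 0) (at z within U)" for \<rho> \<tau>
    by (rule tendsto_cong) (use U in eventually_elim, simp only: eq)
  then show "limitin (top_of ?F) (\<lambda>w. inverse (w - z) \<odot>\<^bsub>?F\<^esub> (f w \<ominus>\<^bsub>?F\<^esub> f z)) d (at z within U) \<longleftrightarrow>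
      free_disk_deriv n r U f z d"
    unfolding limitin_free_disk free_disk_deriv_def using ev by simp
qed

lemma free_disk_deriv_const:
  assumes "\<And>w. w \<in> U \<Longrightarrow> f w = c" "z \<in> U"
  shows "free_disk_deriv n r U f z (\<lambda>\<alpha>. 0)"
  unfolding free_disk_deriv_def
proof (intro conjI allI impI free_disk_zero_closed)
  fix \<rho> \<tau>
  have "\<forall>\<^sub>F w in at z within U. w \<in> U" by (simp add: eventually_at_filter)
  then have "\<forall>\<^sub>F w in at z within U.
      0 = free_disk_norm n \<rho> \<tau> (\<lambda>\<alpha>. inverse (w - z) * (f w \<alpha> - f z \<alpha>) - 0)"
    by eventually_elim (simp add: assms free_disk_norm_eq)
  then show "((\<lambda>w. free_disk_norm n \<rho> \<tau> (\<lambda>\<alpha>. inverse (w - z) * (f w \<alpha> - f z \<alpha>) - 0)) \<longlongrightarrow> 0) (at z within U)"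
    by (rule tendsto_eventually[OF eventually_mono]) simp
qed

text \<open>Elements of the function algebra are extensional, so the result of every operation is
  restricted to the punctured plane; derivatives within \<open>U\<close> are unaffected by
  this.\<close>

lemma free_disk_deriv_cong:
  assumes "\<And>w. w \<in> U \<Longrightarrow> f w = g w" "z \<in> U" "free_disk_deriv n r U f z d"
  shows "free_disk_deriv n r U g z d"
  unfolding free_disk_deriv_def
proof (intro conjI allI impI)
  show "d \<in> carrier (free_disk n r)" using assms(3) by (simp add: free_disk_deriv_def)
  fix \<rho> \<tau> assume rt: "admissible_radii r \<rho> \<tau>"
  have "\<forall>\<^sub>F w in at z within U. w \<in> U" by (simp add: eventually_at_filter)
  then have "\<forall>\<^sub>F w in at z within U.
      free_disk_norm n \<rho> \<tau> (\<lambda>\<alpha>. inverse (w - z) * (f w \<alpha> - f z \<alpha>) - d \<alpha>) =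
      free_disk_norm n \<rho> \<tau> (\<lambda>\<alpha>. inverse (w - z) * (g w \<alpha> - g z \<alpha>) - d \<alpha>)"
    by eventually_elim (simp add: assms(1,2))
  then show "((\<lambda>w. free_disk_norm n \<rho> \<tau> (\<lambda>\<alpha>. inverse (w - z) * (g w \<alpha> - g z \<alpha>) - d \<alpha>)) \<longlongrightarrow> 0) (at z within U)"
    by (rule Lim_transform_eventually[rotated]) (use assms(3) rt in \<open>simp add: free_disk_deriv_def\<close>)
qed

lemma free_disk_deriv_add:
  assumes f: "f \<in> U \<rightarrow> carrier (free_disk n r)" "free_disk_deriv n r U f z d"
    and g: "g \<in> U \<rightarrow> carrier (free_disk n r)" "free_disk_deriv n r U g z e" and z: "z \<in> U"
  shows "free_disk_deriv n r U (\<lambda>w \<alpha>. f w \<alpha> + g w \<alpha>) z (\<lambda>\<alpha>. d \<alpha> + e \<alpha>)"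
  unfolding free_disk_deriv_def
proof (intro conjI allI impI)
  have d: "d \<in> carrier (free_disk n r)" and e: "e \<in> carrier (free_disk n r)"
    using f g by (simp_all add: free_disk_deriv_def)
  then show "(\<lambda>\<alpha>. d \<alpha> + e \<alpha>) \<in> carrier (free_disk n r)" by (rule free_disk_add_closed)
  fix \<rho> \<tau> assume rt: "admissible_radii r \<rho> \<tau>"
  let ?N = "free_disk_norm n \<rho> \<tau>"
  let ?q = "\<lambda>f d w \<alpha>. inverse (w - z) * (f w \<alpha> - f z \<alpha>) - d \<alpha>"
  have U: "\<forall>\<^sub>F w in at z within U. w \<in> U" by (simp add: eventually_at_filter)
  show "((\<lambda>w. ?N (\<lambda>\<alpha>. inverse (w - z) * (f w \<alpha> + g w \<alpha> - (f z \<alpha> + g z \<alpha>)) - (d \<alpha> + e \<alpha>))) \<longlongrightarrow> 0) (at z within U)"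
  proof (rule tendsto_sandwich[OF always_eventually _ tendsto_const])
    show "\<forall>w. 0 \<le> ?N (\<lambda>\<alpha>. inverse (w - z) * (f w \<alpha> + g w \<alpha> - (f z \<alpha> + g z \<alpha>)) - (d \<alpha> + e \<alpha>))"
      using free_disk_norm_nonneg[OF rt] by blast
    show "\<forall>\<^sub>F w in at z within U. ?N (\<lambda>\<alpha>. inverse (w - z) * (f w \<alpha> + g w \<alpha> - (f z \<alpha> + g z \<alpha>)) - (d \<alpha> + e \<alpha>))
        \<le> ?N (?q f d w) + ?N (?q g e w)"
      using U
    proof eventually_elim
      case (elim w)
      have "?q f d w \<in> carrier (free_disk n r)" "?q g e w \<in> carrier (free_disk n r)"
        using elim z f(1) g(1) d e
        by (auto intro!: free_disk_diff_closed free_disk_smult_closed)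
      from free_disk_norm_add[OF this rt] show ?case by (simp add: algebra_simps)
    qed
    show "((\<lambda>w. ?N (?q f d w) + ?N (?q g e w)) \<longlongrightarrow> 0) (at z within U)"
      using f(2) g(2) rt by (intro tendsto_add_zero) (simp_all add: free_disk_deriv_def)
  qed
qed

text \<open>With q_f, q_g the errors of the difference quotients, the error for the product is q_f
  g(w) + d (g(w) - g(z)) + f(z) q_g, keeping the order of the factors. Submultiplicativity of the
  seminorms bounds each term by something that tends to 0.\<close>

lemma free_disk_deriv_mult:
  assumes f: "f \<in> U \<rightarrow> carrier (free_disk n r)" "free_disk_deriv n r U f z d"
    and g: "g \<in> U \<rightarrow> carrier (free_disk n r)" "free_disk_deriv n r U g z e" and z: "z \<in> U"
  shows "free_disk_deriv n r U (\<lambda>w. word_conv (f w) (g w)) z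
    (\<lambda>\<alpha>. word_conv d (g z) \<alpha> + word_conv (f z) e \<alpha>)"
  unfolding free_disk_deriv_def
proof (intro conjI allI impI)
  have d: "d \<in> carrier (free_disk n r)" and e: "e \<in> carrier (free_disk n r)"
    using f g by (simp_all add: free_disk_deriv_def)
  have fz: "f z \<in> carrier (free_disk n r)" and gz: "g z \<in> carrier (free_disk n r)"
    using f(1) g(1) z by auto
  show "(\<lambda>\<alpha>. word_conv d (g z) \<alpha> + word_conv (f z) e \<alpha>) \<in> carrier (free_disk n r)"
    by (intro free_disk_add_closed free_disk_mult_closed d e fz gz)
  fix \<rho> \<tau> assume rt: "admissible_radii r \<rho> \<tau>"
  let ?N = "free_disk_norm n \<rho> \<tau>"
  let ?q = "\<lambda>f d w \<alpha>. inverse (w - z) * (f w \<alpha> - f z \<alpha>) - d \<alpha>"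
  \<comment> \<open>This majorizes the norm of g(w) - g(z) = (w - z) (q_g + e), and so proves
    continuity of \<open>g\<close> at \<open>z\<close> on the way.\<close>
  let ?\<delta> = "\<lambda>w. cmod (w - z) * (?N (?q g e w) + ?N e)"
  let ?Q = "\<lambda>w \<alpha>. inverse (w - z) * (word_conv (f w) (g w) \<alpha> - word_conv (f z) (g z) \<alpha>) -
    (word_conv d (g z) \<alpha> + word_conv (f z) e \<alpha>)"
  have U: "\<forall>\<^sub>F w in at z within U. w \<in> U" by (simp add: eventually_at_filter)
  have lim: "((\<lambda>w. ?N (?q f d w)) \<longlongrightarrow> 0) (at z within U)" "((\<lambda>w. ?N (?q g e w)) \<longlongrightarrow> 0) (at z within U)"
    using f(2) g(2) rt by (simp_all add: free_disk_deriv_def)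
  have "((\<lambda>w. cmod (w - z)) \<longlongrightarrow> 0) (at z within U)"
    by (rule tendsto_norm_zero) (intro LIM_zero tendsto_ident_at)
  then have \<delta>: "(?\<delta> \<longlongrightarrow> 0) (at z within U)"
    using tendsto_mult[OF _ tendsto_add[OF lim(2) tendsto_const[of "?N e"]]] by fastforce
  show "((\<lambda>w. ?N (?Q w)) \<longlongrightarrow> 0) (at z within U)"
  proof (rule tendsto_sandwich[OF always_eventually _ tendsto_const])
    show "\<forall>w. 0 \<le> ?N (?Q w)" using free_disk_norm_nonneg[OF rt] by blast
    show "\<forall>\<^sub>F w in at z within U. ?N (?Q w) \<le>
        ?N (?q f d w) * (?\<delta> w + ?N (g z)) + ?N d * ?\<delta> w + ?N (f z) * ?N (?q g e w)"
      using U
    proof eventually_elim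
      case (elim w)
      have fw: "f w \<in> carrier (free_disk n r)" and gw: "g w \<in> carrier (free_disk n r)"
        using f(1) g(1) elim by auto
      have qf: "?q f d w \<in> carrier (free_disk n r)" and qg: "?q g e w \<in> carrier (free_disk n r)"
        by (intro free_disk_diff_closed free_disk_smult_closed fw fz gw gz d e)+
      have dg: "(\<lambda>\<alpha>. g w \<alpha> - g z \<alpha>) \<in> carrier (free_disk n r)"
        by (intro free_disk_diff_closed gw gz)
      \<comment> \<open>Only membership of \<open>w\<close> in \<open>U\<close> is at hand, so
        \<open>w = z\<close> is included; both sides vanish there.\<close>
      have "(\<lambda>\<alpha>. g w \<alpha> - g z \<alpha>) = (\<lambda>\<alpha>. (w - z) * (?q g e w \<alpha> + e \<alpha>))"
        by (cases "w = z") (simp_all flip: mult.assoc)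
      then have "?N (\<lambda>\<alpha>. g w \<alpha> - g z \<alpha>) = cmod (w - z) * ?N (\<lambda>\<alpha>. ?q g e w \<alpha> + e \<alpha>)"
        by (simp only: free_disk_norm_smult)
      also have "\<dots> \<le> ?\<delta> w"
        by (rule mult_left_mono[OF free_disk_norm_add[OF qg e rt]]) simp
      finally have Ndg: "?N (\<lambda>\<alpha>. g w \<alpha> - g z \<alpha>) \<le> ?\<delta> w" .
      have "?N (g w) \<le> ?N (\<lambda>\<alpha>. g w \<alpha> - g z \<alpha>) + ?N (g z)"
        using free_disk_norm_add[OF dg gz rt] by simp
      with Ndg have Ng: "?N (g w) \<le> ?\<delta> w + ?N (g z)" by simp
      have "?Q w = (\<lambda>\<alpha>. (word_conv (?q f d w) (g w) \<alpha> + word_conv d (\<lambda>\<alpha>. g w \<alpha> - g z \<alpha>) \<alpha>) +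
          word_conv (f z) (?q g e w) \<alpha>)"
        by (simp add: fun_eq_iff word_conv_def split_def sum_distrib_left algebra_simps
            flip: sum.distrib sum_subtractf)
      then have "?N (?Q w) \<le> ?N (word_conv (?q f d w) (g w)) + ?N (word_conv d (\<lambda>\<alpha>. g w \<alpha> - g z \<alpha>)) +
          ?N (word_conv (f z) (?q g e w))"
        using free_disk_norm_add[OF free_disk_add_closed[OF free_disk_mult_closed[OF qf gw]
              free_disk_mult_closed[OF d dg]] free_disk_mult_closed[OF fz qg] rt]
          free_disk_norm_add[OF free_disk_mult_closed[OF qf gw] free_disk_mult_closed[OF d dg] rt]
        by simp
      also have "\<dots> \<le> ?N (?q f d w) * ?N (g w) + ?N d * ?N (\<lambda>\<alpha>. g w \<alpha> - g z \<alpha>) + ?N (f z) * ?N (?q g e w)"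
        by (rule add_mono[OF add_mono[OF free_disk_norm_mult[OF qf gw rt] free_disk_norm_mult[OF d dg rt]]
              free_disk_norm_mult[OF fz qg rt]])
      also have "\<dots> \<le> ?N (?q f d w) * (?\<delta> w + ?N (g z)) + ?N d * ?\<delta> w + ?N (f z) * ?N (?q g e w)"
        by (intro add_mono mult_left_mono Ng Ndg free_disk_norm_nonneg[OF rt] order_refl)
      finally show ?case .
    qed
    show "((\<lambda>w. ?N (?q f d w) * (?\<delta> w + ?N (g z)) + ?N d * ?\<delta> w + ?N (f z) * ?N (?q g e w)) \<longlongrightarrow> 0)
        (at z within U)"
      using tendsto_add[OF tendsto_add[OF tendsto_mult[OF lim(1) tendsto_add[OF \<delta> tendsto_const]]
            tendsto_mult[OF tendsto_const \<delta>]] tendsto_mult[OF tendsto_const lim(2)]] by simp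
  qed
qed

lemma free_disk_deriv_scalar:
  assumes g: "g holomorphic_on U" and z: "z \<in> U" and c: "c \<in> carrier (free_disk n r)"
  shows "\<exists>d. free_disk_deriv n r U (\<lambda>w \<alpha>. g w * c \<alpha>) z d"
proof -
  obtain g' where g': "(g has_field_derivative g') (at z within U)"
    using g z by (auto simp: holomorphic_on_def field_differentiable_def)
  then have "((\<lambda>w. (g w - g z) / (w - z)) \<longlongrightarrow> g') (at z within U)"
    by (simp add: has_field_derivative_iff)
  then have "((\<lambda>w. (g w - g z) / (w - z) - g') \<longlongrightarrow> 0) (at z within U)" by (rule LIM_zero)
  then have lim: "((\<lambda>w. cmod ((g w - g z) / (w - z) - g')) \<longlongrightarrow> 0) (at z within U)" by (rule tendsto_norm_zero)
  have "free_disk_deriv n r U (\<lambda>w \<alpha>. g w * c \<alpha>) z (\<lambda>\<alpha>. g' * c \<alpha>)"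
    unfolding free_disk_deriv_def
  proof (intro conjI allI impI free_disk_smult_closed c)
    fix \<rho> \<tau>
    have "(\<lambda>\<alpha>. inverse (w - z) * (g w * c \<alpha> - g z * c \<alpha>) - g' * c \<alpha>) =
        (\<lambda>\<alpha>. ((g w - g z) / (w - z) - g') * c \<alpha>)" for w
      by (simp add: fun_eq_iff divide_inverse algebra_simps)
    then have "free_disk_norm n \<rho> \<tau> (\<lambda>\<alpha>. inverse (w - z) * (g w * c \<alpha> - g z * c \<alpha>) - g' * c \<alpha>) =
        cmod ((g w - g z) / (w - z) - g') * free_disk_norm n \<rho> \<tau> c" for w
      by (simp only: free_disk_norm_smult)
    then show "((\<lambda>w. free_disk_norm n \<rho> \<tau> (\<lambda>\<alpha>. inverse (w - z) * (g w * c \<alpha> - g z * c \<alpha>) - g' * c \<alpha>))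
        \<longlongrightarrow> 0) (at z within U)"
      using tendsto_mult[OF lim tendsto_const[of "free_disk_norm n \<rho> \<tau> c"]] by simp
  qed
  then show ?thesis by blast
qed

section \<open>Ring structure and central scalars of the function algebra\<close>

lemma hol_free_disk_simps:
  "carrier (hol_free_disk n r) = {f \<in> punctured_plane \<rightarrow>\<^sub>E carrier (free_disk n r).
    vector_holomorphic_on (free_disk n r) f punctured_plane}"
  "monoid.mult (hol_free_disk n r) = (\<lambda>f g. \<lambda>z\<in>punctured_plane. word_conv (f z) (g z))"
  "one (hol_free_disk n r) = (\<lambda>z\<in>punctured_plane. word_basis [])"
  "zero (hol_free_disk n r) = (\<lambda>z\<in>punctured_plane. \<lambda>\<alpha>. 0)"
  "add (hol_free_disk n r) = (\<lambda>f g. \<lambda>z\<in>punctured_plane. \<lambda>\<alpha>. f z \<alpha> + g z \<alpha>)"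
  "smult (hol_free_disk n r) = (\<lambda>c f. \<lambda>z\<in>punctured_plane. \<lambda>\<alpha>. c * f z \<alpha>)"
  "act (hol_free_disk n r) = (\<lambda>g f. \<lambda>z\<in>punctured_plane. \<lambda>\<alpha>. g z * f z \<alpha>)"
  "top_of (hol_free_disk n r) =
    compact_open punctured_plane (top_of (free_disk n r)) (carrier (hol_free_disk n r))"
  by (simp_all add: hol_free_disk_def hol_valued_def free_disk_one
      free_disk_simps(1,3,4,5))

lemma hol_free_disk_carrier_iff:
  "f \<in> carrier (hol_free_disk n r) \<longleftrightarrow> f \<in> punctured_plane \<rightarrow>\<^sub>E carrier (free_disk n r) \<and>
    (\<forall>z\<in>punctured_plane. \<exists>d. free_disk_deriv n r punctured_plane f z d)"
  using vector_holomorphic_on_free_disk[of f punctured_plane n r] by (auto simp: hol_free_disk_simps(1))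

lemma hol_free_diskI:
  assumes "\<And>z. z \<in> punctured_plane \<Longrightarrow> f z \<in> carrier (free_disk n r)"
    and "\<And>z. z \<in> punctured_plane \<Longrightarrow> \<exists>d. free_disk_deriv n r punctured_plane f z d"
  shows "restrict f punctured_plane \<in> carrier (hol_free_disk n r)"
  unfolding hol_free_disk_carrier_iff
proof (intro conjI ballI)
  show "restrict f punctured_plane \<in> punctured_plane \<rightarrow>\<^sub>E carrier (free_disk n r)" using assms(1) by auto
  fix z assume z: "z \<in> punctured_plane"
  then obtain d where "free_disk_deriv n r punctured_plane f z d" using assms(2) by blast
  then have "free_disk_deriv n r punctured_plane (restrict f punctured_plane) z d"
    by (rule free_disk_deriv_cong[rotated 2]) (simp_all add: z)
  then show "\<exists>d. free_disk_deriv n r punctured_plane (restrict f punctured_plane) z d"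
    by (rule exI[of _ d])
qed

lemma hol_free_diskD:
  assumes "f \<in> carrier (hol_free_disk n r)"
  shows "f \<in> punctured_plane \<rightarrow> carrier (free_disk n r)" "restrict f punctured_plane = f"
    "z \<in> punctured_plane \<Longrightarrow> f z \<in> carrier (free_disk n r)"
    "z \<in> punctured_plane \<Longrightarrow> \<exists>d. free_disk_deriv n r punctured_plane f z d"
  using assms by (auto simp: hol_free_disk_carrier_iff intro: PiE_restrict)

lemma hol_free_disk_const:
  assumes "c \<in> carrier (free_disk n r)"
  shows "(\<lambda>z\<in>punctured_plane. c) \<in> carrier (hol_free_disk n r)"
  by (rule hol_free_diskI) (use assms free_disk_deriv_const[of punctured_plane "\<lambda>_. c" c] in blast)+

lemma hol_free_disk_mult_closed:
  assumes f: "f \<in> carrier (hol_free_disk n r)" and g: "g \<in> carrier (hol_free_disk n r)"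
  shows "f \<otimes>\<^bsub>hol_free_disk n r\<^esub> g \<in> carrier (hol_free_disk n r)"
  unfolding hol_free_disk_simps(2)
proof (rule hol_free_diskI)
  fix z assume z: "z \<in> punctured_plane"
  show "word_conv (f z) (g z) \<in> carrier (free_disk n r)"
    by (intro free_disk_mult_closed hol_free_diskD(3)[OF f z] hol_free_diskD(3)[OF g z])
  show "\<exists>d. free_disk_deriv n r punctured_plane (\<lambda>z. word_conv (f z) (g z)) z d"
    using hol_free_diskD(4)[OF f z] hol_free_diskD(4)[OF g z]
      free_disk_deriv_mult[OF hol_free_diskD(1)[OF f] _ hol_free_diskD(1)[OF g] _ z] by blast
qed

lemma hol_free_disk_add_closed:
  assumes f: "f \<in> carrier (hol_free_disk n r)" and g: "g \<in> carrier (hol_free_disk n r)"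
  shows "f \<oplus>\<^bsub>hol_free_disk n r\<^esub> g \<in> carrier (hol_free_disk n r)"
  unfolding hol_free_disk_simps(5)
proof (rule hol_free_diskI)
  fix z assume z: "z \<in> punctured_plane"
  show "(\<lambda>\<alpha>. f z \<alpha> + g z \<alpha>) \<in> carrier (free_disk n r)"
    by (intro free_disk_add_closed hol_free_diskD(3)[OF f z] hol_free_diskD(3)[OF g z])
  show "\<exists>d. free_disk_deriv n r punctured_plane (\<lambda>z \<alpha>. f z \<alpha> + g z \<alpha>) z d"
    using hol_free_diskD(4)[OF f z] hol_free_diskD(4)[OF g z]
      free_disk_deriv_add[OF hol_free_diskD(1)[OF f] _ hol_free_diskD(1)[OF g] _ z] by blast
qed

lemma word_basis_Nil_closed: "word_basis [] \<in> carrier (free_disk n r)"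
  by (rule word_basis_closed) (simp add: words_def)

lemma word_conv_Nil: "word_conv (word_basis []) a = a" "word_conv a (word_basis []) = a"
  by (simp_all add: word_basis_def word_conv_one_left word_conv_one_right)

text \<open>This embeds the scalar functions as central elements. Both the action of holomorphic
  functions and multiplication by complex numbers become ring multiplication, so their behaviour
  under cosets and characters follows from that of products.\<close>

definition hol_scalar :: "(complex \<Rightarrow> complex) \<Rightarrow> complex \<Rightarrow> nat list \<Rightarrow> complex" where
  "hol_scalar g = (\<lambda>z\<in>punctured_plane. \<lambda>\<alpha>. g z * word_basis [] \<alpha>)"

lemma hol_scalar_closed:
  assumes "g holomorphic_on punctured_plane"
  shows "hol_scalar g \<in> carrier (hol_free_disk n r)"
  unfolding hol_scalar_def
  by (rule hol_free_diskI) (rule free_disk_smult_closed free_disk_deriv_scalar word_basis_Nil_closed assms | assumption)+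

lemma hol_scalar_mult:
  "hol_scalar g \<otimes>\<^bsub>hol_free_disk n r\<^esub> f = (\<lambda>z\<in>punctured_plane. \<lambda>\<alpha>. g z * f z \<alpha>)"
  "f \<otimes>\<^bsub>hol_free_disk n r\<^esub> hol_scalar g = (\<lambda>z\<in>punctured_plane. \<lambda>\<alpha>. g z * f z \<alpha>)"
  by (simp_all add: hol_free_disk_simps(2) hol_scalar_def word_conv_smult_left word_conv_smult_right
      word_conv_Nil cong: restrict_cong)

lemma act_hol_free_disk: "act (hol_free_disk n r) g f = hol_scalar g \<otimes>\<^bsub>hol_free_disk n r\<^esub> f"
  by (simp add: hol_scalar_mult hol_free_disk_simps(7))

lemma smult_hol_free_disk: "c \<odot>\<^bsub>hol_free_disk n r\<^esub> f = hol_scalar (\<lambda>_. c) \<otimes>\<^bsub>hol_free_disk n r\<^esub> f"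
  by (simp add: hol_scalar_mult hol_free_disk_simps(6))

lemma ring_hol_free_disk: "ring (hol_free_disk n r)"
proof (rule ringI)
  show "abelian_group (hol_free_disk n r)"
  proof (rule abelian_groupI)
    fix f assume f: "f \<in> carrier (hol_free_disk n r)"
    show "\<exists>g\<in>carrier (hol_free_disk n r). g \<oplus>\<^bsub>hol_free_disk n r\<^esub> f = \<zero>\<^bsub>hol_free_disk n r\<^esub>"
    proof (rule bexI[OF _ hol_free_disk_mult_closed[OF hol_scalar_closed f]])
      show "(\<lambda>_. -1) holomorphic_on punctured_plane" by (rule holomorphic_on_const)
      show "hol_scalar (\<lambda>_. -1) \<otimes>\<^bsub>hol_free_disk n r\<^esub> f \<oplus>\<^bsub>hol_free_disk n r\<^esub> f = \<zero>\<^bsub>hol_free_disk n r\<^esub>"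
        unfolding hol_scalar_mult by (simp add: hol_free_disk_simps(4,5) cong: restrict_cong)
    qed
    show "\<zero>\<^bsub>hol_free_disk n r\<^esub> \<oplus>\<^bsub>hol_free_disk n r\<^esub> f = f"
      using hol_free_diskD(2)[OF f] by (simp add: hol_free_disk_simps(4,5) cong: restrict_cong)
  next
    show "\<zero>\<^bsub>hol_free_disk n r\<^esub> \<in> carrier (hol_free_disk n r)"
      unfolding hol_free_disk_simps(4) by (intro hol_free_disk_const free_disk_zero_closed)
  qed (simp_all add: hol_free_disk_add_closed, simp_all add: hol_free_disk_simps(5) add_ac cong: restrict_cong)
  show "Group.monoid (hol_free_disk n r)"
  proof (rule monoidI)
    show "\<one>\<^bsub>hol_free_disk n r\<^esub> \<in> carrier (hol_free_disk n r)"
      unfolding hol_free_disk_simps(3) by (intro hol_free_disk_const word_basis_Nil_closed)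
    fix f assume f: "f \<in> carrier (hol_free_disk n r)"
    show "\<one>\<^bsub>hol_free_disk n r\<^esub> \<otimes>\<^bsub>hol_free_disk n r\<^esub> f = f" "f \<otimes>\<^bsub>hol_free_disk n r\<^esub> \<one>\<^bsub>hol_free_disk n r\<^esub> = f"
      using hol_free_diskD(2)[OF f]
      by (simp_all add: hol_free_disk_simps(2,3) word_conv_Nil cong: restrict_cong)
  qed (simp_all add: hol_free_disk_mult_closed,
      simp add: hol_free_disk_simps(2) word_conv_assoc cong: restrict_cong)
qed (simp_all add: hol_free_disk_simps(2,5) word_conv_add_left word_conv_add_right cong: restrict_cong)

section \<open>The character of the deformed algebra\<close>

definition diag_char :: "nat \<Rightarrow> real \<Rightarrow> (nat list \<Rightarrow> complex) \<Rightarrow> complex" where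
  "diag_char n \<rho> a = (\<Sum>\<^sub>\<infinity>\<alpha>\<in>words n. a \<alpha> * of_real (\<rho> ^ length \<alpha>))"

text \<open>For \<tau> = 1 the weight ignores the blocks, and the norm is exactly the sum of the
  absolute values of the terms of the character.\<close>

lemma diag_char_abs_summable:
  assumes "a \<in> carrier (free_disk n r)" "0 < \<rho>" "ereal \<rho> < r"
  shows "(\<lambda>\<alpha>. norm (a \<alpha> * of_real (\<rho> ^ length \<alpha>))) summable_on words n"
    "(\<Sum>\<^sub>\<infinity>\<alpha>\<in>words n. norm (a \<alpha> * of_real (\<rho> ^ length \<alpha>))) = free_disk_norm n \<rho> 1 a"
    "(\<lambda>\<alpha>. a \<alpha> * of_real (\<rho> ^ length \<alpha>)) summable_on words n"
proof -
  have eq: "norm (a \<alpha> * of_real (\<rho> ^ length \<alpha>)) = cmod (a \<alpha>) * word_weight \<rho> 1 \<alpha>" for \<alpha>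
    using assms(2) by (simp add: word_weight_def norm_mult norm_power)
  show sum: "(\<lambda>\<alpha>. norm (a \<alpha> * of_real (\<rho> ^ length \<alpha>))) summable_on words n"
    using assms unfolding eq by (simp add: free_disk_carrier admissible_radii_def)
  show "(\<Sum>\<^sub>\<infinity>\<alpha>\<in>words n. norm (a \<alpha> * of_real (\<rho> ^ length \<alpha>))) = free_disk_norm n \<rho> 1 a"
    unfolding eq free_disk_norm_eq ..
  show "(\<lambda>\<alpha>. a \<alpha> * of_real (\<rho> ^ length \<alpha>)) summable_on words n"
    using sum by (rule abs_summable_summable)
qed

lemma diag_char_bound:
  assumes "a \<in> carrier (free_disk n r)" "0 < \<rho>" "ereal \<rho> < r"
  shows "cmod (diag_char n \<rho> a) \<le> free_disk_norm n \<rho> 1 a"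
  unfolding diag_char_def diag_char_abs_summable(2)[OF assms, symmetric]
  using diag_char_abs_summable(1)[OF assms] by (rule norm_infsum_bound)

lemma diag_char_add:
  assumes "a \<in> carrier (free_disk n r)" "b \<in> carrier (free_disk n r)" "0 < \<rho>" "ereal \<rho> < r"
  shows "diag_char n \<rho> (\<lambda>\<alpha>. a \<alpha> + b \<alpha>) = diag_char n \<rho> a + diag_char n \<rho> b"
  unfolding diag_char_def distrib_right
  by (rule infsum_add) (rule diag_char_abs_summable(3)[OF assms(1,3,4)] diag_char_abs_summable(3)[OF assms(2-4)])+

lemma diag_char_smult: "diag_char n \<rho> (\<lambda>\<alpha>. c * a \<alpha>) = c * diag_char n \<rho> a"
  unfolding diag_char_def mult.assoc by (rule infsum_cmult_right')

lemma diag_char_word_basis: "w \<in> words n \<Longrightarrow> diag_char n \<rho> (word_basis w) = of_real (\<rho> ^ length w)"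
  unfolding diag_char_def
  by (subst infsum_word_basis[where f = "\<lambda>x \<alpha>. x * of_real (\<rho> ^ length \<alpha>)"]) simp_all

text \<open>A Cauchy product over words: the powers of \<rho> multiply under concatenation, and
  absolute summability over pairs of words permits grouping the pairs by their
  concatenation.\<close>

lemma diag_char_mult:
  assumes a: "a \<in> carrier (free_disk n r)" and b: "b \<in> carrier (free_disk n r)"
    and \<rho>: "0 < \<rho>" "ereal \<rho> < r"
  shows "diag_char n \<rho> (word_conv a b) = diag_char n \<rho> a * diag_char n \<rho> b"
proof -
  let ?W = "words n"
  define a' where "a' \<alpha> = a \<alpha> * of_real (\<rho> ^ length \<alpha>)" for \<alpha>
  define b' where "b' \<alpha> = b \<alpha> * of_real (\<rho> ^ length \<alpha>)" for \<alpha>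
  have sa: "(\<lambda>\<alpha>. norm (a' \<alpha>)) summable_on ?W" and sb: "(\<lambda>\<alpha>. norm (b' \<alpha>)) summable_on ?W"
    unfolding a'_def b'_def by (rule diag_char_abs_summable(1)[OF a \<rho>] diag_char_abs_summable(1)[OF b \<rho>])+
  have "(\<lambda>p. norm (a' (fst p) * b' (snd p))) summable_on ?W \<times> ?W"
  proof (rule Infinite_Sum.abs_summable_on_Sigma_iff[THEN iffD2], intro conjI ballI)
    show "(\<lambda>y. norm (a' (fst (x, y)) * b' (snd (x, y)))) summable_on ?W" for x
      using summable_on_cmult_right[OF sb, of "norm (a' x)"] by (simp add: norm_mult)
    have "(\<lambda>x. norm (a' x) * norm (\<Sum>\<^sub>\<infinity>y\<in>?W. norm (b' y))) summable_on ?W"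
      by (rule summable_on_cmult_left[OF sa])
    then show "(\<lambda>x. norm (\<Sum>\<^sub>\<infinity>y\<in>?W. norm (a' (fst (x, y)) * b' (snd (x, y))))) summable_on ?W"
      by (simp add: norm_mult infsum_cmult_right' abs_mult)
  qed
  then have prod: "(\<lambda>p. a' (fst p) * b' (snd p)) summable_on ?W \<times> ?W" by (rule abs_summable_summable)
  \<comment> \<open>A word together with one of its factorizations is the same datum as a pair of
    words.\<close>
  have bij: "bij_betw snd (Sigma ?W splits) (?W \<times> ?W)"
    by (rule bij_betwI[where g = "\<lambda>(\<alpha>, \<beta>). (\<alpha> @ \<beta>, (\<alpha>, \<beta>))"]) (auto simp: splits_def words_def)
  have sig: "(\<lambda>q. a' (fst (snd q)) * b' (snd (snd q))) summable_on Sigma ?W splits"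
    using prod summable_on_reindex_bij_betw[OF bij, of "\<lambda>p. a' (fst p) * b' (snd p)"] by simp
  have "diag_char n \<rho> (word_conv a b) =
      (\<Sum>\<^sub>\<infinity>\<gamma>\<in>?W. \<Sum>\<^sub>\<infinity>p\<in>splits \<gamma>. a' (fst (snd (\<gamma>, p))) * b' (snd (snd (\<gamma>, p))))"
    unfolding diag_char_def
  proof (rule infsum_cong)
    fix \<gamma>
    have "word_conv a b \<gamma> * of_real (\<rho> ^ length \<gamma>) = (\<Sum>p\<in>splits \<gamma>. a' (fst p) * b' (snd p))"
      unfolding word_conv_def sum_distrib_right
      by (intro sum.cong) (auto simp: splits_def a'_def b'_def power_add)
    then show "word_conv a b \<gamma> * of_real (\<rho> ^ length \<gamma>) =
        (\<Sum>\<^sub>\<infinity>p\<in>splits \<gamma>. a' (fst (snd (\<gamma>, p))) * b' (snd (snd (\<gamma>, p))))"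
      by (simp add: finite_splits)
  qed
  also have "\<dots> = (\<Sum>\<^sub>\<infinity>q\<in>Sigma ?W splits. a' (fst (snd q)) * b' (snd (snd q)))"
    by (rule infsum_Sigma_banach[OF sig])
  also have "\<dots> = (\<Sum>\<^sub>\<infinity>p\<in>?W \<times> ?W. a' (fst p) * b' (snd p))"
    by (rule infsum_reindex_bij_betw[OF bij])
  also have "\<dots> = (\<Sum>\<^sub>\<infinity>\<alpha>\<in>?W. \<Sum>\<^sub>\<infinity>\<beta>\<in>?W. a' (fst (\<alpha>, \<beta>)) * b' (snd (\<alpha>, \<beta>)))"
    by (rule infsum_Sigma_banach[OF prod, symmetric])
  also have "\<dots> = (\<Sum>\<^sub>\<infinity>\<alpha>\<in>?W. a' \<alpha>) * (\<Sum>\<^sub>\<infinity>\<beta>\<in>?W. b' \<beta>)"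
    by (simp add: infsum_cmult_right' infsum_cmult_left')
  finally show ?thesis by (simp add: diag_char_def a'_def b'_def)
qed

lemma continuous_diag_char:
  assumes \<rho>: "0 < \<rho>" "ereal \<rho> < r"
  shows "continuous_map (top_of (free_disk n r)) euclidean (diag_char n \<rho>)"
  unfolding continuous_map_atin
proof
  let ?T = "top_of (free_disk n r)"
  fix a assume a: "a \<in> topspace ?T"
  then have ac: "a \<in> carrier (free_disk n r)" by simp
  have rt: "admissible_radii r \<rho> 1" using \<rho> by (simp add: admissible_radii_def)
  note id = limitin_atin_self_id[OF a, unfolded limitin_free_disk]
  have ev: "\<forall>\<^sub>F b in atin ?T a. b \<in> carrier (free_disk n r)" using id by blast
  have lim: "((\<lambda>b. free_disk_norm n \<rho> 1 (\<lambda>\<alpha>. b \<alpha> - a \<alpha>)) \<longlongrightarrow> 0) (atin ?T a)" using id rt by blast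
  have "((\<lambda>b. diag_char n \<rho> b - diag_char n \<rho> a) \<longlongrightarrow> 0) (atin ?T a)"
  proof (rule Lim_null_comparison[OF _ lim])
    show "\<forall>\<^sub>F b in atin ?T a. norm (diag_char n \<rho> b - diag_char n \<rho> a) \<le> free_disk_norm n \<rho> 1 (\<lambda>\<alpha>. b \<alpha> - a \<alpha>)"
      using ev
    proof eventually_elim
      case (elim b)
      have d: "(\<lambda>\<alpha>. b \<alpha> - a \<alpha>) \<in> carrier (free_disk n r)" using elim ac by (rule free_disk_diff_closed)
      have "diag_char n \<rho> b = diag_char n \<rho> (\<lambda>\<alpha>. b \<alpha> - a \<alpha>) + diag_char n \<rho> a"
        using diag_char_add[OF d ac \<rho>] by simp
      then show ?case using diag_char_bound[OF d \<rho>] by simp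
    qed
  qed
  then show "limitin euclidean (diag_char n \<rho>) (diag_char n \<rho> a) (atin ?T a)"
    by (simp add: LIM_zero_iff)
qed

section \<open>Words and commutation relations in the function algebra\<close>

lemma one_in_punctured_plane [simp]: "1 \<in> punctured_plane"
  by (simp add: punctured_plane_def)

definition hol_word :: "nat list \<Rightarrow> complex \<Rightarrow> nat list \<Rightarrow> complex" where
  "hol_word w = (\<lambda>z\<in>punctured_plane. word_basis w)"

lemma free_gen_eq: "free_gen i = hol_word [i]"
  by (simp add: free_gen_def hol_word_def word_basis_def)

lemma hol_word_closed: "w \<in> words n \<Longrightarrow> hol_word w \<in> carrier (hol_free_disk n r)"
  unfolding hol_word_def by (intro hol_free_disk_const word_basis_closed)

lemma hol_word_append: "hol_word v \<otimes>\<^bsub>hol_free_disk n r\<^esub> hol_word w = hol_word (v @ w)"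
  by (simp add: hol_free_disk_simps(2) hol_word_def word_conv_basis cong: restrict_cong)

lemma coordinate_holomorphic: "(\<lambda>z. z ^ k) holomorphic_on punctured_plane"
  by (intro holomorphic_intros)

lemma hol_scalar_coordinate: "hol_scalar coordinate = hol_scalar (\<lambda>z. z)"
  by (simp add: hol_scalar_def coordinate_def cong: restrict_cong)

lemma hol_free_disk_diff_apply:
  assumes "f \<in> carrier (hol_free_disk n r)" "g \<in> carrier (hol_free_disk n r)"
  shows "f \<ominus>\<^bsub>hol_free_disk n r\<^esub> g = f \<oplus>\<^bsub>hol_free_disk n r\<^esub> hol_scalar (\<lambda>_. -1) \<otimes>\<^bsub>hol_free_disk n r\<^esub> g"
proof -
  interpret ring "hol_free_disk n r" by (rule ring_hol_free_disk)
  have "hol_scalar (\<lambda>_. -1) \<otimes>\<^bsub>hol_free_disk n r\<^esub> g \<oplus>\<^bsub>hol_free_disk n r\<^esub> g = \<zero>\<^bsub>hol_free_disk n r\<^esub>"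
    unfolding hol_scalar_mult by (simp add: hol_free_disk_simps(4,5) cong: restrict_cong)
  then have "\<ominus>\<^bsub>hol_free_disk n r\<^esub> g = hol_scalar (\<lambda>_. -1) \<otimes>\<^bsub>hol_free_disk n r\<^esub> g"
    by (rule minus_equality) (intro assms hol_free_disk_mult_closed hol_scalar_closed holomorphic_on_const)+
  then show ?thesis by (simp add: a_minus_def)
qed

definition fibre_char :: "nat \<Rightarrow> real \<Rightarrow> (complex \<Rightarrow> nat list \<Rightarrow> complex) \<Rightarrow> complex" where
  "fibre_char n \<rho> f = diag_char n \<rho> (f 1)"

text \<open>A q-commutator of two generators whose parameter q is the coordinate; in the fibre at 1
  it is the ordinary commutator.\<close>

definition commutator :: "nat \<Rightarrow> ereal \<Rightarrow> nat \<Rightarrow> nat \<Rightarrow> complex \<Rightarrow> nat list \<Rightarrow> complex" where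
  "commutator n r i j = free_gen i \<otimes>\<^bsub>hol_free_disk n r\<^esub> free_gen j \<ominus>\<^bsub>hol_free_disk n r\<^esub>
        act (hol_free_disk n r) coordinate (free_gen j \<otimes>\<^bsub>hol_free_disk n r\<^esub> free_gen i)"

lemma commutator_eq:
  assumes "i \<in> {1..n}" "j \<in> {1..n}"
  shows "commutator n r i j = hol_word [i, j] \<ominus>\<^bsub>hol_free_disk n r\<^esub>
    (hol_scalar (\<lambda>z. z) \<otimes>\<^bsub>hol_free_disk n r\<^esub> hol_word [j, i])"
  by (simp add: commutator_def free_gen_eq hol_word_append act_hol_free_disk hol_scalar_coordinate)

lemma two_words: "i \<in> {1..n} \<Longrightarrow> j \<in> {1..n} \<Longrightarrow> [i, j] \<in> words n"
  by (simp add: words_def)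

lemma commutator_closed:
  assumes "i \<in> {1..n}" "j \<in> {1..n}"
  shows "commutator n r i j \<in> carrier (hol_free_disk n r)"
proof -
  interpret ring "hol_free_disk n r" by (rule ring_hol_free_disk)
  show ?thesis
    unfolding commutator_eq[OF assms]
    by (intro minus_closed m_closed hol_word_closed hol_scalar_closed two_words assms holomorphic_on_ident)
qed

section \<open>Exchange of powers, factorials against exponentials, and the annulus\<close>

lemma (in Group.monoid) central_pow:
  assumes Z: "Z \<in> carrier G" "\<And>x. x \<in> carrier G \<Longrightarrow> Z \<otimes> x = x \<otimes> Z" and x: "x \<in> carrier G"
  shows "Z [^] (m :: nat) \<otimes> x = x \<otimes> Z [^] m"
proof (induction m)
  case (Suc m)
  have "Z [^] Suc m \<otimes> x = Z [^] m \<otimes> (x \<otimes> Z)" using Z x by (simp add: m_assoc)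
  also have "\<dots> = x \<otimes> Z [^] Suc m" using Z(1) x Suc by (simp flip: m_assoc)
  finally show ?case .
qed (use x in simp)

text \<open>Each of the k m exchanges of one \<open>a\<close> with one \<open>b\<close> releases one
  central factor \<open>Z\<close>. The inner induction moves a single \<open>a\<close> through the
  power of \<open>b\<close>, the outer one treats the remaining copies.\<close>

lemma (in Group.monoid) pow_mult_pow_swap:
  assumes a: "a \<in> carrier G" and b: "b \<in> carrier G" and Z: "Z \<in> carrier G"
    and central: "\<And>x. x \<in> carrier G \<Longrightarrow> Z \<otimes> x = x \<otimes> Z" and ab: "a \<otimes> b = Z \<otimes> (b \<otimes> a)"
  shows "a [^] (k :: nat) \<otimes> b [^] (m :: nat) = Z [^] (k * m) \<otimes> (b [^] m \<otimes> a [^] k)"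
proof -
  have one: "a \<otimes> b [^] m = Z [^] m \<otimes> (b [^] m \<otimes> a)" for m :: nat
  proof (induction m)
    case (Suc m)
    have "a \<otimes> b [^] Suc m = (a \<otimes> b [^] m) \<otimes> b" using a b by (simp add: m_assoc)
    also have "\<dots> = Z [^] m \<otimes> (b [^] m \<otimes> (a \<otimes> b))" using a b Z by (simp add: Suc m_assoc)
    also have "b [^] m \<otimes> (a \<otimes> b) = (b [^] m \<otimes> Z) \<otimes> (b \<otimes> a)" using a b Z by (simp add: ab m_assoc)
    also have "b [^] m \<otimes> Z = Z \<otimes> b [^] m" using central[of "b [^] m"] b by simp
    finally show ?case using a b Z by (simp add: m_assoc)
  qed (use a in simp)
  show ?thesis
  proof (induction k)
    case (Suc k)
    have "a [^] Suc k \<otimes> b [^] m = a [^] k \<otimes> (a \<otimes> b [^] m)" using a b by (simp add: m_assoc)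
    also have "\<dots> = (a [^] k \<otimes> Z [^] m) \<otimes> (b [^] m \<otimes> a)" using a b Z by (simp add: one m_assoc)
    also have "a [^] k \<otimes> Z [^] m = Z [^] m \<otimes> a [^] k" using central_pow[OF Z central] a by simp
    also have "(Z [^] m \<otimes> a [^] k) \<otimes> (b [^] m \<otimes> a) = Z [^] m \<otimes> ((a [^] k \<otimes> b [^] m) \<otimes> a)"
      using a b Z by (simp add: m_assoc)
    also have "\<dots> = (Z [^] m \<otimes> Z [^] (k * m)) \<otimes> (b [^] m \<otimes> (a [^] k \<otimes> a))"
      using a b Z by (simp add: Suc m_assoc)
    also have "Z [^] m \<otimes> Z [^] (k * m) = Z [^] (Suc k * m)" using Z by (simp add: nat_pow_mult)
    finally show ?case by simp
  qed (use b in simp)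
qed

text \<open>Since k! is at most k^k, it is enough that k^2 is eventually below c 2^k, and then to
  take k-th powers.\<close>

lemma fact_square_less_exponential:
  assumes "0 < (c :: real)"
  shows "\<forall>\<^sub>F k in sequentially. (fact k)\<^sup>2 < c ^ k * 2 ^ (k * k)"
proof -
  have "(\<lambda>k. real k ^ 2 / 2 ^ k) \<longlonglongrightarrow> 0" by real_asymp
  then have "\<forall>\<^sub>F k in sequentially. real k ^ 2 / 2 ^ k < c" using assms by (rule order_tendstoD(2))
  \<comment> \<open>Positivity of k keeps the inequality strict when it is raised to the k-th
    power.\<close>
  then show ?thesis using eventually_gt_at_top[of 0]
  proof eventually_elim
    case (elim k)
    have "(fact k :: real) \<le> real k ^ k" using fact_le_power[of k] by simp
    then have "(fact k :: real)\<^sup>2 \<le> (real k ^ k)\<^sup>2" by (rule power_mono) simp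
    also have "\<dots> = (real k ^ 2) ^ k" by (simp add: power_mult[symmetric] mult.commute)
    also have "\<dots> < (c * 2 ^ k) ^ k"
      using elim by (intro power_strict_mono) (simp_all add: field_simps)
    also have "\<dots> = c ^ k * 2 ^ (k * k)" by (simp add: power_mult_distrib power_mult)
    finally show ?case .
  qed
qed

text \<open>The radii are reciprocal, so that the factor z^m yields the same gain 2^m on either
  circle. The point 1 lies between them.\<close>

definition annulus :: "complex set" where
  "annulus = cball 0 2 - ball 0 (1 / 2)"

lemma annulus_props: "compact annulus" "1 \<in> annulus" "annulus \<noteq> {}" "annulus \<subseteq> punctured_plane"
proof -
  show one: "1 \<in> annulus" by (simp add: annulus_def)
  then show "annulus \<noteq> {}" by blast
  show "compact annulus" unfolding annulus_def by (intro compact_diff compact_cball open_ball)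
  show "annulus \<subseteq> punctured_plane" by (auto simp: annulus_def punctured_plane_def)
qed

lemma frontier_annulus:
  assumes "z \<in> frontier annulus" shows "z \<in> annulus" "cmod z = 1 / 2 \<or> cmod z = 2"
proof -
  have "closed annulus" using annulus_props(1) by (rule compact_imp_closed)
  with assms show z: "z \<in> annulus" by (auto simp: frontier_def)
  have "ball 0 2 - cball 0 (1 / 2) \<subseteq> interior annulus"
    by (rule interior_maximal) (auto simp: annulus_def open_Diff)
  then have "z \<notin> ball 0 2 - cball 0 (1 / 2)" using assms by (auto simp: frontier_def)
  with z show "cmod z = 1 / 2 \<or> cmod z = 2" by (auto simp: annulus_def)
qed

text \<open>The product \<open>g h\<close> equals \<open>z\<^sup>m h\<^sup>2\<close> and \<open>z\<^sup>-\<^sup>m g\<^sup>2\<close>, hence is small on both boundary circles.\<close>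

lemma annulus_product_bound:
  assumes g: "g \<in> uniform_fns annulus" and h: "h \<in> uniform_fns annulus"
    and gh: "\<And>z. z \<in> annulus \<Longrightarrow> g z = z ^ m * h z"
    and bg: "\<And>z. z \<in> annulus \<Longrightarrow> cmod (g z) \<le> M" and bh: "\<And>z. z \<in> annulus \<Longrightarrow> cmod (h z) \<le> M"
  shows "cmod (g 1 * h 1) \<le> M\<^sup>2 / 2 ^ m"
proof (rule maximum_modulus_frontier[of "\<lambda>z. g z * h z" annulus])
  have "closure annulus = annulus" using annulus_props(1) by (simp add: compact_imp_closed)
  then show "continuous_on (closure annulus) (\<lambda>z. g z * h z)"
    using uniform_fnsD(2)[OF g] uniform_fnsD(2)[OF h] by (simp add: continuous_on_mult)
  show "(\<lambda>z. g z * h z) holomorphic_on interior annulus"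
    by (intro holomorphic_on_mult uniform_fnsD(3)[OF g] uniform_fnsD(3)[OF h])
  show "bounded annulus" using annulus_props(1) by (rule compact_imp_bounded)
  show "1 \<in> annulus" by (rule annulus_props(2))
  fix z assume z: "z \<in> frontier annulus"
  note zA = frontier_annulus(1)[OF z]
  have sq: "cmod x ^ 2 \<le> M\<^sup>2" if "cmod x \<le> M" for x using that by (rule power_mono) simp
  show "cmod (g z * h z) \<le> M\<^sup>2 / 2 ^ m"
  proof (cases "cmod z = 2")
    case True
    have "cmod (g z * h z) * 2 ^ m = cmod (g z) ^ 2"
      using gh[OF zA] True by (simp add: norm_mult norm_power power2_eq_square mult_ac)
    then show ?thesis using sq[OF bg[OF zA]] by (simp add: pos_le_divide_eq)
  next
    case False
    then have half: "cmod z = 1 / 2" using frontier_annulus(2)[OF z] by blast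
    have "cmod (g z * h z) = cmod z ^ m * cmod (h z) ^ 2"
      unfolding gh[OF zA] by (simp add: norm_mult norm_power power2_eq_square)
    also have "\<dots> = cmod (h z) ^ 2 / 2 ^ m" by (simp add: half power_one_over)
    finally show ?thesis using sq[OF bh[OF zA]] by (simp add: divide_right_mono)
  qed
qed

section \<open>The character on the quotient algebra\<close>

locale disk_character =
  fixes n :: nat and r :: ereal and \<rho> :: real
  assumes \<rho>: "0 < \<rho>" "ereal \<rho> < r"
begin

abbreviation "R \<equiv> hol_free_disk n r"
abbreviation "J \<equiv> def_ideal n r"
abbreviation "P \<equiv> deformed_polydisk n r"

interpretation R: ring R by (rule ring_hol_free_disk)

lemma fibre_char_add:
  "f \<in> carrier R \<Longrightarrow> g \<in> carrier R \<Longrightarrow> fibre_char n \<rho> (f \<oplus>\<^bsub>R\<^esub> g) = fibre_char n \<rho> f + fibre_char n \<rho> g"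
  using diag_char_add[OF hol_free_diskD(3)[of f n r 1] hol_free_diskD(3)[of g n r 1] \<rho>]
  by (simp add: fibre_char_def hol_free_disk_simps(5))

lemma fibre_char_mult:
  "f \<in> carrier R \<Longrightarrow> g \<in> carrier R \<Longrightarrow> fibre_char n \<rho> (f \<otimes>\<^bsub>R\<^esub> g) = fibre_char n \<rho> f * fibre_char n \<rho> g"
  using diag_char_mult[OF hol_free_diskD(3)[of f n r 1] hol_free_diskD(3)[of g n r 1] \<rho>]
  by (simp add: fibre_char_def hol_free_disk_simps(2))

lemma fibre_char_scalar: "fibre_char n \<rho> (hol_scalar g) = g 1"
  by (simp add: fibre_char_def hol_scalar_def diag_char_smult diag_char_word_basis words_def)

lemma fibre_char_word: "w \<in> words n \<Longrightarrow> fibre_char n \<rho> (hol_word w) = of_real (\<rho> ^ length w)"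
  by (simp add: fibre_char_def hol_word_def diag_char_word_basis)

lemma fibre_char_minus:
  assumes "f \<in> carrier R" "g \<in> carrier R"
  shows "fibre_char n \<rho> (f \<ominus>\<^bsub>R\<^esub> g) = fibre_char n \<rho> f - fibre_char n \<rho> g"
proof -
  have c: "hol_scalar (\<lambda>_. -1) \<in> carrier R" by (intro hol_scalar_closed holomorphic_on_const)
  show ?thesis
    unfolding hol_free_disk_diff_apply[OF assms] fibre_char_add[OF assms(1) R.m_closed[OF c assms(2)]]
      fibre_char_mult[OF c assms(2)] fibre_char_scalar by simp
qed

lemma topspace_hol_free_disk: "topspace (top_of R) = carrier R"
  by (simp add: hol_free_disk_simps(8))

text \<open>Evaluation at 1 is continuous because a one-point set is compact: the preimage of an
  open set is itself subbasic.\<close>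

lemma continuous_fibre_char: "continuous_map (top_of R) euclidean (fibre_char n \<rho>)"
  unfolding continuous_map_def topspace_hol_free_disk
proof (intro conjI allI impI)
  fix V :: "complex set" assume V: "openin euclidean V"
  have "openin (top_of (free_disk n r)) {a \<in> carrier (free_disk n r). diag_char n \<rho> a \<in> V}"
    using openin_continuous_map_preimage[OF continuous_diag_char[OF \<rho>] V] by simp
  then have "openin (top_of R) {f \<in> carrier R. f ` {1} \<subseteq> {a \<in> carrier (free_disk n r). diag_char n \<rho> a \<in> V}}"
    unfolding hol_free_disk_simps(8) by (intro compact_open_subbasis) auto
  moreover have "{f \<in> carrier R. f ` {1} \<subseteq> {a \<in> carrier (free_disk n r). diag_char n \<rho> a \<in> V}} =
      {f \<in> carrier R. fibre_char n \<rho> f \<in> V}"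
    using hol_free_diskD(3)[of _ n r 1] by (auto simp: fibre_char_def)
  ultimately show "openin (top_of R) {f \<in> carrier R. fibre_char n \<rho> f \<in> V}" by simp
qed simp

lemma ideal_fibre_char: "ideal {f \<in> carrier R. fibre_char n \<rho> f = 0} R"
proof (rule idealI[OF ring_hol_free_disk])
  have zero: "fibre_char n \<rho> \<zero>\<^bsub>R\<^esub> = 0"
    using fibre_char_add[OF R.zero_closed R.zero_closed] by simp
  have neg: "fibre_char n \<rho> (\<ominus>\<^bsub>R\<^esub> f) = - fibre_char n \<rho> f" if "f \<in> carrier R" for f
    using fibre_char_add[OF R.a_inv_closed[OF that] that] that zero
    by (simp add: R.l_neg eq_neg_iff_add_eq_0)
  show "subgroup {f \<in> carrier R. fibre_char n \<rho> f = 0} (add_monoid R)"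
    by (rule R.add.subgroupI) (use zero neg fibre_char_add R.zero_closed in \<open>auto simp flip: a_inv_def\<close>)
qed (auto simp: fibre_char_mult)

lemma closedin_fibre_char: "closedin (top_of R) {f \<in> carrier R. fibre_char n \<rho> f = 0}"
  using closedin_continuous_map_preimage[OF continuous_fibre_char, of "{0}"]
  by (simp add: topspace_hol_free_disk)

lemma generators_eq:
  "{free_gen i \<otimes>\<^bsub>R\<^esub> free_gen j \<ominus>\<^bsub>R\<^esub> act R coordinate (free_gen j \<otimes>\<^bsub>R\<^esub> free_gen i)
      | i j. 1 \<le> i \<and> i < j \<and> j \<le> n} = {commutator n r i j | i j. 1 \<le> i \<and> i < j \<and> j \<le> n}"
  unfolding commutator_def ..

lemma ideal_def_ideal: "ideal J R"
  unfolding def_ideal_def closed_ideal_generated_def generators_eq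
proof (rule R.i_Intersect)
  \<comment> \<open>The intersection of an empty family would be the whole type; the whole ring is a
    member, since it is closed and contains the generators.\<close>
  have "carrier R \<in> {J. ideal J R \<and> closedin (top_of R) J \<and>
      {commutator n r i j | i j. 1 \<le> i \<and> i < j \<and> j \<le> n} \<subseteq> J}"
    using R.oneideal closedin_topspace[of "top_of R"] commutator_closed[of _ n _ r]
    by (auto simp: topspace_hol_free_disk)
  then show "{J. ideal J R \<and> closedin (top_of R) J \<and>
      {commutator n r i j | i j. 1 \<le> i \<and> i < j \<and> j \<le> n} \<subseteq> J} \<noteq> {}" by blast
qed simp

lemma commutator_in_def_ideal: "1 \<le> i \<Longrightarrow> i < j \<Longrightarrow> j \<le> n \<Longrightarrow> commutator n r i j \<in> J"
  unfolding def_ideal_def closed_ideal_generated_def generators_eq by blast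

text \<open>The closed ideal is known only as an intersection, so its elements are not described.
  Instead the kernel of the character is shown to be one of the intersected ideals: it is closed, it
  is an ideal, and at z = 1 the two terms of each generator both have the value \<rho>^2.\<close>

lemma def_ideal_fibre_char: "f \<in> J \<Longrightarrow> fibre_char n \<rho> f = 0"
proof -
  have "fibre_char n \<rho> (commutator n r i j) = 0" if "i \<in> {1..n}" "j \<in> {1..n}" for i j
  proof -
    have c: "hol_scalar (\<lambda>z. z) \<in> carrier R" by (intro hol_scalar_closed holomorphic_on_ident)
    note w = hol_word_closed[OF two_words[OF that(1,2)]] hol_word_closed[OF two_words[OF that(2,1)]]
    show ?thesis
      unfolding commutator_eq[OF that] fibre_char_minus[OF w(1) R.m_closed[OF c w(2)]]
        fibre_char_mult[OF c w(2)] fibre_char_scalar fibre_char_word[OF two_words[OF that(1,2)]]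
        fibre_char_word[OF two_words[OF that(2,1)]] by simp
  qed
  then have "{commutator n r i j | i j. 1 \<le> i \<and> i < j \<and> j \<le> n} \<subseteq> {f \<in> carrier R. fibre_char n \<rho> f = 0}"
    using commutator_closed[of _ n _ r] by auto
  then have "J \<subseteq> {f \<in> carrier R. fibre_char n \<rho> f = 0}"
    unfolding def_ideal_def closed_ideal_generated_def generators_eq
    using ideal_fibre_char closedin_fibre_char by blast
  then show "f \<in> J \<Longrightarrow> fibre_char n \<rho> f = 0" by blast
qed

interpretation J: ideal J R by (rule ideal_def_ideal)
interpretation Q: ring "R Quot J" by (rule J.quotient_is_ring)
interpretation hom: ring_hom_ring R "R Quot J" "(+>\<^bsub>R\<^esub>) J" by (rule J.rcos_ring_hom_ring)

lemma coset_eq: "y \<in> J +>\<^bsub>R\<^esub> x \<Longrightarrow> x \<in> carrier R \<Longrightarrow> y \<in> carrier R \<and> J +>\<^bsub>R\<^esub> y = J +>\<^bsub>R\<^esub> x"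
  using R.a_repr_independence[OF _ _ J.a_subgroup, of y x] R.a_r_coset_subset_G[OF J.a_subset, of x] by auto

lemma fibre_char_coset:
  assumes "x \<in> carrier R" shows "fibre_char n \<rho> ` (J +>\<^bsub>R\<^esub> x) = {fibre_char n \<rho> x}"
proof -
  have eq: "fibre_char n \<rho> y = fibre_char n \<rho> x" if y: "y \<in> J +>\<^bsub>R\<^esub> x" for y
  proof -
    obtain h where h: "h \<in> J" "y = h \<oplus>\<^bsub>R\<^esub> x" using y by (auto simp: a_r_coset_def r_coset_def)
    show ?thesis
      unfolding h(2) fibre_char_add[OF J.a_Hcarr[OF h(1)] assms] def_ideal_fibre_char[OF h(1)] by simp
  qed
  have "fibre_char n \<rho> ` (J +>\<^bsub>R\<^esub> x) = (\<lambda>_. fibre_char n \<rho> x) ` (J +>\<^bsub>R\<^esub> x)"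
    by (rule image_cong[OF refl]) (rule eq)
  also have "\<dots> = {fibre_char n \<rho> x}" using J.a_rcos_self[OF assms] by (rule image_constant)
  finally show ?thesis .
qed

lemma deformed_polydisk_simps:
  "carrier P = (\<lambda>x. J +>\<^bsub>R\<^esub> x) ` carrier R"
  "add P = add (R Quot J)" "zero P = zero (R Quot J)" "monoid.mult P = monoid.mult (R Quot J)"
  by (auto simp: deformed_polydisk_def quotient_tmod_def FactRing_def A_RCOSETS_def RCOSETS_def
      a_r_coset_def)

text \<open>The operations of the quotient are unions over representatives. All members of this
  union coincide and there is at least one, so the union is that coset; \<open>act_coset\<close> and
  \<open>smult_coset\<close> are the two instances.\<close>

lemma scalar_coset:
  assumes g: "g holomorphic_on punctured_plane" and x: "x \<in> carrier R"
  shows "(\<Union>y\<in>J +>\<^bsub>R\<^esub> x. J +>\<^bsub>R\<^esub> (hol_scalar g \<otimes>\<^bsub>R\<^esub> y)) = J +>\<^bsub>R\<^esub> (hol_scalar g \<otimes>\<^bsub>R\<^esub> x)"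
proof -
  have s: "hol_scalar g \<in> carrier R" using g by (rule hol_scalar_closed)
  have "J +>\<^bsub>R\<^esub> (hol_scalar g \<otimes>\<^bsub>R\<^esub> y) = J +>\<^bsub>R\<^esub> (hol_scalar g \<otimes>\<^bsub>R\<^esub> x)" if "y \<in> J +>\<^bsub>R\<^esub> x" for y
    using coset_eq[OF that x] s x by (simp add: hom.hom_mult)
  then show ?thesis using J.a_rcos_self[OF x] by blast
qed

lemma act_coset:
  assumes "g \<in> carrier (hol punctured_plane)" "x \<in> carrier R"
  shows "act P g (J +>\<^bsub>R\<^esub> x) = J +>\<^bsub>R\<^esub> (hol_scalar g \<otimes>\<^bsub>R\<^esub> x)"
proof -
  have "g holomorphic_on punctured_plane" using assms(1) by (simp add: hol_simps)
  then show ?thesis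
    using scalar_coset[OF _ assms(2)]
    by (simp add: deformed_polydisk_def quotient_tmod_def act_hol_free_disk)
qed

lemma smult_coset:
  assumes "x \<in> carrier R"
  shows "c \<odot>\<^bsub>P\<^esub> (J +>\<^bsub>R\<^esub> x) = J +>\<^bsub>R\<^esub> (hol_scalar (\<lambda>_. c) \<otimes>\<^bsub>R\<^esub> x)"
  using scalar_coset[OF holomorphic_on_const assms]
  by (simp add: deformed_polydisk_def quotient_tmod_def smult_hol_free_disk)

lemma add_coset: "x \<in> carrier R \<Longrightarrow> y \<in> carrier R \<Longrightarrow>
    (J +>\<^bsub>R\<^esub> x) \<oplus>\<^bsub>P\<^esub> (J +>\<^bsub>R\<^esub> y) = J +>\<^bsub>R\<^esub> (x \<oplus>\<^bsub>R\<^esub> y)"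
  by (simp add: deformed_polydisk_simps hom.hom_add)

text \<open>The quotient topology is given through the abstraction \<open>topology\<close>, which
  can be unfolded only once the family is known to be a topology; preimages commute with
  intersections and unions.\<close>

lemma openin_deformed_polydisk:
  "openin (top_of P) W \<longleftrightarrow> W \<subseteq> carrier P \<and> openin (top_of R) {x \<in> carrier R. J +>\<^bsub>R\<^esub> x \<in> W}"
proof -
  let ?open = "\<lambda>W. W \<subseteq> carrier (R Quot J) \<and> openin (top_of R) {x \<in> carrier R. J +>\<^bsub>R\<^esub> x \<in> W}"
  have "istopology ?open"
    unfolding istopology_def
  proof (intro conjI allI impI)
    fix S T assume S: "?open S" and T: "?open T"
    have "{x \<in> carrier R. J +>\<^bsub>R\<^esub> x \<in> S \<inter> T} =
        {x \<in> carrier R. J +>\<^bsub>R\<^esub> x \<in> S} \<inter> {x \<in> carrier R. J +>\<^bsub>R\<^esub> x \<in> T}" by blast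
    then show "openin (top_of R) {x \<in> carrier R. J +>\<^bsub>R\<^esub> x \<in> S \<inter> T}" using S T by auto
    show "S \<inter> T \<subseteq> carrier (R Quot J)" using S by blast
  next
    fix \<K> assume K: "\<forall>S\<in>\<K>. ?open S"
    have "{x \<in> carrier R. J +>\<^bsub>R\<^esub> x \<in> \<Union>\<K>} = (\<Union>S\<in>\<K>. {x \<in> carrier R. J +>\<^bsub>R\<^esub> x \<in> S})" by blast
    then show "openin (top_of R) {x \<in> carrier R. J +>\<^bsub>R\<^esub> x \<in> \<Union>\<K>}" using K by auto
    show "\<Union>\<K> \<subseteq> carrier (R Quot J)" using K by blast
  qed
  then show ?thesis
    by (simp add: deformed_polydisk_def quotient_tmod_def topology_inverse')
qed

lemma topspace_deformed_polydisk: "topspace (top_of P) = carrier P"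
proof -
  have "{x \<in> carrier R. J +>\<^bsub>R\<^esub> x \<in> carrier P} = carrier R" by (auto simp: deformed_polydisk_simps)
  then have "openin (top_of P) (carrier P)"
    unfolding openin_deformed_polydisk using openin_topspace[of "top_of R"]
    by (simp add: topspace_hol_free_disk)
  moreover have "topspace (top_of P) \<subseteq> carrier P"
    using openin_topspace[of "top_of P"] unfolding openin_deformed_polydisk by blast
  ultimately show ?thesis by (meson openin_subset subset_antisym)
qed

lemma continuous_quotient_map: "continuous_map (top_of R) (top_of P) (\<lambda>x. J +>\<^bsub>R\<^esub> x)"
  unfolding continuous_map_def topspace_hol_free_disk topspace_deformed_polydisk
  by (auto simp: deformed_polydisk_simps(1) openin_deformed_polydisk)

text \<open>\<open>fibre_char\<close> is constant on each coset, so its image of a coset is a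
  singleton, and \<open>the_elem\<close> extracts the common value.\<close>

definition quotient_char :: "(complex \<Rightarrow> nat list \<Rightarrow> complex) set \<Rightarrow> nat \<Rightarrow> (complex \<Rightarrow> complex) \<times> 'q" where
  "quotient_char q = encode (\<lambda>z\<in>{1}. the_elem (fibre_char n \<rho> ` q))"

lemma quotient_char_coset:
  "x \<in> carrier R \<Longrightarrow> quotient_char (J +>\<^bsub>R\<^esub> x) = encode (\<lambda>z\<in>{1}. fibre_char n \<rho> x)"
  by (simp add: quotient_char_def fibre_char_coset)

lemma const_closed: "encode (\<lambda>z\<in>{1}. c) \<in> carrier (uniform_module {1})"
  by (simp add: uniform_module_simps uniform_fns_closed)

lemma continuous_quotient_char:
  "continuous_map (top_of P) (top_of
    (uniform_module {1} :: (complex \<Rightarrow> complex, nat \<Rightarrow> (complex \<Rightarrow> complex) \<times> 'q) tmod)) quotient_char"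
    (is "continuous_map _ (top_of ?Y) _")
proof -
  have one: "compact {1 :: complex}" "{1 :: complex} \<noteq> {}" by auto
  have "continuous_map euclidean (top_of ?Y) (\<lambda>c. encode (\<lambda>z\<in>{1}. c))"
    unfolding continuous_map_atin
  proof
    fix c :: complex
    have id: "((\<lambda>x. x) \<longlongrightarrow> c) (atin euclidean c)"
      using limitin_atin_self_id[of c euclidean] by simp
    have "\<forall>\<^sub>F x in atin euclidean c.
        uniform_norm {1} (encode (\<lambda>z\<in>{1}. x) \<ominus>\<^bsub>?Y\<^esub> encode (\<lambda>z\<in>{1}. c)) < \<epsilon>" if "0 < \<epsilon>" for \<epsilon>
      using tendstoD[OF id that]
      by eventually_elim
        (simp add: uniform_module_minus[OF uniform_fns_closed(1) uniform_fns_closed(1)] uniform_norm_def dist_norm)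
    then show "limitin (top_of ?Y) (\<lambda>c. encode (\<lambda>z\<in>{1}. c)) (encode (\<lambda>z\<in>{1}. c)) (atin euclidean c)"
      unfolding limitin_uniform_module[OF one]
      by (simp add: const_closed)
  qed
  then have "continuous_map (top_of R) (top_of ?Y) ((\<lambda>c. encode (\<lambda>z\<in>{1}. c)) \<circ> fibre_char n \<rho>)"
    by (rule continuous_map_compose[OF continuous_fibre_char])
  \<comment> \<open>Continuity on the quotient is a matter of the composite with the projection,
    which this establishes.\<close>
  then have cont: "continuous_map (top_of R) (top_of ?Y) (\<lambda>x. quotient_char (J +>\<^bsub>R\<^esub> x))"
    by (rule continuous_map_eq) (simp add: topspace_hol_free_disk quotient_char_coset)
  show ?thesis
    unfolding continuous_map_def topspace_deformed_polydisk openin_deformed_polydisk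
  proof (intro conjI allI impI)
    show "quotient_char \<in> carrier P \<rightarrow> topspace (top_of ?Y)"
      using const_closed by (auto simp: top_of_uniform_module deformed_polydisk_simps(1) quotient_char_coset)
    fix V assume "openin (top_of ?Y) V"
    from openin_continuous_map_preimage[OF cont this]
    have "openin (top_of R) {x \<in> carrier R. quotient_char (J +>\<^bsub>R\<^esub> x) \<in> V}"
      by (simp add: topspace_hol_free_disk)
    moreover have "{x \<in> carrier R. J +>\<^bsub>R\<^esub> x \<in> {q \<in> carrier P. quotient_char q \<in> V}} =
        {x \<in> carrier R. quotient_char (J +>\<^bsub>R\<^esub> x) \<in> V}"
      by (auto simp: deformed_polydisk_simps(1))
    ultimately show "openin (top_of R) {x \<in> carrier R. J +>\<^bsub>R\<^esub> x \<in> {q \<in> carrier P. quotient_char q \<in> V}}"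
      by simp
  qed blast
qed

lemma tmod_hom_quotient_char: "tmod_hom (hol punctured_plane) P (uniform_module {1}) quotient_char"
  unfolding tmod_hom_def continuous_linear_def
proof (intro conjI ballI allI continuous_quotient_char)
  show "quotient_char \<in> carrier P \<rightarrow> carrier (uniform_module {1})"
    using const_closed by (auto simp: deformed_polydisk_simps(1) quotient_char_coset)
  fix p q assume "p \<in> carrier P" "q \<in> carrier P"
  then obtain x y where xy: "x \<in> carrier R" "y \<in> carrier R" "p = J +>\<^bsub>R\<^esub> x" "q = J +>\<^bsub>R\<^esub> y"
    by (auto simp: deformed_polydisk_simps(1))
  show "quotient_char (p \<oplus>\<^bsub>P\<^esub> q) = quotient_char p \<oplus>\<^bsub>uniform_module {1}\<^esub> quotient_char q"
    using xy by (simp add: add_coset quotient_char_coset fibre_char_add uniform_module_simps(3) del: hom.hom_add hom.hom_mult cong: restrict_cong)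
next
  fix c p assume "p \<in> carrier P"
  then obtain x where x: "x \<in> carrier R" "p = J +>\<^bsub>R\<^esub> x" by (auto simp: deformed_polydisk_simps(1))
  have s: "hol_scalar (\<lambda>_. c) \<in> carrier R" by (intro hol_scalar_closed holomorphic_on_const)
  show "quotient_char (c \<odot>\<^bsub>P\<^esub> p) = c \<odot>\<^bsub>uniform_module {1}\<^esub> quotient_char p"
    using x s by (simp add: smult_coset quotient_char_coset fibre_char_mult fibre_char_scalar
        uniform_module_simps(4) del: hom.hom_add hom.hom_mult cong: restrict_cong)
next
  fix g p assume g: "g \<in> carrier (hol punctured_plane)" and "p \<in> carrier P"
  then obtain x where x: "x \<in> carrier R" "p = J +>\<^bsub>R\<^esub> x" by (auto simp: deformed_polydisk_simps(1))
  have s: "hol_scalar g \<in> carrier R" using g by (intro hol_scalar_closed) (simp add: hol_simps)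
  show "quotient_char (act P g p) = act (uniform_module {1}) g (quotient_char p)"
    using x s g by (simp add: act_coset quotient_char_coset fibre_char_mult fibre_char_scalar
        uniform_module_simps(5) del: hom.hom_add hom.hom_mult cong: restrict_cong)
qed

section \<open>Powers of generators in the quotient\<close>

lemma hol_word_replicate:
  assumes "i \<in> {1..n}" shows "hol_word (replicate k i) = hol_word [i] [^]\<^bsub>R\<^esub> k"
proof (induction k)
  case 0 then show ?case by (simp add: hol_word_def hol_free_disk_simps(3))
next
  case (Suc k)
  have "hol_word (replicate (Suc k) i) = hol_word (replicate k i) \<otimes>\<^bsub>R\<^esub> hol_word [i]"
    by (simp add: hol_word_append replicate_append_same)
  then show ?case by (simp add: Suc)
qed

lemma hol_scalar_power: "hol_scalar (\<lambda>z. z ^ k) = hol_scalar (\<lambda>z. z) [^]\<^bsub>R\<^esub> k"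
proof (induction k)
  case 0 then show ?case by (simp add: hol_scalar_def hol_free_disk_simps(3))
next
  case (Suc k)
  have "hol_scalar (\<lambda>z. z ^ Suc k) = hol_scalar (\<lambda>z. z ^ k) \<otimes>\<^bsub>R\<^esub> hol_scalar (\<lambda>z. z)"
    unfolding hol_scalar_mult by (simp add: hol_scalar_def mult_ac cong: restrict_cong)
  then show ?case by (simp add: Suc)
qed

lemma hol_scalar_central: "hol_scalar g \<otimes>\<^bsub>R\<^esub> x = x \<otimes>\<^bsub>R\<^esub> hol_scalar g"
  by (simp only: hol_scalar_mult)

lemma words_replicate: "i \<in> {1..n} \<Longrightarrow> j \<in> {1..n} \<Longrightarrow> replicate k i @ replicate m j \<in> words n"
  by (auto simp: words_def)

text \<open>In the quotient the coordinate is a central element \<open>?Z\<close> with \<zeta>_i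
  \<zeta>_j = \<open>?Z\<close> \<zeta>_j \<zeta>_i, so \<open>pow_mult_pow_swap\<close> applies;
  the power of \<open>?Z\<close> is then read as the action of a function.\<close>

lemma word_swap:
  assumes ij: "1 \<le> i" "i < j" "j \<le> n"
  shows "J +>\<^bsub>R\<^esub> hol_word (replicate k i @ replicate k j) =
    act P (\<lambda>z\<in>punctured_plane. z ^ (k * k)) (J +>\<^bsub>R\<^esub> hol_word (replicate k j @ replicate k i))"
proof -
  let ?a = "J +>\<^bsub>R\<^esub> hol_word [i]" and ?b = "J +>\<^bsub>R\<^esub> hol_word [j]" and ?Z = "J +>\<^bsub>R\<^esub> hol_scalar (\<lambda>z. z)"
  have ij': "i \<in> {1..n}" "j \<in> {1..n}" using ij by auto
  have Zc: "hol_scalar (\<lambda>z. z) \<in> carrier R" by (intro hol_scalar_closed holomorphic_on_ident)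
  have ac: "hol_word [i] \<in> carrier R" and bc: "hol_word [j] \<in> carrier R"
    by (rule hol_word_closed; use ij' in \<open>simp add: words_def\<close>)+
  note w = hol_word_closed[OF two_words[OF ij'(1,2)], of r] hol_word_closed[OF two_words[OF ij'(2,1)], of r]
  have "J +>\<^bsub>R\<^esub> hol_word [i, j] = J +>\<^bsub>R\<^esub> (hol_scalar (\<lambda>z. z) \<otimes>\<^bsub>R\<^esub> hol_word [j, i])"
    using commutator_in_def_ideal[OF ij] R.quotient_eq_iff_same_a_r_cos[OF ideal_def_ideal w(1) R.m_closed[OF Zc w(2)]]
    unfolding commutator_eq[OF ij'] by blast
  then have ab: "?a \<otimes>\<^bsub>R Quot J\<^esub> ?b = ?Z \<otimes>\<^bsub>R Quot J\<^esub> (?b \<otimes>\<^bsub>R Quot J\<^esub> ?a)"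
    unfolding hom.hom_mult[OF ac bc, symmetric] hom.hom_mult[OF bc ac, symmetric] hol_word_append
      append_Cons append_Nil hom.hom_mult[OF Zc w(2), symmetric] .
  have central: "?Z \<otimes>\<^bsub>R Quot J\<^esub> q = q \<otimes>\<^bsub>R Quot J\<^esub> ?Z" if q: "q \<in> carrier (R Quot J)" for q
  proof -
    obtain x where x: "x \<in> carrier R" "q = J +>\<^bsub>R\<^esub> x"
      using q by (auto simp: FactRing_def A_RCOSETS_def RCOSETS_def a_r_coset_def)
    show ?thesis
      unfolding x(2) hom.hom_mult[OF Zc x(1), symmetric] hom.hom_mult[OF x(1) Zc, symmetric]
      by (simp only: hol_scalar_central)
  qed
  note cl = hom.hom_closed[OF ac] hom.hom_closed[OF bc] hom.hom_closed[OF Zc]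
  \<comment> \<open>Stated for fresh \<open>i\<close> and \<open>j\<close>, because it serves both
    orders of the two letters.\<close>
  have pow: "J +>\<^bsub>R\<^esub> hol_word (replicate k i @ replicate m j) =
      (J +>\<^bsub>R\<^esub> hol_word [i]) [^]\<^bsub>R Quot J\<^esub> k \<otimes>\<^bsub>R Quot J\<^esub> (J +>\<^bsub>R\<^esub> hol_word [j]) [^]\<^bsub>R Quot J\<^esub> m"
    if "i \<in> {1..n}" "j \<in> {1..n}" "hol_word [i] \<in> carrier R" "hol_word [j] \<in> carrier R" for i j and k m :: nat
    unfolding hol_word_append[symmetric, where n = n and r = r] hol_word_replicate[OF that(1)] hol_word_replicate[OF that(2)]
    by (simp only: hom.hom_mult hom.hom_nat_pow R.nat_pow_closed that)
  let ?v = "hol_word (replicate k j @ replicate k i)"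
  have vc: "?v \<in> carrier R" by (intro hol_word_closed words_replicate ij')
  have "J +>\<^bsub>R\<^esub> hol_word (replicate k i @ replicate k j) =
      ?Z [^]\<^bsub>R Quot J\<^esub> (k * k) \<otimes>\<^bsub>R Quot J\<^esub> (?b [^]\<^bsub>R Quot J\<^esub> k \<otimes>\<^bsub>R Quot J\<^esub> ?a [^]\<^bsub>R Quot J\<^esub> k)"
    unfolding pow[OF ij' ac bc] by (rule Q.pow_mult_pow_swap[OF cl central ab])
  also have "\<dots> = J +>\<^bsub>R\<^esub> (hol_scalar (\<lambda>z. z ^ (k * k)) \<otimes>\<^bsub>R\<^esub> ?v)"
    unfolding pow[OF ij'(2,1) bc ac, symmetric] hol_scalar_power
    by (simp only: hom.hom_mult hom.hom_nat_pow R.nat_pow_closed Zc vc)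
  also have "hol_scalar (\<lambda>z. z ^ (k * k)) = hol_scalar (\<lambda>z\<in>punctured_plane. z ^ (k * k))"
    by (simp add: hol_scalar_def cong: restrict_cong)
  also have "J +>\<^bsub>R\<^esub> (\<dots> \<otimes>\<^bsub>R\<^esub> ?v) = act P (\<lambda>z\<in>punctured_plane. z ^ (k * k)) (J +>\<^bsub>R\<^esub> ?v)"
    by (rule act_coset[OF holI[OF coordinate_holomorphic] vc, symmetric])
  finally show ?thesis .
qed

text \<open>The seminorm of the k-th term is at most \<rho>'^(2k) \<tau>^2 / k!, which tends to 0
  for all \<rho>' and \<tau>: the factorial is one normalization that works for every seminorm
  simultaneously.\<close>

lemma limitin_hol_word:
  assumes w: "\<And>k. w k \<in> words n" "\<And>k. length (w k) = 2 * k"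
    "\<And>k. length (remdups_adj (w k)) \<le> 2"
  shows "limitin (top_of R) (\<lambda>k. hol_scalar (\<lambda>_. 1 / fact k) \<otimes>\<^bsub>R\<^esub> hol_word (w k)) \<zero>\<^bsub>R\<^esub> sequentially"
proof -
  define c where "c k \<alpha> = 1 / fact k * word_basis (w k) \<alpha>" for k \<alpha>
  have cc: "c k \<in> carrier (free_disk n r)" for k
    unfolding c_def[abs_def] by (intro free_disk_smult_closed word_basis_closed w)
  \<comment> \<open>These functions are constant in z, so compact-open convergence reduces to
    convergence of their values.\<close>
  have s: "hol_scalar (\<lambda>_. 1 / fact k) \<otimes>\<^bsub>R\<^esub> hol_word (w k) = (\<lambda>z\<in>punctured_plane. c k)" for k
    unfolding hol_scalar_mult by (simp add: hol_word_def c_def[abs_def] cong: restrict_cong)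
  have lim: "limitin (top_of (free_disk n r)) c (\<lambda>\<alpha>. 0) sequentially"
    unfolding limitin_free_disk
  proof (intro conjI allI impI free_disk_zero_closed)
    show "\<forall>\<^sub>F k in sequentially. c k \<in> carrier (free_disk n r)" using cc by simp
    fix \<rho>' \<tau> assume rt: "admissible_radii r \<rho>' \<tau>"
    have "(\<lambda>k. (\<rho>'\<^sup>2) ^ k / fact k) \<longlonglongrightarrow> 0"
      using summable_LIMSEQ_zero[OF summable_exp[of "\<rho>'\<^sup>2"]] by (simp add: divide_inverse mult.commute)
    then have lim0: "(\<lambda>k. (\<rho>'\<^sup>2) ^ k / fact k * \<tau>\<^sup>2) \<longlonglongrightarrow> 0" by (rule tendsto_mult_left_zero)
    show "(\<lambda>k. free_disk_norm n \<rho>' \<tau> (\<lambda>\<alpha>. c k \<alpha> - 0)) \<longlonglongrightarrow> 0"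
    proof (rule tendsto_sandwich[OF always_eventually always_eventually tendsto_const lim0])
      show "\<forall>k. 0 \<le> free_disk_norm n \<rho>' \<tau> (\<lambda>\<alpha>. c k \<alpha> - 0)" using free_disk_norm_nonneg[OF rt] by blast
      show "\<forall>k. free_disk_norm n \<rho>' \<tau> (\<lambda>\<alpha>. c k \<alpha> - 0) \<le> (\<rho>'\<^sup>2) ^ k / fact k * \<tau>\<^sup>2"
      proof
        fix k
        have "free_disk_norm n \<rho>' \<tau> (\<lambda>\<alpha>. c k \<alpha> - 0) = 1 / fact k * word_weight \<rho>' \<tau> (w k)"
          unfolding c_def diff_zero free_disk_norm_smult free_disk_norm_word_basis[OF w(1)]
          by (simp add: norm_divide)
        also have "word_weight \<rho>' \<tau> (w k) \<le> (\<rho>'\<^sup>2) ^ k * \<tau>\<^sup>2"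
          unfolding word_weight_def w(2) power_mult
          using rt by (intro mult_left_mono power_increasing w) (auto simp: admissible_radii_def)
        finally show "free_disk_norm n \<rho>' \<tau> (\<lambda>\<alpha>. c k \<alpha> - 0) \<le> (\<rho>'\<^sup>2) ^ k / fact k * \<tau>\<^sup>2"
          by (simp add: divide_right_mono)
      qed
    qed
  qed
  have closed: "(\<lambda>z\<in>punctured_plane. c k) \<in> carrier R" for k by (rule hol_free_disk_const[OF cc])
  show ?thesis
    unfolding s hol_free_disk_simps(8) compact_open_def limitin_topology_generated_by
  proof (intro conjI ballI impI)
    have "\<zero>\<^bsub>R\<^esub> \<in> topspace (top_of R)" by (simp add: topspace_hol_free_disk)
    then show "\<zero>\<^bsub>R\<^esub> \<in> \<Union>{{f \<in> carrier R. f ` K \<subseteq> V} | K V.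
        compact K \<and> K \<subseteq> punctured_plane \<and> openin (top_of (free_disk n r)) V}"
      unfolding hol_free_disk_simps(8) compact_open_def topology_generated_by_topspace .
    fix S assume "S \<in> {{f \<in> carrier R. f ` K \<subseteq> V} | K V.
        compact K \<and> K \<subseteq> punctured_plane \<and> openin (top_of (free_disk n r)) V}"
    then obtain K V where S: "S = {f \<in> carrier R. f ` K \<subseteq> V}" "K \<subseteq> punctured_plane"
      "openin (top_of (free_disk n r)) V" by blast
    assume "\<zero>\<^bsub>R\<^esub> \<in> S"
    then have zero: "\<zero>\<^bsub>R\<^esub> ` K \<subseteq> V" by (simp add: S(1))
    show "\<forall>\<^sub>F k in sequentially. (\<lambda>z\<in>punctured_plane. c k) \<in> S"
    proof (cases "K = {}")
      \<comment> \<open>For empty \<open>K\<close> nothing places zero in \<open>V\<close>, but the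
        subbasic set is then the whole carrier.\<close>
      case True then show ?thesis using closed by (simp add: S(1))
    next
      case False
      then obtain z where "z \<in> K" by blast
      then have "(\<lambda>\<alpha>. 0) \<in> V" using zero S(2) by (auto simp: hol_free_disk_simps(4))
      then have "\<forall>\<^sub>F k in sequentially. c k \<in> V" using limitinD[OF lim S(3)] by blast
      then show ?thesis
        by eventually_elim (use closed S(2) in \<open>auto simp: S(1)\<close>)
    qed
  qed
qed

text \<open>A continuous linear map sends the null sequence of words divided by k! to a null
  sequence in the uniform norm. Eventually its norms are below 1, and undoing the normalization
  gives the bound k!.\<close>

lemma word_growth:
  fixes \<psi> :: "_ \<Rightarrow> nat \<Rightarrow> (complex \<Rightarrow> complex) \<times> 'q"
  assumes \<psi>: "tmod_hom (hol punctured_plane) P (uniform_module K) \<psi>" and K: "compact K" "K \<noteq> {}"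
    and w: "\<And>k. w k \<in> words n" "\<And>k. length (w k) = 2 * k" "\<And>k. length (remdups_adj (w k)) \<le> 2"
  shows "\<forall>\<^sub>F k in sequentially. \<forall>z\<in>K. cmod (decode (\<psi> (J +>\<^bsub>R\<^esub> hol_word (w k))) z) \<le> fact k"
proof -
  let ?X = "uniform_module K :: (complex \<Rightarrow> complex, nat \<Rightarrow> (complex \<Rightarrow> complex) \<times> 'q) tmod"
  let ?s = "\<lambda>k. hol_scalar (\<lambda>_. 1 / fact k) \<otimes>\<^bsub>R\<^esub> hol_word (w k)"
  let ?g = "\<lambda>k. decode (\<psi> (J +>\<^bsub>R\<^esub> hol_word (w k)))"
  have lin: "continuous_linear P ?X \<psi>" using \<psi> by (simp add: tmod_hom_def)
  have smult: "\<psi> (J +>\<^bsub>R\<^esub> (hol_scalar (\<lambda>_. c) \<otimes>\<^bsub>R\<^esub> x)) = encode (\<lambda>z\<in>K. c * decode (\<psi> (J +>\<^bsub>R\<^esub> x)) z)"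
    if x: "x \<in> carrier R" for c x
  proof -
    have "J +>\<^bsub>R\<^esub> x \<in> carrier P" using x by (simp add: deformed_polydisk_simps(1))
    then have "\<psi> (c \<odot>\<^bsub>P\<^esub> (J +>\<^bsub>R\<^esub> x)) = c \<odot>\<^bsub>?X\<^esub> \<psi> (J +>\<^bsub>R\<^esub> x)"
      using lin unfolding continuous_linear_def by blast
    then show ?thesis unfolding smult_coset[OF x] uniform_module_simps(4) .
  qed
  have wc: "hol_word (w k) \<in> carrier R" for k by (rule hol_word_closed[OF w(1)])
  have g: "?g k \<in> uniform_fns K" for k
  proof -
    have "\<psi> (J +>\<^bsub>R\<^esub> hol_word (w k)) \<in> carrier ?X"
      by (rule continuous_linear_closed[OF lin]) (simp add: deformed_polydisk_simps(1) wc)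
    then show ?thesis by (auto simp: uniform_module_simps(1))
  qed
  have "hol_scalar (\<lambda>_. 0) \<otimes>\<^bsub>R\<^esub> \<zero>\<^bsub>R\<^esub> = \<zero>\<^bsub>R\<^esub>"
    by (rule R.r_null) (intro hol_scalar_closed holomorphic_on_const)
  then have zero: "\<psi> (J +>\<^bsub>R\<^esub> \<zero>\<^bsub>R\<^esub>) = encode (\<lambda>z\<in>K. 0)"
    using smult[OF R.zero_closed, of 0] by simp
  have "continuous_map (top_of R) (top_of ?X) (\<psi> \<circ> (\<lambda>x. J +>\<^bsub>R\<^esub> x))"
    by (rule continuous_map_compose[OF continuous_quotient_map]) (use lin in \<open>simp add: continuous_linear_def\<close>)
  from continuous_map_limit[OF this limitin_hol_word[OF w]]
  have "limitin (top_of ?X) (\<lambda>k. \<psi> (J +>\<^bsub>R\<^esub> ?s k)) (encode (\<lambda>z\<in>K. 0)) sequentially"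
    by (simp only: o_def zero)
  then have "\<forall>\<^sub>F k in sequentially. uniform_norm K (\<psi> (J +>\<^bsub>R\<^esub> ?s k) \<ominus>\<^bsub>?X\<^esub> encode (\<lambda>z\<in>K. 0)) < 1"
    unfolding limitin_uniform_module[OF K] by (elim conjE allE[of _ 1]) simp
  then show ?thesis
  proof eventually_elim
    case (elim k)
    let ?f = "\<lambda>z\<in>K. 1 / fact k * ?g k z"
    have f: "?f \<in> uniform_fns K" using g by (rule uniform_fns_closed(4))
    have "uniform_norm K (encode (\<lambda>z\<in>K. ?f z - (\<lambda>z\<in>K. 0) z) :: nat \<Rightarrow> (complex \<Rightarrow> complex) \<times> 'q) < 1"
      using elim unfolding smult[OF wc] uniform_module_minus[OF f uniform_fns_closed(1)] .
    then have bound: "cmod ((\<lambda>z\<in>K. ?f z - (\<lambda>z\<in>K. 0) z) z) < 1" if "z \<in> K" for z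
      by (rule order.strict_trans1[OF uniform_norm_ge[OF K uniform_fns_closed(3)[OF f uniform_fns_closed(1)] that]])
    show ?case
    proof
      fix z assume z: "z \<in> K"
      have "cmod (?g k z) / fact k < 1" using bound[OF z] z by (simp add: norm_divide)
      then show "cmod (?g k z) \<le> fact k" by (simp add: pos_divide_less_eq)
    qed
  qed
qed

text \<open>For k large enough, the value of g h at 1 that the character prescribes exceeds the
  bound that the maximum principle allows. The parameter 'q stays free so that both lifting problems
  are covered.\<close>

lemma no_lift:
  fixes \<psi> :: "_ \<Rightarrow> nat \<Rightarrow> (complex \<Rightarrow> complex) \<times> 'q"
  assumes n: "2 \<le> n" and \<psi>: "tmod_hom (hol punctured_plane) P (uniform_module annulus) \<psi>"
    and lift: "\<And>x. x \<in> carrier P \<Longrightarrow>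
      encode (restrict (decode (\<psi> x)) {1}) = (quotient_char x :: nat \<Rightarrow> (complex \<Rightarrow> complex) \<times> 'q)"
  shows False
proof -
  note K = annulus_props(1,3)
  define v where "v i j k = replicate k i @ replicate k j" for i j k :: nat
  define g where "g i j k = decode (\<psi> (J +>\<^bsub>R\<^esub> hol_word (v i j k)))" for i j k
  have vw: "v i j k \<in> words n" if "i \<in> {1..n}" "j \<in> {1..n}" for i j k
    unfolding v_def using that by (rule words_replicate)
  have len: "length (v i j k) = 2 * k" for i j k by (simp add: v_def)
  have blocks: "length (remdups_adj (v i j k)) \<le> 2" for i j k
  proof -
    have "length (remdups_adj (replicate k i)) \<le> 1" for i :: nat by (simp add: remdups_adj_replicate)
    from add_mono[OF this[of i] this[of j]] show ?thesis
      unfolding v_def using length_remdups_adj_append[of "replicate k i" "replicate k j"] by simp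
  qed
  have vc: "J +>\<^bsub>R\<^esub> hol_word (v i j k) \<in> carrier P" if "i \<in> {1..n}" "j \<in> {1..n}" for i j k
    using hol_word_closed[OF vw[OF that]] by (simp add: deformed_polydisk_simps(1))
  have gK: "g i j k \<in> uniform_fns annulus" if "i \<in> {1..n}" "j \<in> {1..n}" for i j k
  proof -
    have "\<psi> (J +>\<^bsub>R\<^esub> hol_word (v i j k)) \<in> carrier (uniform_module annulus)"
      using \<psi> by (intro continuous_linear_closed[OF _ vc[OF that]]) (simp add: tmod_hom_def)
    then show ?thesis by (auto simp: uniform_module_simps(1) g_def)
  qed
  have g1: "g i j k 1 = of_real (\<rho> ^ (2 * k))" if "i \<in> {1..n}" "j \<in> {1..n}" for i j k
  proof -
    have "encode (restrict (g i j k) {1}) =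
        (encode (\<lambda>z\<in>{1}. of_real (\<rho> ^ (2 * k))) :: nat \<Rightarrow> (complex \<Rightarrow> complex) \<times> 'q)"
      unfolding g_def lift[OF vc[OF that]] quotient_char_coset[OF hol_word_closed[OF vw[OF that]]]
        fibre_char_word[OF vw[OF that]] len ..
    then have "restrict (g i j k) {1} = (\<lambda>z\<in>{1}. of_real (\<rho> ^ (2 * k)))" by (simp only: encode_inject)
    then have "restrict (g i j k) {1} 1 = (\<lambda>z\<in>{1}. of_real (\<rho> ^ (2 * k))) 1" by simp
    then show ?thesis by simp
  qed
  have one: "1 \<in> {1..n}" and two: "2 \<in> {1..n}" using n by auto
  have swap: "g 1 2 k z = z ^ (k * k) * g 2 1 k z" if z: "z \<in> annulus" for k z
  proof -
    let ?a = "\<lambda>z\<in>punctured_plane. z ^ (k * k)" and ?p = "J +>\<^bsub>R\<^esub> hol_word (v 2 1 k)"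
    have "\<psi> (act P ?a ?p) = act (uniform_module annulus) ?a (\<psi> ?p)"
      using \<psi> holI[OF coordinate_holomorphic] vc[OF two one] unfolding tmod_hom_def by blast
    moreover have "J +>\<^bsub>R\<^esub> hol_word (v 1 2 k) = act P ?a ?p"
      unfolding v_def by (rule word_swap) (use n in auto)
    ultimately have "g 1 2 k = (\<lambda>z\<in>annulus. ?a z * g 2 1 k z)"
      by (simp only: g_def uniform_module_simps(5) decode_encode)
    then show ?thesis using z annulus_props(4) by auto
  qed
  have growth: "\<forall>\<^sub>F k in sequentially. \<forall>z\<in>annulus. cmod (g i j k z) \<le> fact k"
    if "i \<in> {1..n}" "j \<in> {1..n}" for i j
    unfolding g_def by (rule word_growth[OF \<psi> K vw[OF that] len blocks])
  \<comment> \<open>Each of the two words has 2k letters, so the product of their values at 1 is the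
    k-th power of \<rho>^4.\<close>
  have "0 < \<rho> ^ 4" using \<rho>(1) by simp
  note fact_square_less_exponential[OF this]
  \<comment> \<open>Three facts hold for all large k; together they are contradictory, so falsity
    would hold eventually along a nontrivial filter.\<close>
  then have "\<forall>\<^sub>F k :: nat in sequentially. False"
    using growth[OF one two] growth[OF two one]
  proof eventually_elim
    case (elim k)
    have "cmod (g 1 2 k 1 * g 2 1 k 1) \<le> (fact k)\<^sup>2 / 2 ^ (k * k)"
      using elim by (intro annulus_product_bound gK one two swap) auto
    moreover have "cmod (g 1 2 k 1 * g 2 1 k 1) = (\<rho> ^ 4) ^ k"
      unfolding g1[OF one two] g1[OF two one] norm_mult norm_of_real
      using \<rho>(1) by (simp flip: power_add power_mult)
    ultimately have "(\<rho> ^ 4) ^ k * 2 ^ (k * k) \<le> (fact k)\<^sup>2" by (simp add: pos_le_divide_eq)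
    then show False using elim(1) by simp
  qed
  then show False by simp
qed

end

theorem theorem6p4:
  fixes n :: nat and r :: ereal
  assumes "2 \<le> n" and "0 < r"
  shows "\<not> topologically_projective (hol punctured_plane) (deformed_polydisk n r) \<and>
         \<not> topologically_free TYPE('e) (hol punctured_plane) (deformed_polydisk n r)"
proof -
  \<comment> \<open>As \<open>r\<close> may be infinite, a finite real radius below it is
    chosen.\<close>
  obtain \<rho> where \<rho>: "0 < \<rho>" "ereal \<rho> < r"
    using ereal_dense2[OF assms(2)] by auto
  interpret disk_character n r \<rho> by unfold_locales (rule \<rho>)+
  let ?A = "hol punctured_plane" and ?P = "deformed_polydisk n r"
  have one: "compact {1 :: complex}" "{1 :: complex} \<noteq> {}" "{1 :: complex} \<subseteq> punctured_plane" by auto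
  note X = frechet_module_uniform_module[OF annulus_props(1,3,4)]
    and Y = frechet_module_uniform_module[OF one]
    and \<sigma> = admissible_epi_restrict[OF annulus_props(1,2,4)]
  have "\<not> topologically_projective ?A ?P"
  proof
    assume "topologically_projective ?A ?P"
    from this[unfolded topologically_projective_def, rule_format, OF conjI[OF X conjI[OF Y \<sigma>]] tmod_hom_quotient_char]
    show False by (elim exE conjE) (erule no_lift[OF assms(1)], drule (1) bspec, assumption)
  qed
  \<comment> \<open>Freeness involves an arbitrary type 'e, while projectivity is tested in a type
    fixed by the quotient. The same lifting problem is therefore posed again in the type belonging
    to 'e.\<close>
  moreover have "\<not> topologically_free TYPE('e) ?A ?P"
  proof
    assume free: "topologically_free TYPE('e) ?A ?P"
    have "topspace (top_of ?A) = carrier ?A" by (simp add: hol_simps(6))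
    from topologically_free_lifting[OF this monoid_hol free X Y \<sigma> tmod_hom_quotient_char]
    show False by (elim exE conjE) (erule no_lift[OF assms(1)], drule (1) bspec, assumption)
  qed
  ultimately show ?thesis by simp
qed

end
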